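(* [Jackson estimate] Let $\alpha>0$, $\tau:=1/\alpha$, let $k\ge 2$ be an integer, and let $\mathcal I$ be a regular multilevel partition of $\mathbb R$. If $f\in \dot B^{\alpha,k}_\tau$ (where, by convention, $f$ denotes the canonical representative of its class modulo $\Pi_k$), then $f\in \mathrm{VMO}$ and $$\sigma_n(f,\mathcal I)_{\mathrm{BMO}}\le c\,n^{-\alpha}\,\|f\|_{\dot B^{\alpha,k}_\tau},\qquad n\in\mathbb N,$$ where $c>0$ is a constant depending only on $\alpha$, $k$, and the parameters of $\mathcal I$.
   Context: All functions are complex-valued. $\Pi_k$ is the set of univariate algebraic polynomials of degree at most $k-1$. BMO and VMO: $\|f\|_{\mathrm{BMO}}:=\sup_J \frac1{|J|}\int_J|f-\mathrm{Avg}_J f|\,dx$ over all compact intervals $J\subset\mathbb R$, with $\mathrm{Avg}_Jf=\frac1{|J|}\int_J f$. $\mathrm{BMO}$ is the set of $f\in L^1_{loc}(\mathbb R)$ with $\|f\|_{\mathrm{BMO}}<\infty$, functions differing by a constant being identified; $\mathrm{VMO}$ is the closure in the BMO norm of the set $C_0(\mathbb R)$ of continuous compactly supported functions. Regular multilevel partition: $\mathcal I=\bigcup_{m\in\mathbb Z}\mathcal I_m$, where (a) each $\mathcal I_m$ is a partition of $\mathbb R$ into compact intervals with disjoint interiors, $\mathcal I_m=\{[x_{m,j},x_{m,j+1}]:j\in\mathbb Z\}$ with $\cdots<x_{m,-1}<x_{m,0}<x_{m,1}<\cdots$; (b) $\mathcal I_{m+1}$ refines $\mathcal I_m$ and each $I\in\mathcal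 I_m$ has at least two and at most $M_0$ children in $\mathcal I_{m+1}$, $M_0\ge2$ a constant; (c) there is a constant $\lambda\ge1$ with $|I'|\le\lambda|I''|$ for all $I',I''\in\mathcal I_m$, $m\in\mathbb Z$. The parameters of $\mathcal I$ are $M_0,\lambda$. B-splines: $\mathcal Q_m:=\{[x_{m,j},x_{m,j+k}]:j\in\mathbb Z\}$, $\mathcal Q:=\bigcup_m\mathcal Q_m$ (elements are indexed together with their level). For $Q=[x_{m,j},x_{m,j+k}]\in\mathcal Q_m$, $\varphi_Q$ is the B-spline of degree $k-1$ with knots $x_{m,j},\dots,x_{m,j+k}$, normalized so that the B-splines of each level sum to $1$; its support is $Q$. Nonlinear approximation: $\Sigma_n(\mathcal I)$ is the set of all $g=\sum_{Q\in\Lambda_n}a_Q\varphi_Q$ with $a_Q\in\mathbb C$, $\Lambda_n\subset\mathcal Q$, $\#\Lambda_n\le n$ ($\Lambda_n$ may vary with $g$), and $\sigma_n(f,\mathcal I)_{\mathrm{BMO}}:=\inf_{g\in\Sigma_n(\mathcal I)}\|f-g\|_{\mathrm{BMO}}$. Besov space: for $I=[x_{m,j},x_{m,j+1}]\in\mathcal I_m$ set $\Omega_I:=[x_{m,j+1-k},x_{m,j+k}]$. For a compact interval $J$, $\omega_k(f,J)_q:=\sup_{h\in\mathbb R}\|\Delta_h^k(f,\cdot,J)\|_{L^q(J)}$, where $\Delta_h^k(f,x,J)=\sum_{i=0}^k(-1)^{k+i}\binom ki f(x+ih)$ if $[x,x+kh]\subset J$ and $0$ otherwise. Fix any $q\in[1,\infty)$.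 $\dot B^{\alpha,k}_\tau$ is the set of $f\in L^q_{loc}(\mathbb R)$ with $\|f\|_{\dot B^{\alpha,k}_\tau}:=\big(\sum_{I\in\mathcal I}(|I|^{-1/q}\omega_k(f,\Omega_I)_q)^\tau\big)^{1/\tau}<\infty$. (Different $q$ give the same space with equivalent quasi-norms; $\omega_k(f,\Omega_I)_q$ can equivalently be replaced by $\inf_{P\in\Pi_k}\|f-P\|_{L^q(\Omega_I)}$; when $\tau\ge1$ the quasi-norm is also equivalent to $\big(\int_0^\infty[t^{-\alpha}\omega_k(f,t)_\tau]^\tau dt/t\big)^{1/\tau}$, where $\omega_k(f,t)_\tau=\sup_{|h|\le t}\|\Delta_h^kf\|_{L^\tau(\mathbb R)}$. Constants may depend on which of these quasi-norms is fixed.) Convention: the quasi-norm is invariant under adding elements of $\Pi_k$, so elements of $\dot B^{\alpha,k}_\tau$ are classes modulo $\Pi_k$. For every $f\in\dot B^{\alpha,k}_\tau$ there is $P\in\Pi_k$ with $f-P\in\mathrm{VMO}$; each $f\in\dot B^{\alpha,k}_\tau$ is assumed to be this canonical representative $f-P\in\mathrm{VMO}$ (determined up to a constant). *)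

theory Defs
  imports "HOL-Analysis.Analysis" "HOL-Computational_Algebra.Polynomial"
begin

section \<open>BMO and VMO\<close>

definition locally_integrable :: "(real \<Rightarrow> complex) \<Rightarrow> bool" where
  "locally_integrable f \<longleftrightarrow> (\<forall>a b. set_integrable lebesgue {a..b} f)"

definition avg :: "(real \<Rightarrow> complex) \<Rightarrow> real \<Rightarrow> real \<Rightarrow> complex" where
  "avg f a b = (LINT x:{a..b}|lebesgue. f x) /\<^sub>R (b - a)"

text \<open>The norm is extended-real valued, so that the supremum is the true one also outside
  \<open>BMO\<close>.  Functions are not quotiented by constants: the norm below is the seminorm on
  representatives.\<close>

definition bmo_norm :: "(real \<Rightarrow> complex) \<Rightarrow> ennreal" where
  "bmo_norm f =
     (SUP (a, b) \<in> {(a, b). a < b}.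
        (\<integral>\<^sup>+ x \<in> {a..b}. ennreal (cmod (f x - avg f a b)) \<partial>lebesgue) / ennreal (b - a))"

definition BMO :: "(real \<Rightarrow> complex) set" where
  "BMO = {f. locally_integrable f \<and> bmo_norm f < \<infinity>}"

definition C0 :: "(real \<Rightarrow> complex) set" where
  "C0 = {f. continuous_on UNIV f \<and> compact (closure {x. f x \<noteq> 0})}"

definition VMO :: "(real \<Rightarrow> complex) set" where
  "VMO = {f \<in> BMO. \<forall>\<epsilon>>0. \<exists>g\<in>C0. bmo_norm (\<lambda>x. f x - g x) < ennreal \<epsilon>}"


section \<open>Regular multilevel partitions\<close>

text \<open>A multilevel partition is given by its knots \<open>x m j\<close>, where \<open>m\<close> is the level.\<close>

definition cell :: "(int \<Rightarrow> int \<Rightarrow> real) \<Rightarrow> int \<Rightarrow> int \<Rightarrow> real set" where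
  "cell x m j = {x m j .. x m (j + 1)}"

definition level :: "(int \<Rightarrow> int \<Rightarrow> real) \<Rightarrow> int \<Rightarrow> real set set" where
  "level x m = range (cell x m)"

definition cell_length :: "(int \<Rightarrow> int \<Rightarrow> real) \<Rightarrow> int \<Rightarrow> int \<Rightarrow> real" where
  "cell_length x m j = x m (j + 1) - x m j"

definition children :: "(int \<Rightarrow> int \<Rightarrow> real) \<Rightarrow> int \<Rightarrow> real set \<Rightarrow> real set set" where
  "children x m I = {I' \<in> level x (m + 1). I' \<subseteq> I}"

definition regular_multilevel_partition ::
    "nat \<Rightarrow> real \<Rightarrow> (int \<Rightarrow> int \<Rightarrow> real) \<Rightarrow> bool" where
  "regular_multilevel_partition M0 lam x \<longleftrightarrow>
     (\<forall>m. strict_mono (x m) \<and> \<Union> (level x m) = UNIV) \<and>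
     (\<forall>m. \<forall>I' \<in> level x (m + 1). \<exists>I \<in> level x m. I' \<subseteq> I) \<and>
     (\<forall>m. \<forall>I \<in> level x m. 2 \<le> card (children x m I) \<and> card (children x m I) \<le> M0) \<and>
     (\<forall>m i j. cell_length x m i \<le> lam * cell_length x m j)"


section \<open>B-splines\<close>

text \<open>Cox--de Boor recursion: \<open>bspline d t j\<close> is the B-spline of degree \<open>d\<close> with knots
  \<open>t j, \<dots>, t (j + d + 1)\<close>.\<close>

fun bspline :: "nat \<Rightarrow> (int \<Rightarrow> real) \<Rightarrow> int \<Rightarrow> real \<Rightarrow> real" where
  "bspline 0 t j x = (if t j \<le> x \<and> x < t (j + 1) then 1 else 0)"
| "bspline (Suc d) t j x =
     (x - t j) / (t (j + int d + 1) - t j) * bspline d t j x +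
     (t (j + int d + 2) - x) / (t (j + int d + 2) - t (j + 1)) * bspline d t (j + 1) x"

lemma bspline_eq_0:
  assumes "strict_mono t" "x < t j \<or> t (j + int d + 1) \<le> x"
  shows "bspline d t j x = 0"
  using assms(2)
proof (induction d arbitrary: j)
  case 0
  then show ?case by auto
next
  case (Suc d)
  have "t j < t (j + 1)" "t (j + int d + 1) < t (j + int d + 2)"
    using assms(1) by (auto simp: strict_mono_def)
  moreover have e: "j + int (Suc d) + 1 = j + int d + 2" "j + 1 + int d + 1 = j + int d + 2"
    by auto
  ultimately have "bspline d t j x = 0" "bspline d t (j + 1) x = 0"
    using Suc.IH[of j] Suc.IH[of "j + 1"] Suc.prems unfolding e by linarith+
  then show ?case by simp
qed

lemma sum_bspline_eq_1:
  assumes t: "strict_mono t" and x: "t i \<le> x" "x < t (i + 1)"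
  shows "(\<Sum>j = i - int d..i. bspline d t j x) = 1"
proof (induction d)
  case 0
  then show ?case using x by simp
next
  case (Suc d)
  define w where "w j = (x - t j) / (t (j + int d + 1) - t j)" for j
  let ?B = "\<lambda>j. bspline d t j x"
  have lt: "t j < t (j + int d + 1)" for j
    using t by (auto simp: strict_mono_def)
  have w': "(t (j + int d + 2) - x) / (t (j + int d + 2) - t (j + 1)) = 1 - w (j + 1)" for j
  proof -
    have "j + 1 + int d + 1 = j + int d + 2" by simp
    then show ?thesis using lt[of "j + 1"] by (simp add: w_def field_simps)
  qed
  have lo: "?B (i - int d - 1) = 0" and hi: "?B (i + 1) = 0"
    using x by (auto intro!: bspline_eq_0[OF t])
  have 1: "{i - int (Suc d)..i} = insert (i - int d - 1) {i - int d..i}"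
    and 2: "{i - int d..i + 1} = insert (i + 1) {i - int d..i}"
    by auto
  have "(\<Sum>j = i - int (Suc d)..i. bspline (Suc d) t j x)
      = (\<Sum>j = i - int (Suc d)..i. w j * ?B j)
        + (\<Sum>j = i - int (Suc d)..i. (1 - w (j + 1)) * ?B (j + 1))"
    by (simp add: w' sum.distrib flip: w_def)
  also have "(\<Sum>j = i - int (Suc d)..i. (1 - w (j + 1)) * ?B (j + 1))
      = (\<Sum>j = i - int d..i + 1. (1 - w j) * ?B j)"
    by (rule sum.reindex_bij_witness[of _ "\<lambda>j. j - 1" "\<lambda>j. j + 1"]) auto
  also have "\<dots> = (\<Sum>j = i - int d..i. (1 - w j) * ?B j)"
    unfolding 2 using hi by simp
  also have "(\<Sum>j = i - int (Suc d)..i. w j * ?B j) = (\<Sum>j = i - int d..i. w j * ?B j)"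
    unfolding 1 using lo by simp
  also have "(\<Sum>j = i - int d..i. w j * ?B j) + (\<Sum>j = i - int d..i. (1 - w j) * ?B j)
      = (\<Sum>j = i - int d..i. ?B j)"
    by (simp add: algebra_simps flip: sum.distrib)
  finally show ?case using Suc.IH by simp
qed


section \<open>Nonlinear spline approximation in BMO\<close>

text \<open>The pair \<open>(m, j)\<close> stands for \<open>Q = [x m j, x m (j + k)]\<close> together with its level.\<close>

definition Sigma_n ::
    "(int \<Rightarrow> int \<Rightarrow> real) \<Rightarrow> nat \<Rightarrow> nat \<Rightarrow> (real \<Rightarrow> complex) set" where
  "Sigma_n x k n =
     {g. \<exists>\<Lambda> :: (int \<times> int) set. \<exists>a :: int \<times> int \<Rightarrow> complex. finite \<Lambda> \<and> card \<Lambda> \<le> n \<and>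
        g = (\<lambda>y. \<Sum>(m, j)\<in>\<Lambda>. a (m, j) * complex_of_real (bspline (k - 1) (x m) j y))}"

definition sigma_n_BMO ::
    "(int \<Rightarrow> int \<Rightarrow> real) \<Rightarrow> nat \<Rightarrow> nat \<Rightarrow> (real \<Rightarrow> complex) \<Rightarrow> ennreal" where
  "sigma_n_BMO x k n f = (INF g \<in> Sigma_n x k n. bmo_norm (\<lambda>y. f y - g y))"


section \<open>The Besov space\<close>

definition Lq_norm :: "real \<Rightarrow> real set \<Rightarrow> (real \<Rightarrow> complex) \<Rightarrow> real" where
  "Lq_norm q J f = (LINT y:J|lebesgue. cmod (f y) powr q) powr (1 / q)"

definition Lq_loc :: "real \<Rightarrow> (real \<Rightarrow> complex) set" where
  "Lq_loc q = {f \<in> borel_measurable lebesgue.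
     \<forall>a b. set_integrable lebesgue {a..b} (\<lambda>y. cmod (f y) powr q)}"

text \<open>The step \<open>h\<close> may be negative, hence \<^const>\<open>closed_segment\<close>.\<close>

definition Delta :: "nat \<Rightarrow> real \<Rightarrow> (real \<Rightarrow> complex) \<Rightarrow> real set \<Rightarrow> real \<Rightarrow> complex" where
  "Delta k h f J y =
     (if closed_segment y (y + real k * h) \<subseteq> J
      then \<Sum>i\<le>k. (-1) ^ (k + i) * of_nat (k choose i) * f (y + real i * h)
      else 0)"

text \<open>For \<open>f \<in> Lq_loc q\<close> and compact \<open>J\<close> the norms below are bounded by
  \<open>2 ^ k * Lq_norm q J f\<close>, so the real supremum is the true one.\<close>

definition omega :: "nat \<Rightarrow> real \<Rightarrow> (real \<Rightarrow> complex) \<Rightarrow> real set \<Rightarrow> real" where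
  "omega k q f J = (SUP h :: real. Lq_norm q J (Delta k h f J))"

definition Omega :: "(int \<Rightarrow> int \<Rightarrow> real) \<Rightarrow> nat \<Rightarrow> int \<Rightarrow> int \<Rightarrow> real set" where
  "Omega x k m j = {x m (j + 1 - int k) .. x m (j + int k)}"

definition besov_term ::
    "(int \<Rightarrow> int \<Rightarrow> real) \<Rightarrow> nat \<Rightarrow> real \<Rightarrow> real \<Rightarrow> (real \<Rightarrow> complex) \<Rightarrow> int \<times> int \<Rightarrow> real" where
  "besov_term x k q \<tau> f = (\<lambda>(m, j).
     (cell_length x m j powr (- 1 / q) * omega k q f (Omega x k m j)) powr \<tau>)"

text \<open>A cell is a proper subset of its parent, so no interval occurs at two different levels and
  the sum over the intervals of the partition is a sum over all pairs \<open>(m, j)\<close>.\<close>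

definition besov_norm ::
    "(int \<Rightarrow> int \<Rightarrow> real) \<Rightarrow> nat \<Rightarrow> real \<Rightarrow> real \<Rightarrow> (real \<Rightarrow> complex) \<Rightarrow> real" where
  "besov_norm x k q \<tau> f = (\<Sum>\<^sub>\<infinity>mj. besov_term x k q \<tau> f mj) powr (1 / \<tau>)"

definition besov_space ::
    "(int \<Rightarrow> int \<Rightarrow> real) \<Rightarrow> nat \<Rightarrow> real \<Rightarrow> real \<Rightarrow> (real \<Rightarrow> complex) set" where
  "besov_space x k q \<tau> = {f \<in> Lq_loc q. besov_term x k q \<tau> f summable_on UNIV}"

text \<open>The representatives in \<open>VMO\<close> of the class of \<open>f\<close> modulo polynomials of degree at most
  \<open>k - 1\<close> (unique up to an additive constant for \<open>f\<close> in the Besov space).\<close>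

definition canonical_reps :: "nat \<Rightarrow> (real \<Rightarrow> complex) \<Rightarrow> (real \<Rightarrow> complex) set" where
  "canonical_reps k f =
     {g \<in> VMO. \<exists>P :: complex poly. degree P \<le> k - 1 \<and> g = (\<lambda>y. f y - poly P (complex_of_real y))}"

end

theory Submission
  imports Defs
begin

text \<open>
  On every cell, \<open>f\<close> is approximated by a polynomial with error controlled by the local modulus of
  smoothness; blossoming these polynomials gives splines \<open>T m\<close> with
  \<open>T (m + 1) - T m = (\<Sum>j. b (m + 1, j) * \<phi> (m + 1, j))\<close>, where the \<open>\<tau>\<close>-th powers of the coefficients are
  summable with sum bounded by that of the Besov terms.  As \<open>m \<rightarrow> \<infinity>\<close>, \<open>T m\<close> tends to \<open>f\<close>; as \<open>m \<rightarrow> -\<infinity>\<close>,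
  \<open>T m\<close> tends modulo constants to a polynomial, and subtracting it gives the representative in \<open>VMO\<close>.

  The \<open>BMO\<close> norm of a sum of B-splines is bounded by the Carleson constant
  \<open>sup\<^sub>J (\<Sum>Q\<subseteq>J. \<bar>b Q\<bar> * \<bar>Q\<bar>) / \<bar>J\<bar>\<close> of its coefficients.  Mere thresholding of the coefficients would
  lose a logarithm, so the \<open>n\<close> retained terms are chosen from the masses
  \<open>N(Q) = (\<Sum>R\<subseteq>Q. \<bar>b R\<bar> powr \<tau>)\<close>: the term \<open>Q\<close> is kept if \<open>N(Q)\<close> exceeds the mass of every child of \<open>Q\<close> by at
  least \<open>\<theta>\<close>.  This happens at most \<open>2 N / \<theta>\<close> times, \<open>N\<close> being the total mass.  Below a discarded \<open>Q\<close>
  all but one child carry little mass, and that child is shorter than \<open>Q\<close> by a fixed factor, so the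
  discarded terms have Carleson constant \<open>O(\<theta> powr (1 / \<tau>))\<close>.
\<close>


section \<open>Blossoms and knot refinement\<close>

text \<open>A blossom is symmetric and affine in each argument, and refining the knots only
  evaluates it at other nodes. The coefficients \<open>b\<close> are therefore explicit combinations
  whose bounds can be read off the formula; no stability theorem for B-splines enters.

  Why a threshold on the coefficients fails: a full binary tree of depth \<open>L\<close> below one
  cell, all coefficients just under \<epsilon>, has Carleson constant about
  \<open>L * \<epsilon>\<close>, while its mass \<open>2 ^ L * \<epsilon> powr \<tau>\<close> leaves
  room for \<open>L\<close> of order \<open>log n\<close>. Selection by mass keeps the branching
  cells near the top of such a tree.

  BMO asks for mean oscillation only. Hence \<open>q\<close> is removed at once in favour of L1, and
  constants are free: the constant terms of \<open>T m\<close> need not converge as \<open>m\<close>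
  tends to minus infinity, only the other coefficients do. On each interval one fine and one coarse
  level are chosen so that both remainders are negligible; the choice depends on the interval, the
  bound does not, and all sums of splines stay finite.\<close>

text \<open>Applying \<open>P \<mapsto> P + (u - X) P' / d\<close> for \<open>d\<close>, \<open>d - 1\<close>, \<dots>, \<open>1\<close> at nodes \<open>u\<^sub>d, \<dots>, u\<^sub>1\<close> evaluates the
  blossom (polar form) of a polynomial of degree at most \<open>d\<close>.  At the knots
  \<open>t (j + 1), \<dots>, t (j + d)\<close> this is the coefficient of \<open>P\<close> at the B-spline with index \<open>j\<close>.\<close>

definition polar_step :: "nat \<Rightarrow> complex \<Rightarrow> complex poly \<Rightarrow> complex poly" where
  "polar_step d u P = P + smult (1 / of_nat d) ([:u, -1:] * pderiv P)"

fun polar_coeff :: "nat \<Rightarrow> (int \<Rightarrow> real) \<Rightarrow> complex poly \<Rightarrow> int \<Rightarrow> complex" where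
  "polar_coeff 0 t P j = poly P 0"
| "polar_coeff (Suc d) t P j =
     polar_coeff d t (polar_step (Suc d) (of_real (t (j + int d + 1))) P) j"

definition deBoor_step :: "nat \<Rightarrow> (int \<Rightarrow> real) \<Rightarrow> real \<Rightarrow> (int \<Rightarrow> complex) \<Rightarrow> int \<Rightarrow> complex" where
  "deBoor_step d t u a j =
     (of_real (t (j + int d) - u) * a (j - 1) + of_real (u - t j) * a j) / of_real (t (j + int d) - t j)"

text \<open>The knots \<open>s\<close> refine the knots \<open>t\<close>, and \<open>c i\<close> is the interval of \<open>t\<close> containing \<open>s i\<close>: the
  coefficients over \<open>s\<close> are the values of the blossom of the spline at consecutive knots of \<open>s\<close>.\<close>

fun refine_coeff :: "nat \<Rightarrow> (int \<Rightarrow> real) \<Rightarrow> (int \<Rightarrow> real) \<Rightarrow> (int \<Rightarrow> int) \<Rightarrow>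
    (int \<Rightarrow> complex) \<Rightarrow> int \<Rightarrow> complex" where
  "refine_coeff 0 t s c a i = a (c i)"
| "refine_coeff (Suc d) t s c a i =
     refine_coeff d t s c (deBoor_step (Suc d) t (s (i + int d + 1)) a) i"

definition spline :: "nat \<Rightarrow> (int \<Rightarrow> real) \<Rightarrow> int \<Rightarrow> (int \<Rightarrow> complex) \<Rightarrow> real \<Rightarrow> complex" where
  "spline d t c a y = (\<Sum>j = c - int d..c. a j * of_real (bspline d t j y))"

lemma coeff_polar_step:
  "coeff (polar_step d u P) i =
     coeff P i + (u * of_nat (Suc i) * coeff P (Suc i) - of_nat i * coeff P i) / of_nat d"
proof -
  have "coeff ([:u, -1:] * pderiv P) i = u * (of_nat (Suc i) * coeff P (Suc i)) - of_nat i * coeff P i"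
    by (cases i) (simp_all add: coeff_pderiv coeff_pCons)
  then show ?thesis by (simp add: polar_step_def mult.assoc)
qed

lemma polar_step_add: "polar_step d u (P + Q) = polar_step d u P + polar_step d u Q"
  by (rule poly_eqI) (simp add: coeff_polar_step algebra_simps add_divide_distrib diff_divide_distrib)

lemma polar_step_smult: "polar_step d u (smult r P) = smult r (polar_step d u P)"
  by (rule poly_eqI) (simp add: coeff_polar_step algebra_simps add_divide_distrib diff_divide_distrib)

text \<open>The coefficient of order \<open>Suc d\<close> is multiplied by
  \<open>1 - Suc d / Suc d\<close>, so the top term cancels. Each node costs one degree, and
  \<open>d\<close> nodes leave a constant.\<close>

lemma degree_polar_step:
  assumes "degree P \<le> Suc d"
  shows "degree (polar_step (Suc d) u P) \<le> d"
proof (rule degree_le, intro allI impI)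
  fix i assume "d < i"
  then consider "i = Suc d" | "i > Suc d" by linarith
  then show "coeff (polar_step (Suc d) u P) i = 0"
  proof cases
    case 1
    have "coeff P (Suc (Suc d)) = 0" using assms by (intro coeff_eq_0) auto
    then show ?thesis using 1 by (simp add: coeff_polar_step del: of_nat_Suc)
  next
    case 2
    then have "coeff P i = 0" "coeff P (Suc i) = 0" using assms by (auto intro!: coeff_eq_0)
    then show ?thesis by (simp add: coeff_polar_step)
  qed
qed

text \<open>Symmetry of the blossom in two consecutive nodes, checked coefficient by
  coefficient.\<close>

lemma polar_step_commute:
  "polar_step (Suc d) u (polar_step (Suc (Suc d)) v P) = polar_step (Suc d) v (polar_step (Suc (Suc d)) u P)"
proof (rule poly_eqI)
  fix i
  have 1: "of_nat (Suc d) \<noteq> (0::complex)" "of_nat (Suc (Suc d)) \<noteq> (0::complex)" by (simp_all del: of_nat_Suc)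
  define D1 D2 where "D1 = (of_nat (Suc d)::complex)" and "D2 = (of_nat (Suc (Suc d))::complex)"
  have D: "D1 \<noteq> 0" "D2 \<noteq> 0" "D2 = D1 + 1" using 1 by (simp_all add: D1_def D2_def)
  define I where "I = (of_nat i :: complex)"
  have I: "of_nat (Suc i) = I + 1" by (simp add: I_def)
  show "coeff (polar_step (Suc d) u (polar_step (Suc (Suc d)) v P)) i
      = coeff (polar_step (Suc d) v (polar_step (Suc (Suc d)) u P)) i"
    unfolding coeff_polar_step of_nat_Suc[of "Suc i"] I
    unfolding D1_def[symmetric] D2_def[symmetric] I_def[symmetric]
    using D(1,2) unfolding D(3) by (simp add: divide_simps) algebra
qed

lemma polar_step_affine:
  assumes "r \<noteq> s"
  shows "polar_step d u P = smult ((r - u) / (r - s)) (polar_step d s P) + smult ((u - s) / (r - s)) (polar_step d r P)"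
proof (rule poly_eqI)
  fix i
  have "r - s \<noteq> 0" using assms by simp
  have "((r - u) * s + (u - s) * r) / (r - s) = u"
  proof -
    have "(r - u) * s + (u - s) * r = u * (r - s)" by algebra
    then show ?thesis using \<open>r - s \<noteq> 0\<close> by simp
  qed
  then have "(r - u) / (r - s) + (u - s) / (r - s) = 1" "(r - u) / (r - s) * s + (u - s) / (r - s) * r = u"
    using \<open>r - s \<noteq> 0\<close> by (simp_all flip: add_divide_distrib)
  moreover have "coeff P i + (u * n - m) / e = A * (coeff P i + (s * n - m) / e) + B * (coeff P i + (r * n - m) / e)"
    if "A + B = 1" "A * s + B * r = u" for A B n m e :: complex
  proof -
    have "A * (coeff P i + (s * n - m) / e) + B * (coeff P i + (r * n - m) / e)
       = (A + B) * coeff P i + ((A * s + B * r) * n - (A + B) * m) / e"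
      by (simp add: algebra_simps add_divide_distrib diff_divide_distrib)
    then show ?thesis using that by simp
  qed
  ultimately show "coeff (polar_step d u P) i = coeff (smult ((r - u) / (r - s)) (polar_step d s P) + smult ((u - s) / (r - s)) (polar_step d r P)) i"
    by (simp add: coeff_polar_step mult.assoc)
qed

lemma polar_coeff_add: "polar_coeff d t (P + Q) j = polar_coeff d t P j + polar_coeff d t Q j"
  by (induction d arbitrary: P Q) (simp_all add: polar_step_add)

lemma polar_coeff_smult: "polar_coeff d t (smult r P) j = r * polar_coeff d t P j"
  by (induction d arbitrary: P) (simp_all add: polar_step_smult)

lemma polar_coeff_diff: "polar_coeff d t (P - Q) j = polar_coeff d t P j - polar_coeff d t Q j"
  using polar_coeff_add[of d t "P - Q" Q j] by simp

text \<open>Index \<open>j - 1\<close> has the nodes \<open>t j\<close>, \<dots>,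
  \<open>t (j + d)\<close>. The recursion inserts \<open>t j\<close> last; by symmetry it may come
  first, which exposes the nodes shared with index \<open>j\<close>.\<close>

lemma polar_coeff_shift:
  "polar_coeff (Suc d) t P (j - 1) = polar_coeff d t (polar_step (Suc d) (of_real (t j)) P) j"
proof (induction d arbitrary: P)
  case 0
  show ?case by simp
next
  case (Suc d)
  have "polar_coeff (Suc (Suc d)) t P (j - 1) =
      polar_coeff (Suc d) t (polar_step (Suc (Suc d)) (of_real (t (j + int d + 1))) P) (j - 1)"
    by (simp add: algebra_simps)
  also have "\<dots> = polar_coeff d t (polar_step (Suc d) (of_real (t j)) (polar_step (Suc (Suc d)) (of_real (t (j + int d + 1))) P)) j"
    by (rule Suc)
  also have "\<dots> = polar_coeff (Suc d) t (polar_step (Suc (Suc d)) (of_real (t j)) P) j"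
    by (simp add: polar_step_commute[of d "of_real (t j)"])
  finally show ?case .
qed

text \<open>The coefficients with indices \<open>j - 1\<close> and \<open>j\<close> have
  \<open>d\<close> nodes in common and differ in \<open>t j\<close> against
  \<open>t (j + d + 1)\<close>. Affinity in that node gives the blossom at \<open>u\<close>.\<close>

lemma deBoor_step_polar_coeff:
  assumes "strict_mono t"
  shows "deBoor_step (Suc d) t u (polar_coeff (Suc d) t P) = polar_coeff d t (polar_step (Suc d) (of_real u) P)"
proof
  fix j
  have "t j < t (j + int d + 1)" using assms by (simp add: strict_mono_def)
  then have ne: "(of_real (t (j + int d + 1)) :: complex) \<noteq> of_real (t j)" by simp
  show "deBoor_step (Suc d) t u (polar_coeff (Suc d) t P) j = polar_coeff d t (polar_step (Suc d) (of_real u) P) j"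
    unfolding deBoor_step_def polar_coeff_shift
    by (simp add: polar_step_affine[OF ne, of "Suc d" "of_real u" P] polar_coeff_add polar_coeff_smult
        add_divide_distrib add.commute add.left_commute)
qed

text \<open>Symmetry again, now for coefficients that need not come from a single
  polynomial.\<close>

lemma deBoor_step_commute:
  assumes "strict_mono t"
  shows "deBoor_step (Suc d) t u (deBoor_step (Suc (Suc d)) t v a)
       = deBoor_step (Suc d) t v (deBoor_step (Suc (Suc d)) t u a)"
proof
  fix j
  define T S T' S' where "T = complex_of_real (t (j + int d + 1))" and "S = complex_of_real (t (j - 1))"
    and "T' = complex_of_real (t (j + int d + 2))" and "S' = complex_of_real (t j)"
  have "t (j - 1) < t (j + int d + 1)" "t j < t (j + int d + 2)" "t j < t (j + int d + 1)"
    using assms by (simp_all add: strict_mono_def)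
  then have ne: "T - S \<noteq> 0" "T' - S' \<noteq> 0" "T - S' \<noteq> 0" by (simp_all add: T_def S_def T'_def S'_def)
  have e: "j + int (Suc d) = j + int d + 1" "j - 1 + int (Suc (Suc d)) = j + int d + 1"
    "j + int (Suc (Suc d)) = j + int d + 2" by simp_all
  have key: "((T - u) * (((T - v) * A + (v - S) * B) / (T - S)) + (u - S') * (((T' - v) * B + (v - S') * C) / (T' - S'))) / (T - S')
      = ((T - v) * (((T - u) * A + (u - S) * B) / (T - S)) + (v - S') * (((T' - u) * B + (u - S') * C) / (T' - S'))) / (T - S')"
    for u v A B C
  proof -
    have "(T - u) * ((T - v) * A + (v - S) * B) * (T' - S') + (u - S') * ((T' - v) * B + (v - S') * C) * (T - S)
        = (T - v) * ((T - u) * A + (u - S) * B) * (T' - S') + (v - S') * ((T' - u) * B + (u - S') * C) * (T - S)"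
      by algebra
    then show ?thesis using ne by (simp add: divide_simps)
  qed
  show "deBoor_step (Suc d) t u (deBoor_step (Suc (Suc d)) t v a) j
       = deBoor_step (Suc d) t v (deBoor_step (Suc (Suc d)) t u a) j"
    unfolding deBoor_step_def e of_real_diff
    unfolding T_def[symmetric] S_def[symmetric] T'_def[symmetric] S'_def[symmetric]
    by (rule key)
qed

text \<open>The Cox--de Boor recursion moved from the B-splines to the coefficients, with the point
  of evaluation as the node. Both boundary terms of the shifted sum vanish because their B-splines
  are zero at \<open>y\<close>.\<close>

lemma spline_step:
  assumes t: "strict_mono t" and y: "t c \<le> y" "y < t (c + 1)"
  shows "spline (Suc d) t c a y = spline d t c (deBoor_step (Suc d) t y a) y"
proof -
  define w where "w j = (y - t j) / (t (j + int d + 1) - t j)" for j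
  let ?B = "\<lambda>j. complex_of_real (bspline d t j y)"
  have lt: "t j < t (j + int d + 1)" for j
    using t by (auto simp: strict_mono_def)
  have w': "(t (j + int d + 2) - y) / (t (j + int d + 2) - t (j + 1)) = 1 - w (j + 1)" for j
  proof -
    have "j + 1 + int d + 1 = j + int d + 2" by simp
    then show ?thesis using lt[of "j + 1"] by (simp add: w_def field_simps)
  qed
  have lo: "?B (c - int d - 1) = 0" and hi: "?B (c + 1) = 0"
    using y by (auto intro!: bspline_eq_0[OF t])
  have 1: "{c - int (Suc d)..c} = insert (c - int d - 1) {c - int d..c}"
    and 2: "{c - int d..c + 1} = insert (c + 1) {c - int d..c}"
    by auto
  have "spline (Suc d) t c a y
      = (\<Sum>j = c - int (Suc d)..c. a j * of_real (w j) * ?B j)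
        + (\<Sum>j = c - int (Suc d)..c. a j * of_real (1 - w (j + 1)) * ?B (j + 1))"
    unfolding spline_def bspline.simps w' w_def[symmetric]
    by (subst sum.distrib[symmetric]) (simp add: algebra_simps del: of_nat_Suc)
  also have "(\<Sum>j = c - int (Suc d)..c. a j * of_real (1 - w (j + 1)) * ?B (j + 1))
      = (\<Sum>j = c - int d..c + 1. a (j - 1) * of_real (1 - w j) * ?B j)"
    by (rule sum.reindex_bij_witness[of _ "\<lambda>j. j - 1" "\<lambda>j. j + 1"]) auto
  also have "\<dots> = (\<Sum>j = c - int d..c. a (j - 1) * of_real (1 - w j) * ?B j)"
    unfolding 2 using hi by simp
  also have "(\<Sum>j = c - int (Suc d)..c. a j * of_real (w j) * ?B j) = (\<Sum>j = c - int d..c. a j * of_real (w j) * ?B j)"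
    unfolding 1 using lo by simp
  also have "(\<Sum>j = c - int d..c. a j * of_real (w j) * ?B j) + (\<Sum>j = c - int d..c. a (j - 1) * of_real (1 - w j) * ?B j)
      = (\<Sum>j = c - int d..c. deBoor_step (Suc d) t y a j * ?B j)"
    unfolding sum.distrib[symmetric]
  proof (rule sum.cong[OF refl])
    fix j
    have w1: "1 - w j = (t (j + int d + 1) - y) / (t (j + int d + 1) - t j)"
      using lt[of j] by (simp add: w_def field_simps)
    have e: "j + int (Suc d) = j + int d + 1" by simp
    show "a j * of_real (w j) * ?B j + a (j - 1) * of_real (1 - w j) * ?B j = deBoor_step (Suc d) t y a j * ?B j"
      unfolding w1 deBoor_step_def e unfolding w_def
      by (simp add: add_divide_distrib diff_divide_distrib algebra_simps)
  qed
  finally show ?thesis by (simp add: spline_def)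
qed

text \<open>Every step of the recursion inserts \<open>y\<close> as a node, and this does not change
  the value at \<open>y\<close>, because the factor \<open>y - X\<close> vanishes there. This is
  Marsden's identity in terms of blossoms.\<close>

lemma spline_polar_coeff:
  assumes t: "strict_mono t" and y: "t c \<le> y" "y < t (c + 1)" and "degree P \<le> d"
  shows "spline d t c (polar_coeff d t P) y = poly P (of_real y)"
  using assms(4)
proof (induction d arbitrary: P)
  case 0
  then obtain b where "P = [:b:]" by (metis degree_eq_zeroE le_zero_eq)
  then show ?case using y by (simp add: spline_def)
next
  case (Suc d)
  have "spline (Suc d) t c (polar_coeff (Suc d) t P) y
      = poly (polar_step (Suc d) (of_real y) P) (of_real y)"
    unfolding spline_step[OF t y] deBoor_step_polar_coeff[OF t]
    by (rule Suc.IH[OF degree_polar_step[OF Suc.prems]])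
  then show ?case by (simp add: polar_step_def del: polar_coeff.simps)
qed

section \<open>Knot insertion\<close>

locale knot_refinement =
  fixes t s :: "int \<Rightarrow> real" and c :: "int \<Rightarrow> int"
  assumes t: "strict_mono t" and s: "strict_mono s"
    and c: "\<And>i. t (c i) \<le> s i" "\<And>i. s i < t (c i + 1)"
    and sub: "\<And>j. t j \<in> range s"
begin

lemma c_unique: "t j \<le> s i \<Longrightarrow> s i < t (j + 1) \<Longrightarrow> c i = j"
  using c[of i] t by (smt (verit) strict_mono_less strict_mono_less_eq)

text \<open>Every coarse knot is a fine knot, so none lies strictly between \<open>s (i - 1)\<close>
  and \<open>s i\<close>. The coarse interval can change only if \<open>s i\<close> is itself the
  next coarse knot.\<close>

lemma c_pred: "c i = c (i - 1) \<or> (c (i - 1) = c i - 1 \<and> s i = t (c i))"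
proof -
  have 0: "s (i - 1) < s i" using s by (simp add: strict_mono_def)
  obtain r where r: "t (c (i - 1) + 1) = s r" using sub by (metis imageE)
  have "s (i - 1) < s r" using c(2)[of "i - 1"] r by simp
  then have "i \<le> r" using s by (simp add: strict_mono_less)
  then have 1: "s i \<le> t (c (i - 1) + 1)" using s r by (simp add: strict_mono_less_eq)
  show ?thesis
  proof (cases "s i < t (c (i - 1) + 1)")
    case True
    then have "c i = c (i - 1)" using c_unique[of "c (i - 1)" i] c(1)[of "i - 1"] 0 by linarith
    then show ?thesis by simp
  next
    case False
    then have e: "s i = t (c (i - 1) + 1)" using 1 by simp
    have "c i = c (i - 1) + 1"
      using c_unique[of "c (i - 1) + 1" i] e t by (simp add: strict_mono_less)
    then show ?thesis using e by simp
  qed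
qed

text \<open>Counterpart of \<open>polar_coeff_shift\<close>. The interval index can jump only in the
  base case; there \<open>s i\<close> is a coarse knot, and the linear pieces on its two sides agree
  at it.\<close>

lemma refine_coeff_shift:
  "refine_coeff (Suc d) t s c a (i - 1) = refine_coeff d t s c (deBoor_step (Suc d) t (s i) a) i"
proof (induction d arbitrary: a)
  case 0
  show ?case
  proof (cases "c i = c (i - 1)")
    case False
    then have e: "c (i - 1) = c i - 1" "s i = t (c i)" using c_pred[of i] by auto
    have "t (c i - 1) < t (c i)" "t (c i) < t (c i + 1)" using t by (simp_all add: strict_mono_less)
    then have "t (c i) - t (c i - 1) \<noteq> 0" "t (c i + 1) - t (c i) \<noteq> 0" by simp_all
    then show ?thesis by (simp add: e deBoor_step_def flip: of_real_diff)
  qed simp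
next
  case (Suc d)
  have "refine_coeff (Suc (Suc d)) t s c a (i - 1) =
      refine_coeff (Suc d) t s c (deBoor_step (Suc (Suc d)) t (s (i + int d + 1)) a) (i - 1)"
    by (simp add: algebra_simps)
  also have "\<dots> = refine_coeff d t s c (deBoor_step (Suc d) t (s i) (deBoor_step (Suc (Suc d)) t (s (i + int d + 1)) a)) i"
    by (rule Suc)
  also have "\<dots> = refine_coeff (Suc d) t s c (deBoor_step (Suc (Suc d)) t (s i) a) i"
    by (simp add: deBoor_step_commute[OF t, of d "s i"])
  finally show ?case .
qed

end

lemma refine_coeff_linear:
  "refine_coeff d t s c (\<lambda>j. p * a j + q * b j) i = p * refine_coeff d t s c a i + q * refine_coeff d t s c b i"
proof (induction d arbitrary: a b)
  case (Suc d)
  have "deBoor_step (Suc d) t u (\<lambda>j. p * a j + q * b j) = (\<lambda>j. p * deBoor_step (Suc d) t u a j + q * deBoor_step (Suc d) t u b j)" for u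
    by (rule ext) (simp add: deBoor_step_def algebra_simps add_divide_distrib diff_divide_distrib)
  then show ?case by (simp add: Suc)
qed simp

lemma refine_coeff_diff:
  "refine_coeff d t s c (\<lambda>j. a j - b j) i = refine_coeff d t s c a i - refine_coeff d t s c b i"
  using refine_coeff_linear[of d t s c 1 a "-1" b i] by simp

lemma deBoor_step_affine:
  assumes "r \<noteq> v"
  shows "deBoor_step d t u a j = of_real ((r - u) / (r - v)) * deBoor_step d t v a j
     + of_real ((u - v) / (r - v)) * deBoor_step d t r a j"
proof -
  have "r - v \<noteq> 0" using assms by simp
  have "((r - u) * v + (u - v) * r) / (r - v) = u"
  proof -
    have "(r - u) * v + (u - v) * r = u * (r - v)" by algebra
    then show ?thesis using \<open>r - v \<noteq> 0\<close> by simp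
  qed
  then have h: "(r - u) / (r - v) + (u - v) / (r - v) = 1" "(r - u) / (r - v) * v + (u - v) / (r - v) * r = u"
    using \<open>r - v \<noteq> 0\<close> by (simp_all flip: add_divide_distrib)
  define A B where "A = complex_of_real ((r - u) / (r - v))" and "B = complex_of_real ((u - v) / (r - v))"
  have "A + B = 1" "A * of_real v + B * of_real r = of_real u"
    unfolding A_def B_def by (metis h(1) of_real_1 of_real_add, metis h(2) of_real_mult of_real_add)
  then have "of_real (T - u) * p + of_real (u - S) * q = A * (of_real (T - v) * p + of_real (v - S) * q) + B * (of_real (T - r) * p + of_real (r - S) * q)" for T S p q
    by simp algebra
  then show ?thesis
    unfolding deBoor_step_def A_def[symmetric] B_def[symmetric] by (simp only: times_divide_eq_right add_divide_distrib[symmetric])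
qed

context knot_refinement
begin

text \<open>Neighbouring refined coefficients differ in one node, \<open>s i\<close> against
  \<open>s (i + d + 1)\<close>, and affinity in it yields the node \<open>u\<close>. So evaluation
  commutes with refinement, which reduces \<open>spline_refine\<close> to degree zero.\<close>

lemma deBoor_step_refine_coeff:
  "deBoor_step (Suc d) s u (refine_coeff (Suc d) t s c a) = refine_coeff d t s c (deBoor_step (Suc d) t u a)"
proof
  fix i
  have lt: "s i < s (i + int d + 1)" using s by (simp add: strict_mono_def)
  have "deBoor_step (Suc d) t u a = (\<lambda>j. of_real ((s (i + int d + 1) - u) / (s (i + int d + 1) - s i)) * deBoor_step (Suc d) t (s i) a j
     + of_real ((u - s i) / (s (i + int d + 1) - s i)) * deBoor_step (Suc d) t (s (i + int d + 1)) a j)"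
    using lt by (intro ext deBoor_step_affine) simp
  then have "refine_coeff d t s c (deBoor_step (Suc d) t u a) i =
     of_real ((s (i + int d + 1) - u) / (s (i + int d + 1) - s i)) * refine_coeff (Suc d) t s c a (i - 1)
     + of_real ((u - s i) / (s (i + int d + 1) - s i)) * refine_coeff (Suc d) t s c a i"
    unfolding refine_coeff_shift by (simp only: refine_coeff_linear refine_coeff.simps)
  then show "deBoor_step (Suc d) s u (refine_coeff (Suc d) t s c a) i = refine_coeff d t s c (deBoor_step (Suc d) t u a) i"
    unfolding deBoor_step_def[of _ s] by (simp add: add_divide_distrib add.assoc add.commute[of 1] del: refine_coeff.simps)
qed

lemma refine_coeff_polar_coeff: "refine_coeff d t s c (polar_coeff d t P) i = polar_coeff d s P i"
  by (induction d arbitrary: P) (simp_all add: deBoor_step_polar_coeff[OF t] del: polar_coeff.simps(2), simp)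

lemma spline_refine:
  assumes y: "s i \<le> y" "y < s (i + 1)"
  shows "spline d s i (refine_coeff d t s c a) y = spline d t (c i) a y"
proof (induction d arbitrary: a)
  case 0
  have "t (c i) \<le> y" using c(1)[of i] y by simp
  moreover have "y < t (c i + 1)"
  proof -
    obtain r where r: "t (c i + 1) = s r" using sub by (metis imageE)
    have "i < r" using c(2)[of i] r s by (simp add: strict_mono_less)
    then have "s (i + 1) \<le> s r" using s by (simp add: strict_mono_less_eq)
    then show ?thesis using y r by simp
  qed
  ultimately show ?case using y by (simp add: spline_def)
next
  case (Suc d)
  have "t (c i) \<le> y" using c(1)[of i] y by simp
  have "y < t (c i + 1)"
  proof -
    obtain r where r: "t (c i + 1) = s r" using sub by (metis imageE)
    have "i < r" using c(2)[of i] r s by (simp add: strict_mono_less)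
    then have "s (i + 1) \<le> s r" using s by (simp add: strict_mono_less_eq)
    then show ?thesis using y r by simp
  qed
  show ?case
    unfolding spline_step[OF s y] spline_step[OF t \<open>t (c i) \<le> y\<close> \<open>y < t (c i + 1)\<close>] deBoor_step_refine_coeff
    by (rule Suc)
qed

end

section \<open>Bounds for B-splines and polynomials\<close>

text \<open>A discrete intermediate value argument, used for knots and also for the lengths of the
  cells around a point as the level varies.\<close>

lemma strict_mono_index_exists:
  fixes t :: "int \<Rightarrow> real"
  assumes "t j \<le> y" "y < t (j + int n)"
  shows "\<exists>i. t i \<le> y \<and> y < t (i + 1)"
  using assms(2)
proof (induction n)
  case 0
  then show ?case using assms(1) by simp
next
  case (Suc n)
  show ?case
  proof (cases "y < t (j + int n)")
    case False
    then show ?thesis using Suc.prems by (intro exI[of _ "j + int n"]) (simp add: ac_simps)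
  qed (rule Suc.IH)
qed

text \<open>A weight of the recursion is negative only where the B-spline that it multiplies
  vanishes.\<close>

lemma bspline_nonneg:
  assumes t: "strict_mono t"
  shows "0 \<le> bspline d t j y"
proof (induction d arbitrary: j)
  case (Suc d)
  have lt: "t j < t (j + int d + 1)" "t (j + 1) < t (j + int d + 2)" using t by (simp_all add: strict_mono_def)
  have e: "j + 1 + int d + 1 = j + int d + 2" by simp
  have "0 \<le> (y - t j) / (t (j + int d + 1) - t j) * bspline d t j y"
    using bspline_eq_0[OF t, of y j d] Suc[of j] lt by (cases "y < t j") (auto intro!: mult_nonneg_nonneg divide_nonneg_nonneg)
  moreover have "0 \<le> (t (j + int d + 2) - y) / (t (j + int d + 2) - t (j + 1)) * bspline d t (j + 1) y"
    using bspline_eq_0[OF t, of y "j + 1" d] Suc[of "j + 1"] lt unfolding e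
    by (cases "t (j + int d + 2) \<le> y") (auto intro!: mult_nonneg_nonneg divide_nonneg_nonneg)
  ultimately show ?case by simp
qed simp

lemma bspline_le_1:
  assumes t: "strict_mono t"
  shows "bspline d t j y \<le> 1"
proof (cases "t j \<le> y \<and> y < t (j + int d + 1)")
  case True
  then obtain i where i: "t i \<le> y" "y < t (i + 1)"
    using strict_mono_index_exists[of t j y "Suc d"] by (auto simp: ac_simps)
  have "t j < t (i + 1)" "t i < t (j + int d + 1)" using True i by linarith+
  then have j: "j \<in> {i - int d..i}" using t by (auto simp: strict_mono_less)
  have "bspline d t j y \<le> (\<Sum>j = i - int d..i. bspline d t j y)"
    by (rule member_le_sum[OF j]) (auto simp: bspline_nonneg[OF t])
  then show ?thesis using sum_bspline_eq_1[OF t i] by simp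
qed (use bspline_eq_0[OF t, of y j d] in auto)

text \<open>Clamping the weights of the recursion to \<open>[0, 1]\<close> changes nothing on the
  supports. Then all factors lie in \<open>[0, 1]\<close>, and the Lipschitz constants of the two
  products add up to \<open>2 / l + 2 * 4 ^ n / l\<close>, at most \<open>4 ^ (n + 1) / l\<close>.
  The induction starts at the hat function, since degree zero has jumps.\<close>

lemma bspline_lipschitz:
  assumes t: "strict_mono t" and l: "0 < l" "\<And>i. l \<le> t (i + 1) - t i"
  shows "\<bar>bspline (Suc d) t j y - bspline (Suc d) t j z\<bar> \<le> 4 ^ Suc d / l * \<bar>y - z\<bar>"
proof -
  have lin: "\<bar>(y - p) / q - (z - p) / q\<bar> \<le> \<bar>y - z\<bar> / l" "\<bar>(p - y) / q - (p - z) / q\<bar> \<le> \<bar>y - z\<bar> / l" if "l \<le> q" for p q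
  proof -
    have "\<bar>y - z\<bar> / q \<le> \<bar>y - z\<bar> / l" using that l by (intro divide_left_mono) auto
    then show "\<bar>(y - p) / q - (z - p) / q\<bar> \<le> \<bar>y - z\<bar> / l" "\<bar>(p - y) / q - (p - z) / q\<bar> \<le> \<bar>y - z\<bar> / l"
      using that l by (simp_all add: abs_divide abs_minus_commute flip: diff_divide_distrib)
  qed
  show ?thesis
  proof (induction d arbitrary: j)
    case 0
    \<comment> \<open>The hat function as the positive part of the minimum of its two flanks, from
      which its Lipschitz constant is visible.\<close>
    have hat: "bspline (Suc 0) t j y =
        max 0 (min ((y - t j) / (t (j + 1) - t j)) ((t (j + 2) - y) / (t (j + 2) - t (j + 1))))" for y
    proof -
      have lt: "t j < t (j + 1)" "t (j + 1) < t (j + 2)" using t by (simp_all add: strict_mono_def)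
      define u v where "u = (y - t j) / (t (j + 1) - t j)" and "v = (t (j + 2) - y) / (t (j + 2) - t (j + 1))"
      have a: "u \<le> 1 \<longleftrightarrow> y \<le> t (j + 1)" "1 \<le> u \<longleftrightarrow> t (j + 1) \<le> y" "0 \<le> u \<longleftrightarrow> t j \<le> y"
        "v \<le> 1 \<longleftrightarrow> t (j + 1) \<le> y" "1 \<le> v \<longleftrightarrow> y \<le> t (j + 1)" "0 \<le> v \<longleftrightarrow> y \<le> t (j + 2)"
        "v \<le> 0 \<longleftrightarrow> t (j + 2) \<le> y"
        using lt by (auto simp: u_def v_def divide_simps)
      have b: "bspline (Suc 0) t j y = u * (if t j \<le> y \<and> y < t (j + 1) then 1 else 0)
         + v * (if t (j + 1) \<le> y \<and> y < t (j + 2) then 1 else 0)"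
        by (simp add: add.assoc u_def v_def)
      consider "y < t j" | "t j \<le> y" "y < t (j + 1)" | "t (j + 1) \<le> y" "y < t (j + 2)" | "t (j + 2) \<le> y" by linarith
      then have "bspline (Suc 0) t j y = max 0 (min u v)"
      proof cases
        case 1
        then have "\<not> t (j + 1) \<le> y" "\<not> t j \<le> y" "u \<le> 0" using lt a by linarith+
        then show ?thesis unfolding b by simp
      next
        case 2
        then have "\<not> t (j + 1) \<le> y" "0 \<le> u" "u \<le> v" using a by linarith+
        then show ?thesis unfolding b using 2 by simp
      next
        case 3
        then have "\<not> y < t (j + 1)" "0 \<le> v" "v \<le> u" using a by linarith+
        then show ?thesis unfolding b using 3 by simp
      next
        case 4
        then have "\<not> y < t (j + 1)" "\<not> y < t (j + 2)" "v \<le> 0" using lt a by linarith+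
        then show ?thesis unfolding b by simp
      qed
      then show ?thesis by (simp only: u_def v_def)
    qed
    have mm: "\<bar>max 0 (min a b) - max 0 (min a' b')\<bar> \<le> e" if "\<bar>a - a'\<bar> \<le> e" "\<bar>b - b'\<bar> \<le> e" for a b a' b' e :: real
      using that by linarith
    have l2: "l \<le> t (j + 2) - t (j + 1)" using l(2)[of "j + 1"] by (simp add: add.assoc)
    have "\<bar>bspline (Suc 0) t j y - bspline (Suc 0) t j z\<bar> \<le> \<bar>y - z\<bar> / l"
      unfolding hat by (rule mm) (rule lin l(2) l2)+
    also have "\<dots> \<le> 4 * (\<bar>y - z\<bar> / l)" using l by (simp add: divide_simps)
    finally show ?case by simp
  next
    case (Suc d)
    let ?L = "4 ^ Suc d / l * \<bar>y - z\<bar>"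
    have prod: "\<bar>w y * B y - w z * B z\<bar> \<le> \<bar>y - z\<bar> / l + ?L"
      if w: "\<And>x. 0 \<le> w x" "\<And>x. w x \<le> 1" "\<bar>w y - w z\<bar> \<le> \<bar>y - z\<bar> / l"
        and B: "\<And>x. 0 \<le> B x" "\<And>x. B x \<le> 1" "\<bar>B y - B z\<bar> \<le> ?L" for w B :: "real \<Rightarrow> real"
    proof -
      have "w y * B y - w z * B z = (w y - w z) * B y + w z * (B y - B z)" by algebra
      also have "\<bar>\<dots>\<bar> \<le> \<bar>w y - w z\<bar> * \<bar>B y\<bar> + \<bar>w z\<bar> * \<bar>B y - B z\<bar>"
        by (metis abs_mult abs_triangle_ineq)
      also have "\<dots> \<le> \<bar>w y - w z\<bar> * 1 + 1 * \<bar>B y - B z\<bar>"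
        using w(1,2) B(1,2) by (intro add_mono mult_mono) (auto simp: abs_le_iff intro: order_trans)
      finally show ?thesis using w(3) B(3) by linarith
    qed
    define w v where "w x = max 0 (min 1 ((x - t j) / (t (j + int (Suc d) + 1) - t j)))"
      and "v x = max 0 (min 1 ((t (j + int (Suc d) + 2) - x) / (t (j + int (Suc d) + 2) - t (j + 1))))" for x
    have gap: "l \<le> t (i + int n + 1) - t i" for i n
    proof -
      have "t (i + 1) \<le> t (i + int n + 1)" using t by (simp add: strict_mono_less_eq)
      then show ?thesis using l(2)[of i] by linarith
    qed
    have g1: "l \<le> t (j + int (Suc d) + 1) - t j" by (rule gap)
    have e: "j + 1 + int (Suc d) + 1 = j + int (Suc d) + 2" by simp
    have g2: "l \<le> t (j + int (Suc d) + 2) - t (j + 1)" using gap[of "j + 1" "Suc d"] unfolding e .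
    have clamp: "\<bar>max 0 (min 1 a) - max 0 (min 1 b)\<bar> \<le> \<bar>a - b\<bar>" for a b :: real
      by linarith
    have eq: "bspline (Suc (Suc d)) t j x = w x * bspline (Suc d) t j x + v x * bspline (Suc d) t (j + 1) x" for x
    proof -
      have "(x - t j) / (t (j + int (Suc d) + 1) - t j) * bspline (Suc d) t j x = w x * bspline (Suc d) t j x"
      proof (cases "t j \<le> x \<and> x < t (j + int (Suc d) + 1)")
        case True
        then have "0 \<le> (x - t j) / (t (j + int (Suc d) + 1) - t j)" "(x - t j) / (t (j + int (Suc d) + 1) - t j) \<le> 1"
          using g1 l(1) by (auto simp: divide_simps)
        then show ?thesis by (simp add: w_def)
      qed (use bspline_eq_0[OF t, of x j "Suc d"] in auto)
      moreover have "(t (j + int (Suc d) + 2) - x) / (t (j + int (Suc d) + 2) - t (j + 1)) * bspline (Suc d) t (j + 1) x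
          = v x * bspline (Suc d) t (j + 1) x"
      proof (cases "t (j + 1) \<le> x \<and> x < t (j + int (Suc d) + 2)")
        case True
        then have "0 \<le> (t (j + int (Suc d) + 2) - x) / (t (j + int (Suc d) + 2) - t (j + 1))"
            "(t (j + int (Suc d) + 2) - x) / (t (j + int (Suc d) + 2) - t (j + 1)) \<le> 1"
          using g2 l(1) by (auto simp: divide_simps)
        then show ?thesis by (simp add: v_def)
      qed (use bspline_eq_0[OF t, of x "j + 1" "Suc d"] in \<open>auto simp del: bspline.simps\<close>)
      ultimately show ?thesis unfolding bspline.simps(2)[of "Suc d"] by simp
    qed
    have w01: "0 \<le> w x" "w x \<le> 1" "0 \<le> v x" "v x \<le> 1" for x by (simp_all add: w_def v_def)
    have wl: "\<bar>w y - w z\<bar> \<le> \<bar>y - z\<bar> / l" "\<bar>v y - v z\<bar> \<le> \<bar>y - z\<bar> / l"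
      unfolding w_def v_def by (rule order_trans[OF clamp lin(1)[OF g1]] order_trans[OF clamp lin(2)[OF g2]])+
    have "\<bar>w y * bspline (Suc d) t j y - w z * bspline (Suc d) t j z\<bar> \<le> \<bar>y - z\<bar> / l + ?L"
      by (rule prod w01 wl bspline_nonneg[OF t] bspline_le_1[OF t] Suc)+
    moreover have "\<bar>v y * bspline (Suc d) t (j + 1) y - v z * bspline (Suc d) t (j + 1) z\<bar> \<le> \<bar>y - z\<bar> / l + ?L"
      by (rule prod w01 wl bspline_nonneg[OF t] bspline_le_1[OF t] Suc)+
    ultimately have "\<bar>bspline (Suc (Suc d)) t j y - bspline (Suc (Suc d)) t j z\<bar> \<le> 2 * (\<bar>y - z\<bar> / l) + 2 * ?L"
      unfolding eq by linarith
    also have "\<dots> = (2 + 2 * 4 ^ Suc d) * (\<bar>y - z\<bar> / l)" by (simp add: algebra_simps)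
    also have "\<dots> \<le> 4 ^ Suc (Suc d) * (\<bar>y - z\<bar> / l)"
    proof (rule mult_right_mono)
      have "(1::real) \<le> 4 ^ Suc d" by (rule one_le_power) simp
      then show "2 + 2 * 4 ^ Suc d \<le> (4 ^ Suc (Suc d) :: real)" by simp
    qed (use l in simp)
    finally show ?case by simp
  qed
qed

section \<open>Finite differences\<close>

definition nth_diff :: "nat \<Rightarrow> real \<Rightarrow> (real \<Rightarrow> 'a::comm_ring_1) \<Rightarrow> real \<Rightarrow> 'a" where
  "nth_diff k h f y = (\<Sum>i\<le>k. (-1) ^ (k + i) * of_nat (k choose i) * f (y + real i * h))"

lemma nth_diff_Suc: "nth_diff (Suc k) h f y = nth_diff k h f (y + h) - nth_diff k h f y"
proof -
  define F where "F i = f (y + real i * h)" for i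
  have 1: "nth_diff k h f (y + h) = (\<Sum>i\<le>k. (-1) ^ (k + i) * of_nat (k choose i) * F (Suc i))"
    by (simp add: nth_diff_def F_def algebra_simps)
  have "nth_diff k h f y = (\<Sum>i\<le>Suc k. (-1) ^ (k + i) * of_nat (k choose i) * F i)"
    by (simp add: nth_diff_def F_def binomial_eq_0)
  also have "\<dots> = (-1) ^ k * F 0 - (\<Sum>i\<le>k. (-1) ^ (k + i) * of_nat (k choose Suc i) * F (Suc i))"
    by (subst sum.atMost_Suc_shift) (simp add: sum_negf)
  finally have 2: "nth_diff k h f y = \<dots>" .
  have "nth_diff (Suc k) h f y = (\<Sum>i\<le>Suc k. (-1) ^ (Suc k + i) * of_nat (Suc k choose i) * F i)"
    by (simp add: nth_diff_def F_def)
  also have "\<dots> = - ((-1) ^ k * F 0) + (\<Sum>i\<le>k. (-1) ^ (k + i) * of_nat (Suc k choose Suc i) * F (Suc i))"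
    by (subst sum.atMost_Suc_shift) simp
  also have "\<dots> = - ((-1) ^ k * F 0) + (\<Sum>i\<le>k. (-1) ^ (k + i) * of_nat (k choose i) * F (Suc i))
      + (\<Sum>i\<le>k. (-1) ^ (k + i) * of_nat (k choose Suc i) * F (Suc i))"
    by (simp add: algebra_simps sum.distrib)
  finally show ?thesis unfolding 1 2 by simp
qed

lemma nth_diff_commute: "nth_diff k h f (y + s) - nth_diff k h f y = nth_diff k h (\<lambda>y. f (y + s) - f y) y"
  by (simp add: nth_diff_def right_diff_distrib sum_subtractf algebra_simps)

definition diff_poly :: "'a::comm_ring_1 \<Rightarrow> 'a poly \<Rightarrow> 'a poly" where
  "diff_poly h p = pcompose p [:h, 1:] - p"

lemma poly_diff_poly: "poly (diff_poly h p) y = poly p (y + h) - poly p y"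
  by (simp add: diff_poly_def poly_pcompose add.commute)

lemma diff_poly_pCons:
  "diff_poly h (pCons a p) = pCons 0 (diff_poly h p) + smult h (pcompose p [:h, 1:])"
proof -
  have "pCons 0 (pcompose p [:h, 1:]) - pCons a p + [:a:] = pCons 0 (pcompose p [:h, 1:] - p)" by simp
  then show ?thesis by (simp add: diff_poly_def pcompose_pCons algebra_simps)
qed

text \<open>The difference of \<open>X * p\<close> is \<open>X\<close> times the difference of
  \<open>p\<close> plus \<open>h\<close> times the shifted \<open>p\<close>; both parts contribute
  to the leading coefficient, and induction counts the contributions.\<close>

lemma diff_poly_lead:
  fixes p :: "'a::idom poly"
  assumes "degree p \<le> Suc n"
  shows "degree (diff_poly h p) \<le> n \<and> coeff (diff_poly h p) n = h * of_nat (Suc n) * coeff p (Suc n)"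
  using assms
proof (induction p arbitrary: n)
  case 0
  then show ?case by (simp add: diff_poly_def)
next
  case (pCons a p)
  show ?case
  proof (cases n)
    case 0
    then have "degree p = 0" using pCons.prems pCons.hyps by (auto split: if_splits)
    then obtain b where b: "p = [:b:]" by (metis degree_eq_zeroE)
    then show ?thesis using 0 by (simp add: diff_poly_pCons) (simp add: diff_poly_def)
  next
    case (Suc n')
    have d: "degree p \<le> Suc n'" using pCons.prems pCons.hyps Suc by (auto split: if_splits)
    note IH = pCons.IH[OF d]
    have c: "coeff (diff_poly h p) (Suc n') = 0" using IH by (intro coeff_eq_0) auto
    then have c': "coeff (pcompose p [:h, 1:]) (Suc n') = coeff p (Suc n')" by (simp add: diff_poly_def)
    have "degree (pcompose p [:h, 1:]) \<le> Suc n'" using degree_pcompose_le[of p "[:h, 1:]"] d by simp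
    then have "degree (diff_poly h (pCons a p)) \<le> Suc n'" unfolding diff_poly_pCons
      using IH by (intro degree_add_le) (auto intro: order_trans[OF degree_pCons_le] order_trans[OF degree_smult_le])
    moreover have "coeff (diff_poly h (pCons a p)) (Suc n') = h * of_nat (Suc n) * coeff (pCons a p) (Suc n)"
      unfolding diff_poly_pCons using IH c' Suc by (simp add: algebra_simps)
    ultimately show ?thesis using Suc by simp
  qed
qed

lemma nth_diff_poly:
  fixes P :: "complex poly"
  assumes "P = 0 \<or> degree P < k"
  shows "nth_diff k h (\<lambda>y. poly P (of_real y)) y = 0"
  using assms
proof (induction k arbitrary: P y)
  case 0
  then show ?case by (simp add: nth_diff_def)
next
  case (Suc k)
  let ?Q = "diff_poly (of_real h) P"
  have "?Q = 0 \<or> degree ?Q < k"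
  proof (cases k)
    case 0
    then have "degree P = 0" using Suc.prems by auto
    then obtain b where "P = [:b:]" by (rule degree_eq_zeroE)
    then show ?thesis by (simp add: diff_poly_def)
  next
    case (Suc k')
    then have "degree P \<le> Suc k'" using Suc.prems by auto
    then show ?thesis using diff_poly_lead[of P k' "of_real h"] Suc by (auto simp: less_Suc_eq_le)
  qed
  then have "nth_diff k h (\<lambda>y. poly ?Q (of_real y)) y = 0" by (rule Suc.IH)
  then show ?case by (simp add: nth_diff_Suc nth_diff_commute poly_diff_poly)
qed

section \<open>Coefficients of a polynomial against its L1 norm on an interval\<close>

lemma poly_integrable:
  "(\<lambda>x. norm (poly P (complex_of_real x))) integrable_on {a..b}"
  by (intro integrable_continuous_real continuous_intros)

text \<open>Differencing with step \<open>l / 2\<close> lowers the degree and multiplies the leading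
  coefficient by \<open>l / 2 * Suc d\<close>, while the integral of the difference over the left
  half is at most that of \<open>P\<close> over both halves. Induction on \<open>d\<close> ends at
  constants.\<close>

lemma lead_coeff_bound:
  assumes "l > 0"
  shows "\<exists>C>0. \<forall>P::complex poly. degree P \<le> d \<longrightarrow>
           norm (coeff P d) \<le> C * integral {0..l} (\<lambda>x. norm (poly P (of_real x)))"
  using assms
proof (induction d arbitrary: l)
  case 0
  show ?case
  proof (intro exI[of _ "1 / l"] conjI allI impI)
    fix P :: "complex poly" assume "degree P \<le> 0"
    then obtain b where "P = [:b:]" by (metis degree_eq_zeroE le_zero_eq)
    then show "norm (coeff P 0) \<le> 1 / l * integral {0..l} (\<lambda>x. norm (poly P (of_real x)))"
      using 0 by simp
  qed (use 0 in simp)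
next
  case (Suc d)
  obtain C where C: "C > 0" "\<And>P::complex poly. degree P \<le> d \<Longrightarrow>
           norm (coeff P d) \<le> C * integral {0..l/2} (\<lambda>x. norm (poly P (of_real x)))"
    using Suc.IH[OF half_gt_zero[OF Suc.prems]] by blast
  show ?case
  proof (intro exI[of _ "2 * C / (l * of_nat (Suc d))"] conjI allI impI)
    fix P :: "complex poly" assume P: "degree P \<le> Suc d"
    let ?Q = "diff_poly (of_real (l / 2)) P"
    let ?f = "\<lambda>x. norm (poly P (complex_of_real x))"
    note Q = diff_poly_lead[OF P, of "of_real (l / 2)"]
    have "norm (coeff ?Q d) \<le> C * integral {0..l/2} (\<lambda>x. norm (poly ?Q (of_real x)))" using C(2) Q by auto
    also have "integral {0..l/2} (\<lambda>x. norm (poly ?Q (of_real x))) \<le> integral {0..l/2} (\<lambda>x. ?f (x + l / 2) + ?f x)"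
    proof (rule integral_le)
      show "(\<lambda>x. ?f (x + l / 2) + ?f x) integrable_on {0..l/2}"
        by (intro integrable_continuous_real continuous_intros)
      show "norm (poly ?Q (of_real x)) \<le> ?f (x + l / 2) + ?f x" if "x \<in> {0..l/2}" for x
        using norm_triangle_ineq4[of "poly P (of_real (x + l / 2))" "poly P (of_real x)"]
        by (simp add: poly_diff_poly)
    qed (rule poly_integrable)
    also have "\<dots> = integral {0..l/2} (\<lambda>x. ?f (x + l / 2)) + integral {0..l/2} ?f"
      by (intro Henstock_Kurzweil_Integration.integral_add integrable_continuous_real continuous_intros)
    also have "integral {0..l/2} (\<lambda>x. ?f (x + l / 2)) = integral {l/2..l} ?f"
      using integral_shift_real_ivl[of "l/2" "l/2" "l" ?f] by simp
    also have "integral {l/2..l} ?f + integral {0..l/2} ?f = integral {0..l} ?f"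
      using Henstock_Kurzweil_Integration.integral_combine[of 0 "l/2" l ?f] poly_integrable[of P 0 l] Suc.prems by simp
    finally have "norm (coeff ?Q d) \<le> C * integral {0..l} ?f" using C(1) by simp
    moreover have "norm (coeff ?Q d) = l / 2 * of_nat (Suc d) * norm (coeff P (Suc d))"
      unfolding Q[THEN conjunct2] norm_mult norm_of_real norm_of_nat using Suc.prems by simp
    ultimately show "norm (coeff P (Suc d)) \<le> 2 * C / (l * of_nat (Suc d)) * integral {0..l} ?f"
      using Suc.prems by (simp add: field_simps del: of_nat_Suc)
  qed (use C Suc.prems in simp)
qed

text \<open>The leading term, controlled by \<open>lead_coeff_bound\<close>, is split off; the L1
  norm of the remainder is at most \<open>1 + D\<close> times that of \<open>P\<close>, and the
  induction hypothesis applies to it.\<close>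

lemma coeff_sum_bound:
  "\<exists>C>0. \<forall>P::complex poly. degree P \<le> d \<longrightarrow>
     (\<Sum>i\<le>d. norm (coeff P i)) \<le> C * integral {0..1} (\<lambda>x. norm (poly P (of_real x)))"
proof (induction d)
  case 0
  then show ?case using lead_coeff_bound[of 1 0] by simp
next
  case (Suc d)
  then obtain C where C: "C > 0" "\<And>P::complex poly. degree P \<le> d \<Longrightarrow>
     (\<Sum>i\<le>d. norm (coeff P i)) \<le> C * integral {0..1} (\<lambda>x. norm (poly P (of_real x)))" by auto
  obtain D where D: "D > 0" "\<And>P::complex poly. degree P \<le> Suc d \<Longrightarrow>
     norm (coeff P (Suc d)) \<le> D * integral {0..1} (\<lambda>x. norm (poly P (of_real x)))"
    using lead_coeff_bound[of 1 "Suc d"] by auto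
  show ?case
  proof (intro exI[of _ "C * (1 + D) + D"] conjI allI impI)
    fix P :: "complex poly" assume P: "degree P \<le> Suc d"
    define Q where "Q = P - monom (coeff P (Suc d)) (Suc d)"
    let ?I = "integral {0..1} (\<lambda>x. norm (poly P (of_real x)))"
    have Qd: "degree Q \<le> d"
    proof (rule degree_le, intro allI impI)
      fix i assume "d < i"
      then show "coeff Q i = 0" using P by (cases "i = Suc d") (auto simp: Q_def coeff_eq_0)
    qed
    have "integral {0..1} (\<lambda>x. norm (poly Q (of_real x))) \<le> integral {0..1} (\<lambda>x. norm (poly P (of_real x)) + norm (coeff P (Suc d)))"
    proof (rule integral_le)
      show "(\<lambda>x. norm (poly P (complex_of_real x)) + norm (coeff P (Suc d))) integrable_on {0..1}"
        by (intro integrable_continuous_real continuous_intros)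
      fix x :: real assume x: "x \<in> {0..1}"
      have "norm (coeff P (Suc d) * of_real x ^ Suc d) \<le> norm (coeff P (Suc d)) * 1"
        unfolding norm_mult norm_power using x by (intro mult_left_mono power_le_one) auto
      then show "norm (poly Q (of_real x)) \<le> norm (poly P (of_real x)) + norm (coeff P (Suc d))"
        using norm_triangle_ineq4[of "poly P (of_real x)" "coeff P (Suc d) * of_real x ^ Suc d"]
        by (simp add: Q_def poly_monom del: power_Suc)
    qed (rule poly_integrable)
    also have "\<dots> = ?I + norm (coeff P (Suc d))"
      by (subst Henstock_Kurzweil_Integration.integral_add) (auto intro: poly_integrable)
    also have "\<dots> \<le> (1 + D) * ?I" using D(2)[OF P] by (simp add: algebra_simps)
    finally have "C * integral {0..1} (\<lambda>x. norm (poly Q (of_real x))) \<le> C * ((1 + D) * ?I)" using C(1) by simp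
    then have "(\<Sum>i\<le>d. norm (coeff Q i)) \<le> C * ((1 + D) * ?I)" using C(2)[OF Qd] by linarith
    moreover have "(\<Sum>i\<le>d. norm (coeff Q i)) = (\<Sum>i\<le>d. norm (coeff P i))"
      by (rule sum.cong) (auto simp: Q_def)
    ultimately show "(\<Sum>i\<le>Suc d. norm (coeff P i)) \<le> (C * (1 + D) + D) * ?I"
      using D(2)[OF P] by (simp add: algebra_simps)
  qed (use C D in \<open>simp add: add_pos_pos\<close>)
qed

text \<open>The coefficient norm of \<open>P\<close> in the variable \<open>(x - u) / l\<close>.
  Estimates in it have constants that are the same at all positions and scales.\<close>

definition local_norm :: "nat \<Rightarrow> real \<Rightarrow> real \<Rightarrow> complex poly \<Rightarrow> real" where
  "local_norm d u l P = (\<Sum>i\<le>d. norm (coeff (pcompose P [:of_real u, of_real l:]) i))"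

lemma poly_local:
  fixes P :: "complex poly"
  assumes "l > 0"
  shows "poly P (of_real y) = poly (pcompose P [:of_real u, of_real l:]) (of_real ((y - u) / l))"
  using assms by (simp add: poly_pcompose)

lemma local_norm_integral_bound:
  "\<exists>C>0. \<forall>P u l. degree P \<le> d \<longrightarrow> l > 0 \<longrightarrow>
     local_norm d u l P \<le> C / l * integral {u..u + l} (\<lambda>x. norm (poly P (of_real x)))"
proof -
  obtain C where C: "C > 0" "\<And>P::complex poly. degree P \<le> d \<Longrightarrow>
     (\<Sum>i\<le>d. norm (coeff P i)) \<le> C * integral {0..1} (\<lambda>x. norm (poly P (of_real x)))"
    using coeff_sum_bound by blast
  show ?thesis
  proof (intro exI[of _ C] conjI allI impI)
    fix P :: "complex poly" and u l :: real assume P: "degree P \<le> d" and l: "l > 0"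
    let ?p = "pcompose P [:of_real u, of_real l:]"
    let ?f = "\<lambda>x. norm (poly P (complex_of_real x))"
    have "degree ?p \<le> d" using degree_pcompose_le[of P "[:of_real u, of_real l:]"] P l by simp
    then have 1: "local_norm d u l P \<le> C * integral {0..1} (\<lambda>x. norm (poly ?p (of_real x)))"
      unfolding local_norm_def by (rule C(2))
    have "(?f has_integral integral {u..u+l} ?f) {u..u+l}"
      using poly_integrable by (rule integrable_integral)
    from has_integral_affinity[OF this[folded cbox_interval], of l u] l
    have "((\<lambda>x. ?f (l * x + u)) has_integral (1 / l) * integral {u..u+l} ?f) ((\<lambda>x. x / l - u / l) ` {u..u+l})"
      by (simp add: cbox_interval divide_inverse mult.commute)
    moreover have "(\<lambda>x. x / l - u / l) ` {u..u+l} = {0..1}"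
    proof (safe)
      fix x assume "x \<in> {u..u+l}" then show "x / l - u / l \<in> {0..1}" using l by (auto simp: field_simps)
    next
      fix x :: real assume "x \<in> {0..1}"
      then show "x \<in> (\<lambda>x. x / l - u / l) ` {u..u+l}"
        using l by (intro image_eqI[of _ _ "u + l * x"]) (auto simp: field_simps)
    qed
    ultimately have "integral {0..1} (\<lambda>x. ?f (l * x + u)) = (1 / l) * integral {u..u+l} ?f"
      by (auto intro: integral_unique)
    moreover have "(\<lambda>x. norm (poly ?p (of_real x))) = (\<lambda>x. ?f (l * x + u))"
      by (rule ext) (simp add: poly_pcompose algebra_simps)
    ultimately show "local_norm d u l P \<le> C / l * integral {u..u + l} ?f"
      using 1 by simp
  qed (rule C(1))
qed

lemma local_norm_sup_bound:
  assumes P: "degree P \<le> d" and l: "l > 0" and y: "\<bar>y - u\<bar> \<le> K * l" and K: "1 \<le> K"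
  shows "norm (poly P (of_real y)) \<le> K ^ d * local_norm d u l P"
proof -
  let ?p = "pcompose P [:of_real u, of_real l:]"
  have dp: "degree ?p \<le> d" using degree_pcompose_le[of P "[:of_real u, of_real l:]"] P l by simp
  define z where "z = (y - u) / l"
  have z: "\<bar>z\<bar> \<le> K" using y l by (simp add: z_def field_simps)
  have "poly P (of_real y) = (\<Sum>i\<le>degree ?p. coeff ?p i * of_real z ^ i)"
    unfolding poly_local[OF l, of P y u] z_def[symmetric] by (rule poly_altdef)
  also have "\<dots> = (\<Sum>i\<le>d. coeff ?p i * of_real z ^ i)"
    using dp by (intro sum.mono_neutral_left) (auto simp: coeff_eq_0)
  also have "norm \<dots> \<le> (\<Sum>i\<le>d. norm (coeff ?p i) * K ^ d)"
  proof (rule order_trans[OF norm_sum], rule sum_mono)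
    fix i assume i: "i \<in> {..d}"
    have "\<bar>z\<bar> ^ i \<le> K ^ i" using z by (intro power_mono) auto
    also have "\<dots> \<le> K ^ d" using i K by (intro power_increasing) auto
    finally show "norm (coeff ?p i * of_real z ^ i) \<le> norm (coeff ?p i) * K ^ d"
      by (simp add: norm_mult norm_power mult_left_mono)
  qed
  finally show ?thesis unfolding local_norm_def sum_distrib_left by (simp only: mult.commute)
qed

text \<open>Blossoms are compatible with affine changes of variable: the factor \<open>l\<close>
  from the chain rule absorbs the rescaling of the node.\<close>

lemma pcompose_polar_step:
  assumes l: "l > 0"
  shows "pcompose (polar_step d (of_real v) P) [:of_real u, of_real l:]
    = polar_step d (of_real ((v - u) / l)) (pcompose P [:of_real u, of_real l:])"
proof -
  let ?q = "[:complex_of_real u, complex_of_real l:]"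
  have 1: "pderiv (pcompose P ?q) = smult (of_real l) (pcompose (pderiv P) ?q)"
    by (simp add: pderiv_pcompose pderiv_pCons)
  have 2: "pcompose [:of_real v, -1:] ?q = [:of_real v - of_real u, - of_real l:]"
    by (simp add: pcompose_pCons)
  have 3: "smult (of_real l) [:of_real ((v - u) / l), -1:] = [:of_real v - of_real u, - complex_of_real l:]"
    using l by simp
  have "[:of_real ((v - u) / l), -1:] * smult (complex_of_real l) (pcompose (pderiv P) ?q)
      = smult (of_real l) [:of_real ((v - u) / l), -1:] * pcompose (pderiv P) ?q"
    by (simp only: mult_smult_left mult_smult_right)
  then show ?thesis unfolding polar_step_def pcompose_add pcompose_smult pcompose_mult 1 2 unfolding 3 by simp
qed

lemma polar_step_coeff_sum:
  assumes v: "norm v \<le> K" and K: "0 \<le> K"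
  shows "(\<Sum>i\<le>d. norm (coeff (polar_step (Suc d) v P) i)) \<le> (K + 2) * (\<Sum>i\<le>Suc d. norm (coeff P i))"
proof -
  let ?S = "\<Sum>i\<le>Suc d. norm (coeff P i)"
  have "norm (coeff (polar_step (Suc d) v P) i) \<le> 2 * norm (coeff P i) + K * norm (coeff P (Suc i))" if "i \<le> d" for i
  proof -
    have D: "real (Suc d) > 0" by simp
    have a: "norm (v * of_nat (Suc i) * coeff P (Suc i) / of_nat (Suc d)) \<le> K * norm (coeff P (Suc i))"
    proof -
      have "norm (v * of_nat (Suc i) * coeff P (Suc i) / of_nat (Suc d)) = norm v * norm (coeff P (Suc i)) * (real (Suc i) / real (Suc d))"
        by (simp add: norm_mult norm_divide del: of_nat_Suc)
      also have "\<dots> \<le> K * norm (coeff P (Suc i)) * 1"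
        using v K that by (intro mult_mono) (auto simp: divide_simps)
      finally show ?thesis by simp
    qed
    have b: "norm (of_nat i * coeff P i / of_nat (Suc d)) \<le> norm (coeff P i)"
    proof -
      have "norm (of_nat i * coeff P i / of_nat (Suc d)) = norm (coeff P i) * (real i / real (Suc d))"
        by (simp add: norm_mult norm_divide del: of_nat_Suc)
      also have "\<dots> \<le> norm (coeff P i) * 1"
        using that by (intro mult_left_mono) (auto simp: divide_simps)
      finally show ?thesis by simp
    qed
    show ?thesis unfolding coeff_polar_step diff_divide_distrib
      using norm_triangle_ineq[of "coeff P i" "v * of_nat (Suc i) * coeff P (Suc i) / of_nat (Suc d) - of_nat i * coeff P i / of_nat (Suc d)"]
        norm_triangle_ineq4[of "v * of_nat (Suc i) * coeff P (Suc i) / of_nat (Suc d)" "of_nat i * coeff P i / of_nat (Suc d)"] a b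
      by linarith
  qed
  then have "(\<Sum>i\<le>d. norm (coeff (polar_step (Suc d) v P) i)) \<le> (\<Sum>i\<le>d. 2 * norm (coeff P i) + K * norm (coeff P (Suc i)))"
    by (intro sum_mono) simp
  also have "\<dots> = 2 * (\<Sum>i\<le>d. norm (coeff P i)) + K * (\<Sum>i\<le>d. norm (coeff P (Suc i)))"
    by (simp add: sum.distrib sum_distrib_left)
  also have "\<dots> \<le> 2 * ?S + K * ?S"
  proof (intro add_mono mult_left_mono)
    show "(\<Sum>i\<le>d. norm (coeff P (Suc i))) \<le> ?S" by (subst sum.atMost_Suc_shift) simp
  qed (use K in simp_all)
  finally show ?thesis by (simp add: algebra_simps)
qed

text \<open>In the rescaled variable all nodes have modulus at most \<open>K\<close>, and each of
  the \<open>d\<close> polar steps enlarges the coefficient norm by at most the factor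
  \<open>K + 2\<close>.\<close>

lemma polar_coeff_bound:
  assumes P: "degree P \<le> d" and l: "l > 0" and K: "0 \<le> K"
    and t: "\<And>r. 1 \<le> r \<Longrightarrow> r \<le> d \<Longrightarrow> \<bar>t (j + int r) - u\<bar> \<le> K * l"
  shows "norm (polar_coeff d t P j) \<le> (K + 2) ^ d * local_norm d u l P"
  using P t
proof (induction d arbitrary: P)
  case 0
  then obtain b where "P = [:b:]" by (metis degree_eq_zeroE le_zero_eq)
  then show ?case by (simp add: local_norm_def)
next
  case (Suc d)
  let ?v = "t (j + int d + 1)"
  have v: "\<bar>?v - u\<bar> \<le> K * l" using Suc.prems(2)[of "Suc d"] by (simp add: ac_simps)
  have "norm (polar_coeff (Suc d) t P j) \<le> (K + 2) ^ d * local_norm d u l (polar_step (Suc d) (of_real ?v) P)"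
    using Suc.IH[OF degree_polar_step[OF Suc.prems(1)]] Suc.prems(2) by simp
  also have "local_norm d u l (polar_step (Suc d) (of_real ?v) P) \<le> (K + 2) * local_norm (Suc d) u l P"
    unfolding local_norm_def pcompose_polar_step[OF l]
  proof (rule polar_step_coeff_sum[OF _ K])
    show "norm (complex_of_real ((?v - u) / l)) \<le> K"
      unfolding norm_of_real abs_divide using v l by (simp add: field_simps)
  qed
  finally show ?case using K by (simp add: algebra_simps mult_left_mono)
qed

text \<open>The nodes may lie outside the knot intervals, so a de Boor step need not be a convex
  combination. Each of its two weights is still at most \<open>K\<close>, the denominator being at
  least \<open>l\<close>; hence the factor \<open>2 * K\<close> per step.\<close>

lemma refine_coeff_bound:
  assumes t: "strict_mono t" and l: "l > 0" "\<And>j. l \<le> t (j + 1) - t j" and K: "0 \<le> K"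
    and s: "\<And>r j. 1 \<le> r \<Longrightarrow> r \<le> d \<Longrightarrow> c i - int d \<le> j \<Longrightarrow> j \<le> c i + int d \<Longrightarrow> \<bar>s (i + int r) - t j\<bar> \<le> K * l"
    and a: "\<And>j. c i - int d \<le> j \<Longrightarrow> j \<le> c i \<Longrightarrow> norm (a j) \<le> D"
  shows "norm (refine_coeff d t s c a i) \<le> (2 * K) ^ d * D"
  using s a
proof (induction d arbitrary: a D)
  case 0
  then show ?case by simp
next
  case (Suc d)
  let ?u = "s (i + int d + 1)"
  have "norm (refine_coeff d t s c (deBoor_step (Suc d) t ?u a) i) \<le> (2 * K) ^ d * (2 * K * D)"
  proof (rule Suc.IH)
    fix j assume j: "c i - int d \<le> j" "j \<le> c i"
    have 1: "\<bar>?u - t j\<bar> \<le> K * l" "\<bar>?u - t (j + int (Suc d))\<bar> \<le> K * l"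
      using Suc.prems(1)[of "Suc d" j] Suc.prems(1)[of "Suc d" "j + int (Suc d)"] j by (simp_all add: ac_simps)
    have 2: "norm (a (j - 1)) \<le> D" "norm (a j) \<le> D" using Suc.prems(2)[of "j - 1"] Suc.prems(2)[of j] j by auto
    have "t (j + 1) \<le> t (j + int (Suc d))" using t by (simp add: strict_mono_less_eq)
    then have 3: "l \<le> t (j + int (Suc d)) - t j" using l(2)[of j] by linarith
    have D: "0 \<le> D" using 2(1) norm_ge_zero order_trans by blast
    have "norm (deBoor_step (Suc d) t ?u a j) =
        norm (of_real (t (j + int (Suc d)) - ?u) * a (j - 1) + of_real (?u - t j) * a j) / (t (j + int (Suc d)) - t j)"
      unfolding deBoor_step_def norm_divide norm_of_real using 3 l(1) by simp
    also have "\<dots> \<le> (K * l * D + K * l * D) / (t (j + int (Suc d)) - t j)"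
    proof (rule divide_right_mono)
      have "norm (of_real (t (j + int (Suc d)) - ?u) * a (j - 1)) \<le> K * l * D"
        unfolding norm_mult norm_of_real using 1 2 K l(1) by (intro mult_mono) (auto simp: abs_minus_commute)
      moreover have "norm (of_real (?u - t j) * a j) \<le> K * l * D"
        unfolding norm_mult norm_of_real using 1 2 K l(1) by (intro mult_mono) auto
      ultimately show "norm (of_real (t (j + int (Suc d)) - ?u) * a (j - 1) + of_real (?u - t j) * a j) \<le> K * l * D + K * l * D"
        by (intro order_trans[OF norm_triangle_ineq] add_mono)
    qed (use 3 l in simp)
    also have "\<dots> \<le> (K * l * D + K * l * D) / l"
      using 3 l K D by (intro divide_left_mono) auto
    also have "\<dots> = 2 * K * D" using l by (simp add: field_simps)
    finally show "norm (deBoor_step (Suc d) t ?u a j) \<le> 2 * K * D" .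
  qed (use Suc.prems(1) in auto)
  then show ?case by (simp add: algebra_simps)
qed

section \<open>Local polynomial approximation by Steklov means\<close>

definition loc_int :: "(real \<Rightarrow> real) \<Rightarrow> bool" where
  "loc_int u \<longleftrightarrow> u \<in> borel_measurable borel \<and> (\<forall>a b. set_integrable lborel {a..b} u)"

definition steklov :: "real \<Rightarrow> (real \<Rightarrow> real) \<Rightarrow> real \<Rightarrow> real" where
  "steklov \<eta> u x = (LINT s:{0..1}|lborel. u (x + \<eta> * s))"

lemma loc_int_measurable: "loc_int u \<Longrightarrow> u \<in> borel_measurable borel"
  by (simp add: loc_int_def)

lemma loc_int_continuous:
  assumes "\<And>x. isCont u x"
  shows "loc_int u"
proof -
  have c: "continuous_on S u" for S using assms by (simp add: continuous_at_imp_continuous_on)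
  show ?thesis unfolding loc_int_def using c
    by (auto intro: borel_measurable_continuous_onI borel_integrable_atLeastAtMost')
qed

lemma loc_int_affine:
  assumes "loc_int u" "0 \<le> \<eta>"
  shows "set_integrable lborel {0..1} (\<lambda>s. u (x + \<eta> * s))"
proof (cases "\<eta> = 0")
  case True
  have "set_integrable lborel {0..1::real} (\<lambda>s. u x)" by (rule borel_integrable_atLeastAtMost') simp
  then show ?thesis using True by simp
next
  case False
  have "integrable lborel (\<lambda>y. indicator {x..x+\<eta>} y *\<^sub>R u y)"
    using assms by (auto simp: loc_int_def set_integrable_def)
  from lborel_integrable_real_affine[OF this False, of x]
  have "integrable lborel (\<lambda>s. indicator {x..x+\<eta>} (x + \<eta> * s) *\<^sub>R u (x + \<eta> * s))" .
  moreover have "indicator {x..x+\<eta>} (x + \<eta> * s) = (indicator {0..1} s :: real)" for s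
    using assms False by (auto simp: indicator_def zero_le_mult_iff mult_le_cancel_left1)
  ultimately show ?thesis by (simp add: set_integrable_def)
qed

lemma steklov_0: "steklov 0 u = u"
  by (rule ext) (simp add: steklov_def set_lebesgue_integral_def)

lemma steklov_eq_integral:
  assumes "loc_int u" "0 < \<eta>"
  shows "steklov \<eta> u x = integral {x..x+\<eta>} u / \<eta>"
proof -
  have i: "set_integrable lborel {x..x+\<eta>} u" using assms by (auto simp: loc_int_def)
  have "integral {x..x+\<eta>} u = (LINT y:{x..x+\<eta>}|lborel. u y)"
    by (rule set_borel_integral_eq_integral(2)[OF i, symmetric])
  also have "\<dots> = \<bar>\<eta>\<bar> *\<^sub>R (\<integral>s. indicator {x..x+\<eta>} (x + \<eta> * s) *\<^sub>R u (x + \<eta> * s) \<partial>lborel)"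
    unfolding set_lebesgue_integral_def using assms by (intro lborel_integral_real_affine) simp
  also have "(\<lambda>s. indicator {x..x+\<eta>} (x + \<eta> * s)) = (indicator {0..1} :: real \<Rightarrow> real)"
    using assms by (auto simp: indicator_def zero_le_mult_iff mult_le_cancel_left1)
  finally show ?thesis using assms by (simp add: steklov_def set_lebesgue_integral_def fun_eq_iff)
qed

lemma steklov_diff_integral:
  assumes "loc_int u" "0 < \<eta>" "A \<le> x"
  shows "steklov \<eta> u x = (integral {A..x+\<eta>} u - integral {A..x} u) / \<eta>"
proof -
  have "u integrable_on {A..x+\<eta>}"
    using assms by (intro set_borel_integral_eq_integral(1)) (auto simp: loc_int_def)
  then have "integral {A..x} u + integral {x..x+\<eta>} u = integral {A..x+\<eta>} u"
    using assms by (intro Henstock_Kurzweil_Integration.integral_combine) auto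
  then show ?thesis by (simp add: steklov_eq_integral[OF assms(1,2)] field_simps)
qed

lemma steklov_isCont:
  assumes "loc_int u" "0 < \<eta>"
  shows "isCont (steklov \<eta> u) x"
proof -
  define A B where "A = x - 1" and "B = x + \<eta> + 1"
  have "u integrable_on {A..B}"
    using assms by (intro set_borel_integral_eq_integral(1)) (auto simp: loc_int_def)
  then have c: "continuous_on {A..B} (\<lambda>x. integral {A..x} u)"
    by (rule indefinite_integral_continuous_1)
  have "continuous_on {A..x+1} (\<lambda>y. (integral {A..y+\<eta>} u - integral {A..y} u) / \<eta>)"
    by (intro continuous_intros continuous_on_compose2[OF c] continuous_on_subset[OF c])
       (use assms in \<open>auto simp: A_def B_def intro!: continuous_intros\<close>)
  then have "continuous_on {A..x+1} (steklov \<eta> u)"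
    by (rule continuous_on_eq) (simp add: steklov_diff_integral[OF assms, of A])
  then show ?thesis
    by (rule continuous_on_interior) (simp add: A_def)
qed

lemma steklov_has_derivative:
  assumes u: "\<And>x. isCont u x" and \<eta>: "0 < \<eta>"
  shows "(steklov \<eta> u has_real_derivative (u (x + \<eta>) - u x) / \<eta>) (at x)"
proof -
  define A B where "A = x - 1" and "B = x + \<eta> + 1"
  have c: "continuous_on {A..B} u" using u by (simp add: continuous_at_imp_continuous_on)
  have d: "((\<lambda>x. integral {A..x} u) has_real_derivative u y) (at y)" if "A < y" "y < B" for y
  proof -
    have "((\<lambda>x. integral {A..x} u) has_real_derivative u y) (at y within {A..B})"
      using that by (intro integral_has_real_derivative[OF c]) auto
    moreover have "at y within {A..B} = at y" using that by (intro at_within_interior) simp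
    ultimately show ?thesis by simp
  qed
  have "((\<lambda>y. (integral {A..y+\<eta>} u - integral {A..y} u) / \<eta>) has_real_derivative (u (x + \<eta>) - u x) / \<eta>) (at x)"
  proof (intro DERIV_cdivide DERIV_diff)
    show "((\<lambda>y. integral {A..y} u) has_real_derivative u x) (at x)"
      using \<eta> by (intro d) (auto simp: A_def B_def)
    have "((\<lambda>y. integral {A..y} u) has_real_derivative u (x + \<eta>)) (at (x + \<eta>))"
      using \<eta> by (intro d) (auto simp: A_def B_def)
    then show "((\<lambda>y. integral {A..y + \<eta>} u) has_real_derivative u (x + \<eta>)) (at x)"
      by (simp add: DERIV_shift)
  qed
  moreover have "\<forall>\<^sub>F y in nhds x. steklov \<eta> u y = (integral {A..y+\<eta>} u - integral {A..y} u) / \<eta>"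
  proof -
    have "\<forall>\<^sub>F y in nhds x. y \<in> {A<..}" by (rule eventually_nhds_in_open) (auto simp: A_def)
    then show ?thesis
      by eventually_elim (use steklov_diff_integral[OF loc_int_continuous[OF u] \<eta>] in auto)
  qed
  ultimately show ?thesis by (subst DERIV_cong_ev[OF refl _ refl])
qed

lemma loc_int_steklov:
  assumes "loc_int u" "0 \<le> \<eta>"
  shows "loc_int (steklov \<eta> u)"
  using assms by (cases "\<eta> = 0") (auto simp: steklov_0 intro!: loc_int_continuous steklov_isCont)

lemma loc_int_steklov_iter:
  assumes "loc_int u" "0 \<le> \<eta>"
  shows "loc_int ((steklov \<eta> ^^ r) u)"
  using assms by (induction r) (auto intro: loc_int_steklov)

lemma loc_int_shift_diff:
  assumes "loc_int u"
  shows "loc_int (\<lambda>x. u (x + c))" "loc_int (\<lambda>x. u (x + c) - u x)"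
proof -
  have [measurable]: "u \<in> borel_measurable borel" using assms by (simp add: loc_int_def)
  have 1: "set_integrable lborel {a..b} (\<lambda>x. u (x + c))" for a b
  proof -
    have "integrable lborel (\<lambda>y. indicator {a+c..b+c} y *\<^sub>R u y)"
      using assms by (auto simp: loc_int_def set_integrable_def)
    from lborel_integrable_real_affine[OF this, of 1 c]
    have "integrable lborel (\<lambda>y. indicator {a+c..b+c} (c + y) *\<^sub>R u (c + y))" by simp
    moreover have "indicator {a+c..b+c} (c + y) = (indicator {a..b} y :: real)" for y
      by (auto simp: indicator_def)
    ultimately show ?thesis by (simp add: set_integrable_def add.commute)
  qed
  then show "loc_int (\<lambda>x. u (x + c))" by (simp add: loc_int_def)
  show "loc_int (\<lambda>x. u (x + c) - u x)" using 1 assms by (auto simp: loc_int_def intro!: set_integral_diff)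
qed

lemma steklov_iter_shift_diff:
  assumes "loc_int u" "0 \<le> \<eta>"
  shows "(steklov \<eta> ^^ r) (\<lambda>x. u (x + c) - u x) = (\<lambda>y. (steklov \<eta> ^^ r) u (y + c) - (steklov \<eta> ^^ r) u y)"
proof (induction r)
  case (Suc r)
  have "steklov \<eta> (\<lambda>x. v (x + c) - v x) y = steklov \<eta> v (y + c) - steklov \<eta> v y" if v: "loc_int v" for v y
  proof -
    have "y + \<eta> * s + c = y + c + \<eta> * s" for s by simp
    then show ?thesis
      unfolding steklov_def using loc_int_affine[OF v assms(2)] by (simp only: set_integral_diff(2))
  qed
  from this[OF loc_int_steklov_iter[OF assms]] show ?case using Suc by auto
qed simp

lemma loc_int_nth_diff:
  assumes "loc_int u"
  shows "loc_int (nth_diff r h u)"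
proof (induction r)
  case 0
  have "nth_diff 0 h u = u" by (rule ext) (simp add: nth_diff_def)
  then show ?case using assms by simp
next
  case (Suc r)
  have "nth_diff (Suc r) h u = (\<lambda>y. nth_diff r h u (y + h) - nth_diff r h u y)"
    by (rule ext) (rule nth_diff_Suc)
  then show ?case using loc_int_shift_diff(2)[OF Suc] by simp
qed

text \<open>The derivative of a mean is a difference quotient of the function averaged, so every
  derivative trades one of the \<open>k + 1\<close> means for one difference. For
  \<open>r < k\<close> a further mean is left inside and supplies the continuity.\<close>

lemma steklov_iter_has_derivative:
  assumes u: "loc_int u" and \<eta>: "0 < \<eta>" and r: "r < k"
  shows "((\<lambda>x. (steklov \<eta> ^^ (Suc k - r)) (nth_diff r \<eta> u) x / \<eta> ^ r) has_real_derivative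
           (steklov \<eta> ^^ (Suc k - Suc r)) (nth_diff (Suc r) \<eta> u) x / \<eta> ^ Suc r) (at x)"
proof -
  let ?\<psi> = "nth_diff r \<eta> u"
  let ?\<chi> = "(steklov \<eta> ^^ (k - r)) ?\<psi>"
  obtain n where n: "k - r = Suc n" using r by (metis Suc_diff_Suc)
  have \<psi>: "loc_int ?\<psi>" using u by (rule loc_int_nth_diff)
  have c: "isCont ?\<chi> y" for y
    unfolding n using loc_int_steklov_iter[OF \<psi>, of \<eta> n] \<eta> by (simp add: steklov_isCont)
  have e1: "nth_diff (Suc r) \<eta> u = (\<lambda>y. ?\<psi> (y + \<eta>) - ?\<psi> y)" by (rule ext) (rule nth_diff_Suc)
  have e2: "(steklov \<eta> ^^ (Suc k - Suc r)) (nth_diff (Suc r) \<eta> u) x = ?\<chi> (x + \<eta>) - ?\<chi> x"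
    unfolding e1 using steklov_iter_shift_diff[OF \<psi>, of \<eta> "k - r" \<eta>] \<eta> by simp
  have e3: "(steklov \<eta> ^^ (Suc k - r)) ?\<psi> = steklov \<eta> ?\<chi>"
    using r by (simp add: Suc_diff_le)
  have "((\<lambda>x. steklov \<eta> ?\<chi> x / \<eta> ^ r) has_real_derivative ((?\<chi> (x + \<eta>) - ?\<chi> x) / \<eta>) / \<eta> ^ r) (at x)"
    by (intro DERIV_cdivide steklov_has_derivative c \<eta>)
  then show ?thesis unfolding e2 e3 by simp
qed

text \<open>Averaging the \<open>k\<close>-th difference over the steps
  \<open>h + \<delta> * s\<close> replaces \<open>u (x + i * h)\<close> by its mean of length
  \<open>i * \<delta>\<close>; hence a scale that depends on \<open>i\<close>. Fubini preserves the
  bound \<open>W\<close>, and each of the \<open>r\<close> rounds uses up \<delta> of the admissible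
  range of \<open>h\<close>.\<close>

lemma steklov_diff_average:
  fixes u :: "real \<Rightarrow> real" and W :: real
  assumes u: "loc_int u" and \<delta>: "0 \<le> \<delta>"
    and hyp: "\<And>h. 0 \<le> h \<Longrightarrow> h \<le> real n * \<delta> \<Longrightarrow> (\<integral>\<^sup>+x\<in>{a..b}. ennreal \<bar>nth_diff k h u x\<bar> \<partial>lborel) \<le> ennreal W"
    and r: "r \<le> n" and h: "0 \<le> h" "h \<le> real (n - r) * \<delta>"
  shows "(\<integral>\<^sup>+x\<in>{a..b}. ennreal \<bar>\<Sum>i\<le>k. (-1) ^ (k + i) * of_nat (k choose i) * (steklov (real i * \<delta>) ^^ r) u (x + real i * h)\<bar> \<partial>lborel) \<le> ennreal W"
  using r h
proof (induction r arbitrary: h)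
  case 0
  then show ?case using hyp[of h] by (simp add: nth_diff_def)
next
  case (Suc r)
  let ?c = "\<lambda>i. (-1) ^ (k + i) * real (k choose i)"
  let ?V = "\<lambda>i. (steklov (real i * \<delta>) ^^ r) u"
  define G where "G x h = (\<Sum>i\<le>k. ?c i * ?V i (x + real i * h))" for x h
  have V: "loc_int (?V i)" for i using u \<delta> by (intro loc_int_steklov_iter) auto
  have [measurable]: "?V i \<in> borel_measurable borel" for i using V by (rule loc_int_measurable)
  have int: "integrable lborel (\<lambda>s. indicator {0..1} s *\<^sub>R ?V i (x + real i * h + real i * \<delta> * s))" for i x
    using loc_int_affine[OF V, of "real i * \<delta>" i "x + real i * h"] \<delta> by (simp add: set_integrable_def)
  have G: "indicator {0..1} s *\<^sub>R G x (h + \<delta> * s) = (\<Sum>i\<le>k. ?c i * (indicator {0..1} s *\<^sub>R ?V i (x + real i * h + real i * \<delta> * s)))" for x s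
    by (simp add: G_def sum_distrib_left algebra_simps)
  have intG: "integrable lborel (\<lambda>s. indicator {0..1} s *\<^sub>R G x (h + \<delta> * s))" for x
    unfolding G by (intro Bochner_Integration.integrable_sum integrable_mult_right int)
  have "(\<Sum>i\<le>k. ?c i * (steklov (real i * \<delta>) ^^ Suc r) u (x + real i * h)) = (\<integral>s. indicator {0..1} s *\<^sub>R G x (h + \<delta> * s) \<partial>lborel)" for x
    unfolding G by (subst Bochner_Integration.integral_sum)
      (auto intro!: integrable_mult_right int[simplified] simp: steklov_def set_lebesgue_integral_def)
  then have "(\<integral>\<^sup>+x\<in>{a..b}. ennreal \<bar>\<Sum>i\<le>k. ?c i * (steklov (real i * \<delta>) ^^ Suc r) u (x + real i * h)\<bar> \<partial>lborel)
     \<le> (\<integral>\<^sup>+x. (\<integral>\<^sup>+s. ennreal (norm (indicator {0..1} s *\<^sub>R G x (h + \<delta> * s))) \<partial>lborel) * indicator {a..b} x \<partial>lborel)"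
    using integral_norm_bound_ennreal[OF intG] by (intro nn_integral_mono mult_right_mono) auto
  also have "\<dots> = (\<integral>\<^sup>+x. (\<integral>\<^sup>+s. ennreal (norm (indicator {0..1} s *\<^sub>R G x (h + \<delta> * s))) * indicator {a..b} x \<partial>lborel) \<partial>lborel)"
    unfolding G_def by (subst nn_integral_multc) auto
  also have "\<dots> = (\<integral>\<^sup>+s. (\<integral>\<^sup>+x. ennreal (norm (indicator {0..1} s *\<^sub>R G x (h + \<delta> * s))) * indicator {a..b} x \<partial>lborel) \<partial>lborel)"
    unfolding G_def by (subst lborel_pair.Fubini') auto
  also have "\<dots> \<le> (\<integral>\<^sup>+(s::real). ennreal W * indicator {0..1} s \<partial>lborel)"
  proof (rule nn_integral_mono)
    fix s :: real
    show "(\<integral>\<^sup>+x. ennreal (norm (indicator {0..1} s *\<^sub>R G x (h + \<delta> * s))) * indicator {a..b} x \<partial>lborel) \<le> ennreal W * indicator {0..1} s"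
    proof (cases "s \<in> {0..1}")
      case True
      have "\<delta> * s \<le> \<delta>" using True \<delta> mult_left_le[of s \<delta>] by auto
      moreover have "real (n - r) * \<delta> = real (n - Suc r) * \<delta> + \<delta>"
        using Suc.prems(1) by (simp add: of_nat_diff algebra_simps)
      ultimately have "(\<integral>\<^sup>+x\<in>{a..b}. ennreal \<bar>G x (h + \<delta> * s)\<bar> \<partial>lborel) \<le> ennreal W"
        unfolding G_def using Suc.prems True \<delta> by (intro Suc.IH) auto
      then show ?thesis using True by simp
    qed simp
  qed
  also have "\<dots> = ennreal W" by (simp add: nn_integral_cmult_indicator)
  finally show ?case .
qed

text \<open>The averages of \<open>(-1)^(i + 1) * (k choose i) * u (x + i * h)\<close>, summed over \<open>1 \<le> i \<le> k\<close>, form a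
  function \<open>g\<close>: the difference \<open>u - g\<close> is an average of \<open>k\<close>-th differences of \<open>u\<close>, and so is the \<open>k\<close>-th
  derivative of \<open>g\<close>, whence the Taylor polynomial of \<open>g\<close> approximates \<open>u\<close>.  One Steklov mean more than
  \<open>k\<close> is taken because the mean of a function that is merely integrable need not be differentiable.
  All steps are nonnegative, so the approximation holds on the part of the interval that leaves room
  to the right.\<close>

lemma local_polynomial_approx_real:
  fixes u :: "real \<Rightarrow> real" and W :: real
  assumes u: "loc_int u" and \<delta>: "0 < \<delta>" and k: "1 \<le> k" and ab: "a < b" and W: "0 \<le> W"
    and hyp: "\<And>h. 0 \<le> h \<Longrightarrow> real k * h \<le> B - a \<Longrightarrow>
        (\<integral>\<^sup>+x\<in>{a..B - real k * h}. ennreal \<bar>nth_diff k h u x\<bar> \<partial>lborel) \<le> ennreal W"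
    and B: "b + real k * real (k + 1) * \<delta> \<le> B"
  shows "\<exists>c :: nat \<Rightarrow> real. (\<integral>\<^sup>+x\<in>{a..b}. ennreal \<bar>u x - (\<Sum>m<k. c m * (x - a) ^ m)\<bar> \<partial>lborel)
           \<le> ennreal ((1 + 2 ^ k * ((b - a) / \<delta>) ^ Suc k) * W)"
proof -
  define g :: "real \<Rightarrow> real" where
    "g x = (\<Sum>i=1..k. - ((-1) ^ i * of_nat (k choose i)) * (steklov (real i * \<delta>) ^^ Suc k) u x)" for x
  \<comment> \<open>\<open>D r\<close> is the \<open>r\<close>-th derivative of \<open>g\<close>: in
    the part of scale \<open>i * \<delta>\<close>, \<open>r\<close> of the \<open>k + 1\<close>
    means have become differences.\<close>
  define D where "D r x = (\<Sum>i=1..k. - ((-1) ^ i * real (k choose i)) *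
      ((steklov (real i * \<delta>) ^^ (Suc k - r)) (nth_diff r (real i * \<delta>) u) x / (real i * \<delta>) ^ r))" for r x
  have [measurable]: "u \<in> borel_measurable borel" using u by (rule loc_int_measurable)
  have [measurable]: "(steklov (real i * \<delta>) ^^ Suc k) u \<in> borel_measurable borel" for i
    using u \<delta> by (intro loc_int_measurable loc_int_steklov_iter) auto
  have [measurable]: "g \<in> borel_measurable borel" unfolding g_def by measurable
  have nd0: "nth_diff 0 h u = u" for h by (rule ext) (simp add: nth_diff_def)
  have D0: "D 0 = g" by (rule ext) (simp add: D_def g_def nd0)
  have Dd: "(D r has_real_derivative D (Suc r) x) (at x)" if "r < k" for r x
    unfolding D_def
    by (intro DERIV_sum DERIV_cmult steklov_iter_has_derivative u that) (use \<delta> in auto)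
  have kB: "real k * (real (Suc k) * \<delta>) \<le> B - b" using B by (simp add: algebra_simps)
  have ug: "(\<integral>\<^sup>+x\<in>{a..b}. ennreal \<bar>u x - g x\<bar> \<partial>lborel) \<le> ennreal W"
  proof -
    have "(\<integral>\<^sup>+x\<in>{a..b}. ennreal \<bar>\<Sum>i\<le>k. (-1) ^ (k + i) * of_nat (k choose i) * (steklov (real i * \<delta>) ^^ Suc k) u (x + real i * 0)\<bar> \<partial>lborel) \<le> ennreal W"
    proof (rule steklov_diff_average[OF u, where n = "Suc k"])
      fix h assume h: "0 \<le> h" "h \<le> real (Suc k) * \<delta>"
      then have 1: "real k * h \<le> B - b" using kB mult_left_mono[of h "real (Suc k) * \<delta>" "real k"] by linarith
      have "(\<integral>\<^sup>+x\<in>{a..b}. ennreal \<bar>nth_diff k h u x\<bar> \<partial>lborel) \<le> (\<integral>\<^sup>+x\<in>{a..B - real k * h}. ennreal \<bar>nth_diff k h u x\<bar> \<partial>lborel)"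
        using 1 by (intro nn_integral_mono mult_left_mono) (auto simp: indicator_def)
      also have "\<dots> \<le> ennreal W" using h 1 ab by (intro hyp) auto
      finally show "(\<integral>\<^sup>+x\<in>{a..b}. ennreal \<bar>nth_diff k h u x\<bar> \<partial>lborel) \<le> ennreal W" .
    qed (use \<delta> in auto)
    moreover have "\<bar>\<Sum>i\<le>k. (-1) ^ (k + i) * of_nat (k choose i) * (steklov (real i * \<delta>) ^^ Suc k) u (x + real i * 0)\<bar> = \<bar>u x - g x\<bar>" for x
    proof -
      \<comment> \<open>The term \<open>i = 0\<close> has scale zero and is \<open>u\<close> itself;
        the others sum to \<open>- g\<close> once the common factor \<open>(-1) ^ k\<close> is taken
        out.\<close>
      have s0: "(steklov 0 ^^ r) u = u" for r by (induction r) (simp_all add: steklov_0)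
      have "(\<Sum>i\<le>k. (-1) ^ (k + i) * of_nat (k choose i) * (steklov (real i * \<delta>) ^^ Suc k) u (x + real i * 0))
        = (-1) ^ k * (\<Sum>i\<le>k. (-1) ^ i * of_nat (k choose i) * (steklov (real i * \<delta>) ^^ Suc k) u x)"
        by (simp add: sum_distrib_left power_add mult.assoc)
      also have "(\<Sum>i\<le>k. (-1) ^ i * of_nat (k choose i) * (steklov (real i * \<delta>) ^^ Suc k) u x) = u x - g x"
      proof -
        have "{..k} = insert 0 {1..k}" by auto
        then show ?thesis using s0[of "Suc k"] by (simp add: g_def sum_negf del: funpow.simps)
      qed
      finally show ?thesis by (simp add: abs_mult power_abs del: funpow.simps)
    qed
    ultimately show ?thesis by (simp del: funpow.simps)
  qed
  have Dk: "\<bar>D k x\<bar> \<le> 2 ^ k * (W / \<delta> ^ Suc k)" if x: "x \<in> {a..b}" for x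
  proof -
    have "\<bar>(steklov (real i * \<delta>) ^^ (Suc k - k)) (nth_diff k (real i * \<delta>) u) x / (real i * \<delta>) ^ k\<bar> \<le> W / \<delta> ^ Suc k"
      if i: "i \<in> {1..k}" for i
    proof -
      let ?\<eta> = "real i * \<delta>"
      have \<eta>: "\<delta> \<le> ?\<eta>" "0 < ?\<eta>" using i \<delta> by auto
      have ik: "?\<eta> \<le> real k * \<delta>" using i \<delta> by simp
      have "real k * ?\<eta> + ?\<eta> \<le> real k * (real k * \<delta>) + real k * \<delta>" using ik by (intro add_mono mult_left_mono) auto
      \<comment> \<open>Differences of step \<open>i * \<delta>\<close> at points up to
        \<open>b + i * \<delta>\<close> reach as far as \<open>b + (k + 1) * i * \<delta>\<close>.
        With \<open>i \<le> k\<close> this explains the margin \<open>k * (k + 1) * \<delta>\<close>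
        of \<open>B\<close>.\<close>
      then have B': "b + ?\<eta> \<le> B - real k * ?\<eta>" using kB by (simp add: algebra_simps)
      have L: "loc_int (nth_diff k ?\<eta> u)" using u by (rule loc_int_nth_diff)
      then have [measurable]: "nth_diff k ?\<eta> u \<in> borel_measurable borel" by (rule loc_int_measurable)
      have si: "set_integrable lborel {x..x+?\<eta>} (nth_diff k ?\<eta> u)" using L by (simp add: loc_int_def)
      have "ennreal (norm (LINT y:{x..x+?\<eta>}|lborel. nth_diff k ?\<eta> u y)) \<le> (\<integral>\<^sup>+y. ennreal (norm (indicator {x..x+?\<eta>} y *\<^sub>R nth_diff k ?\<eta> u y)) \<partial>lborel)"
        unfolding set_lebesgue_integral_def using si by (intro integral_norm_bound_ennreal) (simp add: set_integrable_def)
      also have "\<dots> \<le> (\<integral>\<^sup>+y\<in>{a..B - real k * ?\<eta>}. ennreal \<bar>nth_diff k ?\<eta> u y\<bar> \<partial>lborel)"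
        using x B' by (intro nn_integral_mono) (auto simp: indicator_def)
      also have "\<dots> \<le> ennreal W" using \<eta> B' ab by (intro hyp) auto
      finally have "\<bar>LINT y:{x..x+?\<eta>}|lborel. nth_diff k ?\<eta> u y\<bar> \<le> W" using W by simp
      then have "\<bar>integral {x..x+?\<eta>} (nth_diff k ?\<eta> u)\<bar> \<le> W" by (simp add: set_borel_integral_eq_integral(2)[OF si])
      moreover have "(steklov ?\<eta> ^^ (Suc k - k)) (nth_diff k ?\<eta> u) x / ?\<eta> ^ k = integral {x..x+?\<eta>} (nth_diff k ?\<eta> u) / ?\<eta> ^ Suc k"
        using steklov_eq_integral[OF L \<eta>(2), of x] by (simp add: Suc_diff_le)
      moreover have "\<bar>integral {x..x+?\<eta>} (nth_diff k ?\<eta> u)\<bar> / ?\<eta> ^ Suc k \<le> W / \<delta> ^ Suc k"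
        using calculation(1) W \<eta> \<delta> by (intro frac_le power_mono zero_less_power) auto
      moreover have "\<bar>?\<eta> ^ Suc k\<bar> = ?\<eta> ^ Suc k" using \<eta> by (intro abs_of_pos zero_less_power)
      ultimately show ?thesis by (simp only: abs_divide)
    qed
    note * = this
    have "\<bar>D k x\<bar> \<le> (\<Sum>i=1..k. real (k choose i) * (W / \<delta> ^ Suc k))"
      unfolding D_def
    proof (intro order_trans[OF sum_abs] sum_mono)
      fix i assume i: "i \<in> {1..k}"
      have "\<bar>- ((-1) ^ i * real (k choose i)) * X\<bar> = real (k choose i) * \<bar>X\<bar>" for X
        by (simp add: abs_mult)
      then show "\<bar>- ((-1) ^ i * real (k choose i)) * ((steklov (real i * \<delta>) ^^ (Suc k - k)) (nth_diff k (real i * \<delta>) u) x / (real i * \<delta>) ^ k)\<bar>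
          \<le> real (k choose i) * (W / \<delta> ^ Suc k)"
        using *[OF i] by (simp only: mult_left_mono of_nat_0_le_iff)
    qed
    also have "\<dots> \<le> (\<Sum>i\<le>k. real (k choose i) * (W / \<delta> ^ Suc k))"
      using W \<delta> by (intro sum_mono2) auto
    also have "\<dots> = 2 ^ k * (W / \<delta> ^ Suc k)"
    proof -
      have "(\<Sum>i\<le>k. real (k choose i)) = real (\<Sum>i\<le>k. k choose i)" by simp
      also have "\<dots> = 2 ^ k" by (simp only: choose_row_sum) simp
      finally show ?thesis by (simp only: sum_distrib_right[symmetric])
    qed
    finally show ?thesis .
  qed
  define c where "c m = D m a / fact m" for m
  define E where "E = (b - a) ^ k * (2 ^ k * (W / \<delta> ^ Suc k))"
  have E0: "0 \<le> E" unfolding E_def using W \<delta> ab by simp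
  have gP: "\<bar>g x - (\<Sum>m<k. c m * (x - a) ^ m)\<bar> \<le> E" if x: "x \<in> {a..b}" for x
  proof (cases "x = a")
    case True
    obtain n where "k = Suc n" using k by (cases k) auto
    then have "(\<Sum>m<k. c m * 0 ^ m) = c 0" by (simp add: sum.lessThan_Suc_shift del: sum.lessThan_Suc)
    then show ?thesis using True E0 by (simp add: c_def D0)
  next
    case False
    then have "\<exists>t. a < t \<and> t < x \<and> g x = (\<Sum>m<k. (D m a / fact m) * (x - a) ^ m) + (D k t / fact k) * (x - a) ^ k"
      using x k Dd D0 by (intro Taylor_up[where a = a and b = x]) auto
    then obtain t where t: "a < t" "t < x" "g x = (\<Sum>m<k. c m * (x - a) ^ m) + (D k t / fact k) * (x - a) ^ k"
      by (auto simp: c_def)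
    have "\<bar>(D k t / fact k) * (x - a) ^ k\<bar> = \<bar>D k t\<bar> / fact k * (x - a) ^ k" using x by (simp add: abs_mult)
    also have "\<dots> \<le> (2 ^ k * (W / \<delta> ^ Suc k)) * (b - a) ^ k"
    proof (intro mult_mono power_mono)
      have "\<bar>D k t\<bar> / fact k \<le> \<bar>D k t\<bar> / 1" by (intro divide_left_mono) auto
      then show "\<bar>D k t\<bar> / fact k \<le> 2 ^ k * (W / \<delta> ^ Suc k)" using Dk[of t] t x by auto
    qed (use x W \<delta> in auto)
    finally show ?thesis using t(3) by (simp add: E_def mult.commute)
  qed
  have "(\<integral>\<^sup>+x\<in>{a..b}. ennreal \<bar>u x - (\<Sum>m<k. c m * (x - a) ^ m)\<bar> \<partial>lborel)
     \<le> (\<integral>\<^sup>+x. (ennreal \<bar>u x - g x\<bar> * indicator {a..b} x + ennreal E * indicator {a..b} x) \<partial>lborel)"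
  proof (rule nn_integral_mono)
    fix x
    show "ennreal \<bar>u x - (\<Sum>m<k. c m * (x - a) ^ m)\<bar> * indicator {a..b} x
        \<le> ennreal \<bar>u x - g x\<bar> * indicator {a..b} x + ennreal E * indicator {a..b} x"
    proof (cases "x \<in> {a..b}")
      case True
      then have "\<bar>u x - (\<Sum>m<k. c m * (x - a) ^ m)\<bar> \<le> \<bar>u x - g x\<bar> + E" using gP[of x] by linarith
      then show ?thesis using True E0 by (simp add: ennreal_plus[symmetric] ennreal_leI del: ennreal_plus)
    qed simp
  qed
  also have "\<dots> = (\<integral>\<^sup>+x\<in>{a..b}. ennreal \<bar>u x - g x\<bar> \<partial>lborel) + ennreal E * ennreal (b - a)"
    using ab by (subst nn_integral_add) (auto simp: nn_integral_cmult_indicator)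
  also have "\<dots> \<le> ennreal W + ennreal E * ennreal (b - a)" using ug by (intro add_right_mono)
  also have "\<dots> = ennreal (W + E * (b - a))"
    using W E0 ab by (simp add: ennreal_mult[symmetric] ennreal_plus[symmetric] del: ennreal_plus)
  also have "W + E * (b - a) = (1 + 2 ^ k * ((b - a) / \<delta>) ^ Suc k) * W"
    by (simp add: E_def algebra_simps power_divide)
  finally show ?thesis by blast
qed

section \<open>Moduli of smoothness\<close>

lemma nth_diff_Re: "Re (nth_diff k h f x) = nth_diff k h (\<lambda>x. Re (f x)) x"
  and nth_diff_Im: "Im (nth_diff k h f x) = nth_diff k h (\<lambda>x. Im (f x)) x"
proof -
  have 1: "(-1) ^ n * of_nat m = complex_of_real ((-1) ^ n * real m)" for n m by simp
  have "Re (complex_of_real r * z) = r * Re z" "Im (complex_of_real r * z) = r * Im z" for r z by simp_all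
  then show "Re (nth_diff k h f x) = nth_diff k h (\<lambda>x. Re (f x)) x"
    "Im (nth_diff k h f x) = nth_diff k h (\<lambda>x. Im (f x)) x"
    unfolding nth_diff_def 1 Re_sum Im_sum by simp_all
qed

lemma local_polynomial_approx:
  fixes f :: "real \<Rightarrow> complex" and W :: real
  assumes f: "f \<in> borel_measurable borel" "\<And>a b. set_integrable lborel {a..b} f"
    and \<delta>: "0 < \<delta>" and k: "1 \<le> k" and ab: "a < b" and W: "0 \<le> W"
    and hyp: "\<And>h. 0 \<le> h \<Longrightarrow> real k * h \<le> B - a \<Longrightarrow>
        (\<integral>\<^sup>+x\<in>{a..B - real k * h}. ennreal (cmod (nth_diff k h f x)) \<partial>lborel) \<le> ennreal W"
    and B: "b + real k * real (k + 1) * \<delta> \<le> B"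
  shows "\<exists>P. degree P \<le> k - 1 \<and> (\<integral>\<^sup>+x\<in>{a..b}. ennreal (cmod (f x - poly P (of_real x))) \<partial>lborel)
           \<le> ennreal (2 * ((1 + 2 ^ k * ((b - a) / \<delta>) ^ Suc k) * W))"
proof -
  let ?K = "(1 + 2 ^ k * ((b - a) / \<delta>) ^ Suc k) * W"
  have [measurable]: "f \<in> borel_measurable borel" by (rule f)
  have li: "loc_int (\<lambda>x. Re (f x))" "loc_int (\<lambda>x. Im (f x))"
    unfolding loc_int_def using integrable_Re[OF f(2)[unfolded set_integrable_def]]
      integrable_Im[OF f(2)[unfolded set_integrable_def]]
    by (auto simp: set_integrable_def)
  have h1: "(\<integral>\<^sup>+x\<in>{a..B - real k * h}. ennreal \<bar>nth_diff k h (\<lambda>x. Re (f x)) x\<bar> \<partial>lborel) \<le> ennreal W"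
    and h2: "(\<integral>\<^sup>+x\<in>{a..B - real k * h}. ennreal \<bar>nth_diff k h (\<lambda>x. Im (f x)) x\<bar> \<partial>lborel) \<le> ennreal W"
    if "0 \<le> h" "real k * h \<le> B - a" for h
  proof -
    show "(\<integral>\<^sup>+x\<in>{a..B - real k * h}. ennreal \<bar>nth_diff k h (\<lambda>x. Re (f x)) x\<bar> \<partial>lborel) \<le> ennreal W"
      by (rule order_trans[OF nn_integral_mono hyp[OF that]])
        (auto intro!: mult_right_mono ennreal_leI simp: abs_Re_le_cmod simp flip: nth_diff_Re)
    show "(\<integral>\<^sup>+x\<in>{a..B - real k * h}. ennreal \<bar>nth_diff k h (\<lambda>x. Im (f x)) x\<bar> \<partial>lborel) \<le> ennreal W"
      by (rule order_trans[OF nn_integral_mono hyp[OF that]])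
        (auto intro!: mult_right_mono ennreal_leI simp: abs_Im_le_cmod simp flip: nth_diff_Im)
  qed
  obtain c where c: "(\<integral>\<^sup>+x\<in>{a..b}. ennreal \<bar>Re (f x) - (\<Sum>m<k. c m * (x - a) ^ m)\<bar> \<partial>lborel) \<le> ennreal ?K"
    using local_polynomial_approx_real[OF li(1) \<delta> k ab W h1 B] by blast
  obtain c' where c': "(\<integral>\<^sup>+x\<in>{a..b}. ennreal \<bar>Im (f x) - (\<Sum>m<k. c' m * (x - a) ^ m)\<bar> \<partial>lborel) \<le> ennreal ?K"
    using local_polynomial_approx_real[OF li(2) \<delta> k ab W h2 B] by blast
  define P where "P = (\<Sum>m<k. smult (Complex (c m) (c' m)) ([:- complex_of_real a, 1:] ^ m))"
  have "degree P \<le> k - 1" unfolding P_def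
  proof (rule degree_sum_le)
    fix m assume m: "m \<in> {..<k}"
    have "degree ([:- complex_of_real a, 1:] ^ m) \<le> degree [:- complex_of_real a, 1:] * m" by (rule degree_power_le)
    also have "\<dots> \<le> k - 1" using m by auto
    finally show "degree (smult (Complex (c m) (c' m)) ([:- complex_of_real a, 1:] ^ m)) \<le> k - 1"
      using degree_smult_le order_trans by blast
  qed simp
  moreover have "(\<integral>\<^sup>+x\<in>{a..b}. ennreal (cmod (f x - poly P (of_real x))) \<partial>lborel) \<le> ennreal (2 * ?K)"
  proof -
    have Pv: "poly P (of_real x) = (\<Sum>m<k. Complex (c m) (c' m) * of_real ((x - a) ^ m))" for x
      by (simp add: P_def poly_sum)
    have R: "Re (f x - poly P (of_real x)) = Re (f x) - (\<Sum>m<k. c m * (x - a) ^ m)"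
      and I: "Im (f x - poly P (of_real x)) = Im (f x) - (\<Sum>m<k. c' m * (x - a) ^ m)" for x
      unfolding Pv by (simp_all del: of_real_power)
    have "(\<integral>\<^sup>+x\<in>{a..b}. ennreal (cmod (f x - poly P (of_real x))) \<partial>lborel)
      \<le> (\<integral>\<^sup>+x. (ennreal \<bar>Re (f x) - (\<Sum>m<k. c m * (x - a) ^ m)\<bar> * indicator {a..b} x
           + ennreal \<bar>Im (f x) - (\<Sum>m<k. c' m * (x - a) ^ m)\<bar> * indicator {a..b} x) \<partial>lborel)"
      using cmod_le[of "f x - poly P (of_real x)" for x] unfolding R I
      by (intro nn_integral_mono)
        (auto simp: indicator_def ennreal_plus[symmetric] simp del: ennreal_plus intro!: ennreal_leI)
    also have "\<dots> = (\<integral>\<^sup>+x\<in>{a..b}. ennreal \<bar>Re (f x) - (\<Sum>m<k. c m * (x - a) ^ m)\<bar> \<partial>lborel)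
       + (\<integral>\<^sup>+x\<in>{a..b}. ennreal \<bar>Im (f x) - (\<Sum>m<k. c' m * (x - a) ^ m)\<bar> \<partial>lborel)"
      by (rule nn_integral_add) measurable
    also have "\<dots> \<le> ennreal ?K + ennreal ?K" using c c' by (rule add_mono)
    also have "\<dots> = ennreal (2 * ?K)"
      using W ab \<delta> by (simp add: ennreal_plus[symmetric] del: ennreal_plus)
    finally show ?thesis .
  qed
  ultimately show ?thesis by blast
qed

lemma Delta_eq:
  "Delta k h f {A..B} y = (if y \<in> {A..B} \<and> y + real k * h \<in> {A..B} then nth_diff k h f y else 0)"
proof -
  have "closed_segment y (y + real k * h) \<subseteq> {A..B} \<longleftrightarrow> y \<in> {A..B} \<and> y + real k * h \<in> {A..B}"
    by (meson closed_segment_subset convex_real_interval(5) ends_in_segment subsetD)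
  then show ?thesis by (simp add: Delta_def nth_diff_def)
qed

lemma nth_diff_measurable [measurable]:
  fixes f :: "real \<Rightarrow> complex"
  assumes [measurable]: "f \<in> borel_measurable borel"
  shows "nth_diff k h f \<in> borel_measurable borel"
  unfolding nth_diff_def by measurable

text \<open>Every summand is at most the largest one, which treats exponents below and above
  \<open>1\<close> alike.\<close>

lemma sum_powr_le:
  fixes v :: "'i \<Rightarrow> real"
  assumes "finite S" "\<And>i. i \<in> S \<Longrightarrow> 0 \<le> v i" "0 < q"
  shows "(\<Sum>i\<in>S. v i) powr q \<le> real (card S) powr q * (\<Sum>i\<in>S. v i powr q)"
proof (cases "S = {}")
  case False
  obtain m where m: "m \<in> S" "\<And>i. i \<in> S \<Longrightarrow> v i \<le> v m"
  proof -
    have "Max (v ` S) \<in> v ` S" using assms(1) False by (intro Max_in) auto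
    then obtain m where "m \<in> S" "Max (v ` S) = v m" by blast
    moreover have "v i \<le> Max (v ` S)" if "i \<in> S" for i using assms(1) that by simp
    ultimately show ?thesis by (auto intro: that)
  qed
  have "(\<Sum>i\<in>S. v i) \<le> real (card S) * v m" using m(2) by (intro sum_bounded_above) auto
  then have "(\<Sum>i\<in>S. v i) powr q \<le> (real (card S) * v m) powr q"
    using assms by (intro powr_mono2) (auto intro: sum_nonneg)
  also have "\<dots> = real (card S) powr q * v m powr q" using assms m by (simp add: powr_mult)
  also have "\<dots> \<le> real (card S) powr q * (\<Sum>i\<in>S. v i powr q)"
    using assms m by (intro mult_left_mono member_le_sum[of m S "\<lambda>i. v i powr q"]) auto
  finally show ?thesis .
qed simp

section \<open>The modulus of smoothness of a Borel function on one interval\<close>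

context
  fixes f :: "real \<Rightarrow> complex" and q A B :: real and k :: nat
  assumes f [measurable]: "f \<in> borel_measurable borel" and q: "1 \<le> q" and AB: "A < B"
    and fq: "set_integrable lborel {A..B} (\<lambda>y. cmod (f y) powr q)"
begin

lemma Delta_measurable [measurable]: "Delta k h f {A..B} \<in> borel_measurable borel"
  unfolding Delta_eq[abs_def] by measurable

text \<open>A bound uniform in \<open>h\<close>: thanks to it the differences are integrable and the
  supremum in \<open>omega\<close> is over a bounded set, so that neither the Bochner integral nor
  the real supremum takes a default value.\<close>

lemma Delta_powr_bound:
  "(\<integral>\<^sup>+y\<in>{A..B}. ennreal (cmod (Delta k h f {A..B} y) powr q) \<partial>lborel)
     \<le> ennreal ((2 ^ k * real (Suc k)) powr q * real (Suc k) * (LINT y:{A..B}|lborel. cmod (f y) powr q))"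
proof -
  let ?\<Phi> = "LINT y:{A..B}|lborel. cmod (f y) powr q"
  have \<Phi>: "(\<integral>\<^sup>+y. ennreal (cmod (f y) powr q) * indicator {A..B} y \<partial>lborel) = ennreal ?\<Phi>"
    using nn_integral_eq_integral[OF fq[unfolded set_integrable_def]]
    by (simp add: set_lebesgue_integral_def indicator_mult_ennreal mult.commute)
  have pt: "ennreal (cmod (Delta k h f {A..B} y) powr q) * indicator {A..B} y
      \<le> (\<Sum>i\<le>k. ennreal ((2 ^ k * real (Suc k)) powr q) * (ennreal (cmod (f (y + real i * h)) powr q) * indicator {A..B} (y + real i * h)))" for y
  proof (cases "y \<in> {A..B} \<and> y + real k * h \<in> {A..B}")
    case True
    have seg: "y + real i * h \<in> {A..B}" if "i \<le> k" for i
    proof (cases "0 \<le> h")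
      case True
      have "real i * h \<le> real k * h" "0 \<le> real i * h" using that True by (auto intro: mult_right_mono)
      then show ?thesis using \<open>y \<in> {A..B} \<and> y + real k * h \<in> {A..B}\<close> by auto
    next
      case False
      then have "real k * h \<le> real i * h" "real i * h \<le> 0" using that by (auto intro: mult_right_mono_neg simp: mult_le_0_iff)
      then show ?thesis using \<open>y \<in> {A..B} \<and> y + real k * h \<in> {A..B}\<close> by auto
    qed
    have "cmod (nth_diff k h f y) \<le> (\<Sum>i\<le>k. 2 ^ k * cmod (f (y + real i * h)))"
      unfolding nth_diff_def
    proof (rule order_trans[OF norm_sum], rule sum_mono)
      fix i assume "i \<in> {..k}"
      have "k choose i \<le> 2 ^ k" by (rule binomial_le_pow2)
      then have "real (k choose i) \<le> 2 ^ k" by (metis numeral_power_eq_of_nat_cancel_iff of_nat_le_iff)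
      then show "cmod ((-1) ^ (k + i) * of_nat (k choose i) * f (y + real i * h)) \<le> 2 ^ k * cmod (f (y + real i * h))"
        by (simp add: norm_mult norm_power mult_right_mono)
    qed
    then have "cmod (nth_diff k h f y) powr q \<le> (\<Sum>i\<le>k. 2 ^ k * cmod (f (y + real i * h))) powr q"
      using q by (intro powr_mono2) auto
    also have "\<dots> \<le> real (card {..k}) powr q * (\<Sum>i\<le>k. (2 ^ k * cmod (f (y + real i * h))) powr q)"
      using q by (intro sum_powr_le) auto
    also have "\<dots> = (\<Sum>i\<le>k. (2 ^ k * real (Suc k)) powr q * cmod (f (y + real i * h)) powr q)"
      by (simp add: sum_distrib_left powr_mult mult.assoc mult.left_commute del: of_nat_Suc)
    finally have "cmod (nth_diff k h f y) powr q \<le> \<dots>" .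
    then show ?thesis using True seg
      by (simp add: Delta_eq ennreal_mult[symmetric] ennreal_leI)
  qed (use q in \<open>auto simp: Delta_eq\<close>)
  have "(\<integral>\<^sup>+y\<in>{A..B}. ennreal (cmod (Delta k h f {A..B} y) powr q) \<partial>lborel)
    \<le> (\<integral>\<^sup>+y. (\<Sum>i\<le>k. ennreal ((2 ^ k * real (Suc k)) powr q) * (ennreal (cmod (f (y + real i * h)) powr q) * indicator {A..B} (y + real i * h))) \<partial>lborel)"
    by (rule nn_integral_mono) (rule pt)
  also have "\<dots> = (\<Sum>i\<le>k. ennreal ((2 ^ k * real (Suc k)) powr q) * (\<integral>\<^sup>+y. ennreal (cmod (f (y + real i * h)) powr q) * indicator {A..B} (y + real i * h) \<partial>lborel))"
    by (subst nn_integral_sum) (auto intro!: sum.cong nn_integral_cmult)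
  also have "\<dots> = (\<Sum>i\<le>k. ennreal ((2 ^ k * real (Suc k)) powr q) * ennreal ?\<Phi>)"
  proof (rule sum.cong[OF refl])
    fix i
    show "ennreal ((2 ^ k * real (Suc k)) powr q) * (\<integral>\<^sup>+y. ennreal (cmod (f (y + real i * h)) powr q) * indicator {A..B} (y + real i * h) \<partial>lborel)
       = ennreal ((2 ^ k * real (Suc k)) powr q) * ennreal ?\<Phi>"
      unfolding \<Phi>[symmetric]
      by (subst (2) nn_integral_real_affine[where c = 1 and t = "real i * h"]) (auto simp: add.commute)
  qed
  also have "\<dots> = ennreal ((2 ^ k * real (Suc k)) powr q * real (Suc k) * ?\<Phi>)"
  proof -
    have "0 \<le> ?\<Phi>"
      unfolding set_lebesgue_integral_def by (intro Bochner_Integration.integral_nonneg) auto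
    then show ?thesis
      by (simp add: ennreal_mult[symmetric] ennreal_of_nat_eq_real_of_nat mult.commute mult.left_commute del: of_nat_Suc)
  qed
  finally show ?thesis .
qed

lemma Delta_powr_integral:
  "ennreal (LINT y:{A..B}|lebesgue. cmod (Delta k h f {A..B} y) powr q)
     = (\<integral>\<^sup>+y\<in>{A..B}. ennreal (cmod (Delta k h f {A..B} y) powr q) \<partial>lborel)"
proof -
  have "(LINT y:{A..B}|lebesgue. cmod (Delta k h f {A..B} y) powr q) = (LINT y:{A..B}|lborel. cmod (Delta k h f {A..B} y) powr q)"
    unfolding set_lebesgue_integral_def by (rule integral_completion) measurable
  moreover have "integrable lborel (\<lambda>y. indicator {A..B} y *\<^sub>R cmod (Delta k h f {A..B} y) powr q)"
  proof (rule integrableI_bounded)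
    have "(\<integral>\<^sup>+y. ennreal (norm (indicator {A..B} y *\<^sub>R cmod (Delta k h f {A..B} y) powr q)) \<partial>lborel)
      = (\<integral>\<^sup>+y\<in>{A..B}. ennreal (cmod (Delta k h f {A..B} y) powr q) \<partial>lborel)"
      by (intro nn_integral_cong) (auto simp: indicator_def)
    then show "(\<integral>\<^sup>+y. ennreal (norm (indicator {A..B} y *\<^sub>R cmod (Delta k h f {A..B} y) powr q)) \<partial>lborel) < \<infinity>"
      using Delta_powr_bound[of h] by (auto intro: le_less_trans)
  qed measurable
  from nn_integral_eq_integral[OF this]
  have "(\<integral>\<^sup>+y. ennreal (indicator {A..B} y *\<^sub>R cmod (Delta k h f {A..B} y) powr q) \<partial>lborel) = ennreal (LINT y:{A..B}|lborel. cmod (Delta k h f {A..B} y) powr q)"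
    by (simp add: set_lebesgue_integral_def)
  moreover have "(\<integral>\<^sup>+y. ennreal (indicator {A..B} y *\<^sub>R cmod (Delta k h f {A..B} y) powr q) \<partial>lborel)
      = (\<integral>\<^sup>+y\<in>{A..B}. ennreal (cmod (Delta k h f {A..B} y) powr q) \<partial>lborel)"
    by (intro nn_integral_cong) (auto simp: indicator_def)
  ultimately show ?thesis by simp
qed

lemma Lq_norm_Delta_le_omega: "Lq_norm q {A..B} (Delta k h f {A..B}) \<le> omega k q f {A..B}"
  unfolding omega_def
proof (rule cSUP_upper[OF UNIV_I], rule bdd_aboveI2)
  fix h
  let ?M = "(2 ^ k * real (Suc k)) powr q * real (Suc k) * (LINT y:{A..B}|lborel. cmod (f y) powr q)"
  have p: "0 \<le> (LINT y:{A..B}|lborel. cmod (f y) powr q)"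
    unfolding set_lebesgue_integral_def by (intro Bochner_Integration.integral_nonneg) auto
  have "(LINT y:{A..B}|lebesgue. cmod (Delta k h f {A..B} y) powr q) \<le> ?M"
  proof (subst ennreal_le_iff[symmetric])
    show "0 \<le> ?M" using p by simp
    show "ennreal (LINT y:{A..B}|lebesgue. cmod (Delta k h f {A..B} y) powr q) \<le> ennreal ?M"
      unfolding Delta_powr_integral by (rule Delta_powr_bound)
  qed
  moreover have "0 \<le> (LINT y:{A..B}|lebesgue. cmod (Delta k h f {A..B} y) powr q)"
    unfolding set_lebesgue_integral_def by (intro Bochner_Integration.integral_nonneg) auto
  ultimately show "Lq_norm q {A..B} (Delta k h f {A..B}) \<le> ?M powr (1 / q)"
    unfolding Lq_norm_def using q by (intro powr_mono2) auto
qed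

lemma omega_nonneg: "0 \<le> omega k q f {A..B}"
  using Lq_norm_Delta_le_omega[of 0] by (rule order_trans[rotated]) (simp add: Lq_norm_def)

text \<open>Hoelder's inequality, obtained by integrating
  \<open>v \<le> t powr (1 - q) * v powr q + t\<close> and then choosing \<open>t\<close>.\<close>

lemma nth_diff_L1_bound:
  assumes h: "0 \<le> h" "real k * h \<le> B - A"
  shows "(\<integral>\<^sup>+x\<in>{A..B - real k * h}. ennreal (cmod (nth_diff k h f x)) \<partial>lborel)
           \<le> ennreal (2 * (B - A) powr (1 - 1 / q) * omega k q f {A..B})"
proof -
  let ?D = "Delta k h f {A..B}" and ?\<Omega> = "omega k q f {A..B}"
  define I where "I = (LINT y:{A..B}|lebesgue. cmod (?D y) powr q)"
  have I0: "0 \<le> I" unfolding I_def set_lebesgue_integral_def by (intro Bochner_Integration.integral_nonneg) auto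
  have "I powr (1 / q) \<le> ?\<Omega>" using Lq_norm_Delta_le_omega[of h] by (simp add: Lq_norm_def I_def)
  then have "(I powr (1 / q)) powr q \<le> ?\<Omega> powr q" using q by (intro powr_mono2) auto
  then have I\<Omega>: "I \<le> ?\<Omega> powr q" using I0 q by (simp add: powr_powr)
  have step: "(\<integral>\<^sup>+x\<in>{A..B - real k * h}. ennreal (cmod (nth_diff k h f x)) \<partial>lborel) \<le> ennreal (t powr (1 - q) * I + t * (B - A))"
    if t: "0 < t" for t
  proof -
    have "(\<integral>\<^sup>+x\<in>{A..B - real k * h}. ennreal (cmod (nth_diff k h f x)) \<partial>lborel)
       \<le> (\<integral>\<^sup>+x. (ennreal (t powr (1 - q)) * (ennreal (cmod (?D x) powr q) * indicator {A..B} x) + ennreal t * indicator {A..B} x) \<partial>lborel)"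
    proof (rule nn_integral_mono)
      fix x
      show "ennreal (cmod (nth_diff k h f x)) * indicator {A..B - real k * h} x
        \<le> ennreal (t powr (1 - q)) * (ennreal (cmod (?D x) powr q) * indicator {A..B} x) + ennreal t * indicator {A..B} x"
      proof (cases "x \<in> {A..B - real k * h}")
        case True
        then have x: "x \<in> {A..B}" "?D x = nth_diff k h f x"
          using h by (auto simp: Delta_eq intro: order_trans)
        have "v \<le> t powr (1 - q) * v powr q + t" if v: "0 \<le> v" for v
        proof (cases "v \<le> t")
          case False
          then have "v = v powr (1 - q) * v powr q" using t by (simp add: powr_add[symmetric])
          also have "\<dots> \<le> t powr (1 - q) * v powr q" using False t q by (intro mult_right_mono powr_mono2') auto
          finally show ?thesis using t by linarith
        qed (use v in \<open>simp add: add_increasing\<close>)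
        then show ?thesis using True x t
          by (simp add: ennreal_mult[symmetric] ennreal_plus[symmetric] ennreal_leI del: ennreal_plus)
      qed simp
    qed
    also have "\<dots> = ennreal (t powr (1 - q)) * (\<integral>\<^sup>+x. ennreal (cmod (?D x) powr q) * indicator {A..B} x \<partial>lborel) + ennreal t * ennreal (B - A)"
      using AB by (subst nn_integral_add) (auto simp: nn_integral_cmult nn_integral_cmult_indicator)
    also have "\<dots> = ennreal (t powr (1 - q)) * ennreal I + ennreal t * ennreal (B - A)"
      using Delta_powr_integral[of h] by (simp add: I_def)
    also have "\<dots> = ennreal (t powr (1 - q) * I + t * (B - A))"
      using t AB I0 by (simp add: ennreal_mult[symmetric] ennreal_plus[symmetric] del: ennreal_plus)
    finally show ?thesis .
  qed
  show ?thesis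
  proof (cases "?\<Omega> = 0")
    case True
    then have "I = 0" using I\<Omega> I0 q by simp
    have "(\<integral>\<^sup>+x\<in>{A..B - real k * h}. ennreal (cmod (nth_diff k h f x)) \<partial>lborel) \<le> 0"
    proof (rule ennreal_le_epsilon)
      fix e :: real assume "0 < e"
      then show "(\<integral>\<^sup>+x\<in>{A..B - real k * h}. ennreal (cmod (nth_diff k h f x)) \<partial>lborel) \<le> 0 + ennreal e"
        using step[of "e / (B - A)"] AB \<open>I = 0\<close> by simp
    qed
    then show ?thesis using True by simp
  next
    case False
    then have \<Omega>: "0 < ?\<Omega>" using omega_nonneg by simp
    \<comment> \<open>Both terms now get the same bound, hence the factor \<open>2\<close>. For
      \<open>?\<Omega> = 0\<close> this choice would be zero, so that case lets \<open>t\<close>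
      tend to zero instead.\<close>
    define t where "t = ?\<Omega> * (B - A) powr (- 1 / q)"
    have t: "0 < t" using \<Omega> AB by (simp add: t_def)
    have "t powr (1 - q) * I \<le> t powr (1 - q) * ?\<Omega> powr q" using I\<Omega> by (intro mult_left_mono) auto
    also have "\<dots> = ?\<Omega> powr (1 - q) * ?\<Omega> powr q * (B - A) powr ((- 1 / q) * (1 - q))"
      unfolding t_def using \<Omega> AB by (simp add: powr_mult powr_powr)
    also have "\<dots> = ?\<Omega> * (B - A) powr (1 - 1 / q)"
    proof -
      have "(- 1 / q) * (1 - q) = 1 - 1 / q" using q by (simp add: field_simps)
      then show ?thesis using \<Omega> by (simp add: powr_add[symmetric])
    qed
    finally have 1: "t powr (1 - q) * I \<le> ?\<Omega> * (B - A) powr (1 - 1 / q)" .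
    have "t * (B - A) = ?\<Omega> * ((B - A) powr (- 1 / q) * (B - A) powr 1)" unfolding t_def using AB by simp
    also have "\<dots> = ?\<Omega> * (B - A) powr (1 - 1 / q)" by (simp only: powr_add[symmetric]) (simp add: add.commute)
    finally have "t powr (1 - q) * I + t * (B - A) \<le> 2 * (B - A) powr (1 - 1 / q) * ?\<Omega>" using 1 by simp
    then show ?thesis using step[OF t] by (meson ennreal_leI order_trans)
  qed
qed

end

section \<open>Reduction to Borel functions\<close>

lemma lebesgue_measurable_borel_version:
  fixes f :: "real \<Rightarrow> complex"
  assumes "f \<in> borel_measurable lebesgue"
  shows "\<exists>g. g \<in> borel_measurable borel \<and> (AE x in lborel. f x = g x)"
proof -
  have "(\<lambda>x. Re (f x)) \<in> borel_measurable lebesgue" "(\<lambda>x. Im (f x)) \<in> borel_measurable lebesgue"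
    using assms by (simp_all add: borel_measurable_complex_iff)
  note m = this
  from completion_ex_borel_measurable_real[OF m(1)]
  obtain r where r: "r \<in> borel_measurable lborel" "AE x in lborel. Re (f x) = r x" ..
  from completion_ex_borel_measurable_real[OF m(2)]
  obtain s where s: "s \<in> borel_measurable lborel" "AE x in lborel. Im (f x) = s x" ..
  have "(\<lambda>x. Complex (r x) (s x)) \<in> borel_measurable borel"
    using r(1) s(1) by (simp add: borel_measurable_complex_iff)
  moreover have "AE x in lborel. f x = Complex (r x) (s x)"
    using r(2) s(2) by eventually_elim (simp add: complex_eq_iff)
  ultimately show ?thesis by (intro exI conjI)
qed

lemma AE_lborel_translate:
  assumes "AE x in lborel. P (x::real)"
  shows "AE x in lborel. P (x + c)"
proof -
  obtain N where N: "{x \<in> space lborel. \<not> P x} \<subseteq> N" "emeasure lborel N = 0" "N \<in> sets lborel"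
    using assms by (rule AE_E)
  have [measurable]: "N \<in> sets borel" using N by simp
  have "AE x in lborel. x \<notin> N" using N by (intro AE_not_in) (simp add: null_sets_def)
  then have "AE x in lborel. c + 1 * x \<notin> N" by (intro AE_borel_affine) auto
  then show ?thesis by eventually_elim (use N(1) in \<open>auto simp: add.commute\<close>)
qed

text \<open>Fubini and substitution are applied to Borel functions, whereas \<open>f\<close> is only
  Lebesgue measurable. A Borel function equal to \<open>f\<close> almost everywhere has the same
  moduli: a difference involves finitely many translates, and translates of null sets are
  null.\<close>

lemma Lq_loc_borel_version:
  assumes f: "f \<in> Lq_loc q" and q: "1 \<le> q"
  obtains g where "g \<in> borel_measurable borel" "AE x in lborel. f x = g x"
    "\<And>a b. set_integrable lborel {a..b} (\<lambda>y. cmod (g y) powr q)"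
    "\<And>a b. set_integrable lborel {a..b} g"
    "\<And>k A B. omega k q f {A..B} = omega k q g {A..B}"
proof -
  have fm [measurable]: "f \<in> borel_measurable lebesgue" and fq: "\<And>a b. set_integrable lebesgue {a..b} (\<lambda>y. cmod (f y) powr q)"
    using f by (auto simp: Lq_loc_def)
  obtain g where gm [measurable]: "g \<in> borel_measurable borel" and fg: "AE x in lborel. f x = g x"
    using lebesgue_measurable_borel_version[OF fm] by auto
  have fg': "AE x in lebesgue. f x = g x" using fg by (rule AE_completion)
  have gm' [measurable]: "g \<in> borel_measurable lebesgue" using gm by (simp add: measurable_completion)
  have 1: "set_integrable lborel {a..b} (\<lambda>y. cmod (g y) powr q)" for a b
  proof -
    have "integrable lebesgue (\<lambda>y. indicator {a..b} y *\<^sub>R cmod (g y) powr q)"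
    proof (rule integrable_cong_AE_imp[OF fq[of a b, unfolded set_integrable_def]])
      show "AE y in lebesgue. indicator {a..b} y *\<^sub>R cmod (f y) powr q = indicator {a..b} y *\<^sub>R cmod (g y) powr q"
        using fg' by eventually_elim simp
    qed (rule measurable_completion, measurable)
    then show ?thesis unfolding set_integrable_def by (subst (asm) integrable_completion) measurable
  qed
  have 2: "set_integrable lborel {a..b} g" for a b
  proof -
    have "set_integrable lborel {a..b} (\<lambda>y. 1 + cmod (g y) powr q)"
    proof (rule set_integral_add(1)[OF _ 1])
      show "set_integrable lborel {a..b} (\<lambda>y. 1 :: real)" by (rule borel_integrable_atLeastAtMost') simp
    qed
    then show ?thesis
    proof (rule set_integrable_bound)
      show "AE x in lborel. x \<in> {a..b} \<longrightarrow> norm (g x) \<le> norm (1 + cmod (g x) powr q)"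
      proof (intro always_eventually allI impI)
        fix x
        have "v \<le> 1 + v powr q" if "0 \<le> v" for v :: real
          using that q powr_mono[of 1 q v] by (cases "v \<le> 1") (auto intro: add_increasing2)
        from this[of "norm (g x)"] show "norm (g x) \<le> norm (1 + cmod (g x) powr q)" by simp
      qed
    qed (auto simp: set_borel_measurable_def)
  qed
  have 3: "omega k q f {A..B} = omega k q g {A..B}" for k A B
  proof -
    have "Lq_norm q {A..B} (Delta k h f {A..B}) = Lq_norm q {A..B} (Delta k h g {A..B})" for h
    proof -
      have "AE y in lborel. \<forall>i\<le>k. f (y + real i * h) = g (y + real i * h)"
        using AE_lborel_translate[OF fg] by (simp add: AE_all_countable)
      then have "AE y in lebesgue. \<forall>i\<le>k. f (y + real i * h) = g (y + real i * h)" by (rule AE_completion)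
      then have ae: "AE y in lebesgue. nth_diff k h f y = nth_diff k h g y"
        by eventually_elim (simp add: nth_diff_def)
      have Dg: "(\<lambda>y. indicator {A..B} y *\<^sub>R cmod (Delta k h g {A..B} y) powr q) \<in> borel_measurable lebesgue"
        unfolding Delta_eq by (rule measurable_completion) measurable
      have ae': "AE y in lebesgue. indicator {A..B} y *\<^sub>R cmod (Delta k h g {A..B} y) powr q = indicator {A..B} y *\<^sub>R cmod (Delta k h f {A..B} y) powr q"
        using ae by eventually_elim (simp add: Delta_eq)
      have tr: "(\<lambda>y. f (y + c)) \<in> borel_measurable lebesgue" for c
      proof -
        have "(\<lambda>x. c + x) \<in> lebesgue \<rightarrow>\<^sub>M lebesgue"
          using lebesgue_affine_measurable[where c = "\<lambda>x::real. 1" and t = c] by simp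
        from measurable_compose[OF this fm] show ?thesis by (simp add: add.commute)
      qed
      have nd: "nth_diff k h f \<in> borel_measurable lebesgue"
        unfolding nth_diff_def by (intro borel_measurable_sum borel_measurable_times borel_measurable_const tr)
      have "{y \<in> space lebesgue. y \<in> {A..B} \<and> y + real k * h \<in> {A..B}} = {max A (A - real k * h)..min B (B - real k * h)}" by auto
      then have "{y \<in> space lebesgue. y \<in> {A..B} \<and> y + real k * h \<in> {A..B}} \<in> sets lebesgue" by simp
      then have [measurable]: "Delta k h f {A..B} \<in> borel_measurable lebesgue"
        unfolding Delta_eq[abs_def] by (intro measurable_If nd measurable_const) auto
      have "(\<lambda>y. cmod (Delta k h f {A..B} y) powr q) \<in> borel_measurable lebesgue" by measurable
      then have "(\<lambda>y. indicator {A..B} y *\<^sub>R cmod (Delta k h f {A..B} y) powr q) \<in> borel_measurable lebesgue"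
        by (intro borel_measurable_scaleR borel_measurable_indicator) auto
      then show ?thesis
        unfolding Lq_norm_def set_lebesgue_integral_def using ae' Dg
        by (intro arg_cong[where f = "\<lambda>x. x powr (1/q)"] integral_cong_AE) auto
    qed
    then show ?thesis by (simp add: omega_def)
  qed
  show ?thesis by (rule that[OF gm fg 1 2 3])
qed

text \<open>The polynomial is controlled on \<open>[a, b]\<close> by the modulus on the longer
  interval \<open>[a, B]\<close>; the margin on the right is the room that forward differences take
  up.\<close>

lemma besov_local_polynomial:
  assumes f: "f \<in> Lq_loc q" and q: "1 \<le> q" and k: "1 \<le> k" and \<delta>: "0 < \<delta>" and ab: "a < b"
    and B: "b + real k * real (k + 1) * \<delta> \<le> B"
  shows "0 \<le> omega k q f {a..B}"
    "\<exists>P. degree P \<le> k - 1 \<and> (\<integral>\<^sup>+x\<in>{a..b}. ennreal (cmod (f x - poly P (of_real x))) \<partial>lebesgue)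
       \<le> ennreal (2 * ((1 + 2 ^ k * ((b - a) / \<delta>) ^ Suc k) * (2 * (B - a) powr (1 - 1 / q) * omega k q f {a..B})))"
proof -
  obtain g where g: "g \<in> borel_measurable borel" "AE x in lborel. f x = g x"
    "\<And>a b. set_integrable lborel {a..b} (\<lambda>y. cmod (g y) powr q)"
    "\<And>a b. set_integrable lborel {a..b} g"
    "\<And>k A B. omega k q f {A..B} = omega k q g {A..B}"
    by (rule Lq_loc_borel_version[OF f q], rule that)
  have "0 \<le> real k * real (k + 1) * \<delta>" using \<delta> by simp
  then have aB: "a < B" using ab B by linarith
  show \<Omega>: "0 \<le> omega k q f {a..B}"
    unfolding g(5) by (rule omega_nonneg[OF g(1) q aB g(3)])
  obtain P where P: "degree P \<le> k - 1" "(\<integral>\<^sup>+x\<in>{a..b}. ennreal (cmod (g x - poly P (of_real x))) \<partial>lborel)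
       \<le> ennreal (2 * ((1 + 2 ^ k * ((b - a) / \<delta>) ^ Suc k) * (2 * (B - a) powr (1 - 1 / q) * omega k q f {a..B})))"
  proof (atomize_elim, rule local_polynomial_approx[OF g(1,4) \<delta> k ab _ _ B])
    show "0 \<le> 2 * (B - a) powr (1 - 1 / q) * omega k q f {a..B}" using \<Omega> by simp
    show "(\<integral>\<^sup>+x\<in>{a..B - real k * h}. ennreal (cmod (nth_diff k h g x)) \<partial>lborel) \<le> ennreal (2 * (B - a) powr (1 - 1 / q) * omega k q f {a..B})"
      if "0 \<le> h" "real k * h \<le> B - a" for h
      unfolding g(5) by (rule nth_diff_L1_bound[OF g(1) q aB g(3) that])
  qed
  moreover have "(\<integral>\<^sup>+x\<in>{a..b}. ennreal (cmod (f x - poly P (of_real x))) \<partial>lebesgue) = (\<integral>\<^sup>+x\<in>{a..b}. ennreal (cmod (g x - poly P (of_real x))) \<partial>lborel)"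
    unfolding nn_integral_completion
    by (rule nn_integral_cong_AE) (use g(2) in eventually_elim, simp)
  ultimately show "\<exists>P. degree P \<le> k - 1 \<and> (\<integral>\<^sup>+x\<in>{a..b}. ennreal (cmod (f x - poly P (of_real x))) \<partial>lebesgue)
       \<le> ennreal (2 * ((1 + 2 ^ k * ((b - a) / \<delta>) ^ Suc k) * (2 * (B - a) powr (1 - 1 / q) * omega k q f {a..B})))"
    by auto
qed

lemma Lq_loc_locally_integrable:
  assumes f: "f \<in> Lq_loc q" and q: "1 \<le> q"
  shows "locally_integrable f"
  unfolding locally_integrable_def
proof (intro allI)
  fix a b
  obtain g where g: "g \<in> borel_measurable borel" "AE x in lborel. f x = g x"
    "\<And>a b. set_integrable lborel {a..b} (\<lambda>y. cmod (g y) powr q)"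
    "\<And>a b. set_integrable lborel {a..b} g"
    "\<And>k A B. omega k q f {A..B} = omega k q g {A..B}"
    by (rule Lq_loc_borel_version[OF f q], rule that)
  have fm [measurable]: "f \<in> borel_measurable lebesgue" using f by (simp add: Lq_loc_def)
  have "integrable lebesgue (\<lambda>x. indicator {a..b} x *\<^sub>R g x)"
    using g(1,4) unfolding set_integrable_def by (subst integrable_completion) auto
  then show "set_integrable lebesgue {a..b} f"
    unfolding set_integrable_def
  proof (rule integrable_cong_AE_imp)
    show "AE x in lebesgue. indicator {a..b} x *\<^sub>R g x = indicator {a..b} x *\<^sub>R f x"
      using AE_completion[OF g(2)] by eventually_elim simp
  qed (intro borel_measurable_scaleR borel_measurable_indicator fm, auto)
qed

section \<open>The tree of cells and sparse selection\<close>

locale multilevel_partition =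
  fixes M0 :: nat and lam :: real and x :: "int \<Rightarrow> int \<Rightarrow> real"
  assumes regular: "regular_multilevel_partition M0 lam x" and lam: "1 \<le> lam"
begin

abbreviation len :: "int \<Rightarrow> int \<Rightarrow> real" where "len \<equiv> cell_length x"

text \<open>Cells are taken half open here, so that each point lies in exactly one cell per level
  and the cells form a tree.\<close>

definition idx :: "int \<Rightarrow> real \<Rightarrow> int" where
  "idx m y = (THE j. x m j \<le> y \<and> y < x m (j + 1))"

definition kids :: "int \<Rightarrow> int \<Rightarrow> int set" where
  "kids m j = {i. idx m (x (m + 1) i) = j}"

text \<open>The cell itself counts as its first generation, so \<open>desc n\<close> spans
  \<open>n\<close> levels. Being finite, it allows induction from the top without any limit.\<close>

definition desc :: "nat \<Rightarrow> int \<Rightarrow> int \<Rightarrow> (int \<times> int) set" where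
  "desc n m j = {(l, i). m \<le> l \<and> l < m + int n \<and> idx m (x l i) = j}"

definition rho :: real where "rho = lam / (1 + lam)"

lemma knots_mono: "strict_mono (x m)"
  using regular by (simp add: regular_multilevel_partition_def)

lemma knots_less [simp]: "x m i < x m j \<longleftrightarrow> i < j"
  by (rule strict_mono_less[OF knots_mono])

lemma knots_le [simp]: "x m i \<le> x m j \<longleftrightarrow> i \<le> j"
  by (rule strict_mono_less_eq[OF knots_mono])

lemma knots_eq [simp]: "x m i = x m j \<longleftrightarrow> i = j"
  by (rule strict_mono_eq[OF knots_mono])

lemma len_pos [simp]: "0 < len m j"
  by (simp add: cell_length_def)

lemma len_nonneg [simp]: "0 \<le> len m j"
  using len_pos[of m j] by linarith

lemma len_le: "len m i \<le> lam * len m j"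
  using regular by (simp add: regular_multilevel_partition_def)

lemma idx_eq:
  assumes "x m j \<le> y" "y < x m (j + 1)"
  shows "idx m y = j"
  unfolding idx_def
proof (rule the_equality)
  fix i assume "x m i \<le> y \<and> y < x m (i + 1)"
  then have "x m i < x m (j + 1)" "x m j < x m (i + 1)" using assms by linarith+
  then show "i = j" by simp
qed (use assms in simp)

lemma idx_lower [simp]: "x m (idx m y) \<le> y" and idx_upper [simp]: "y < x m (idx m y + 1)"
proof -
  have "y \<in> \<Union> (level x m)" using regular by (simp add: regular_multilevel_partition_def)
  then obtain j where j: "x m j \<le> y" "y \<le> x m (j + 1)" by (auto simp: level_def cell_def)
  have "\<exists>j. x m j \<le> y \<and> y < x m (j + 1)"
  proof (cases "y < x m (j + 1)")
    case False
    then have "y = x m (j + 1)" using j by simp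
    then show ?thesis by (intro exI[of _ "j + 1"]) simp
  qed (use j in blast)
  then show "x m (idx m y) \<le> y" "y < x m (idx m y + 1)" using idx_eq by auto
qed

lemma idx_knot [simp]: "idx m (x m j) = j"
  by (rule idx_eq) simp_all

lemma le_idx_iff: "j \<le> idx m y \<longleftrightarrow> x m j \<le> y"
proof
  assume "j \<le> idx m y"
  then have "x m j \<le> x m (idx m y)" by simp
  then show "x m j \<le> y" using idx_lower[of m y] by linarith
next
  assume "x m j \<le> y"
  then have "x m j < x m (idx m y + 1)" using idx_upper[of y m] by linarith
  then show "j \<le> idx m y" by simp
qed

lemma idx_mono: "y \<le> z \<Longrightarrow> idx m y \<le> idx m z"
  using idx_lower[of m y] by (subst le_idx_iff) linarith

text \<open>The half-open fine cell around the knot lies in one coarse cell. That coarse cell must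
  start at the knot, and then so does the fine cell.\<close>

lemma knot_next_level: "x m j \<in> range (x (m + 1))"
proof -
  define i where "i = idx (m + 1) (x m j)"
  have i: "x (m + 1) i \<le> x m j" "x m j < x (m + 1) (i + 1)" by (simp_all add: i_def)
  have "cell x (m + 1) i \<in> level x (m + 1)" by (simp add: level_def)
  then obtain I where "I \<in> level x m" "cell x (m + 1) i \<subseteq> I"
    using regular unfolding regular_multilevel_partition_def by blast
  then obtain j' where j': "cell x (m + 1) i \<subseteq> cell x m j'" by (auto simp: level_def)
  have "x (m + 1) i \<le> x (m + 1) (i + 1)" by simp
  then have j'': "x m j' \<le> x (m + 1) i" "x (m + 1) (i + 1) \<le> x m (j' + 1)"
    using j' unfolding cell_def atLeastatMost_subset_iff by auto
  then have "x m j < x m (j' + 1)" "x m j' \<le> x m j" using i by linarith+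
  then have "j = j'" by simp
  then show ?thesis using i j'' by (metis order_antisym rangeI)
qed

lemma knot_finer_level:
  assumes "m \<le> l"
  shows "x m j \<in> range (x l)"
  using assms
proof (induction l rule: int_ge_induct)
  case (step l)
  then show ?case using knot_next_level by (metis (no_types, lifting) rangeE)
qed simp

text \<open>The left end of the coarse cell around \<open>y\<close> is also a fine knot, hence it
  lies at or before the left end of the fine cell around \<open>y\<close>.\<close>

lemma idx_idx:
  assumes "m \<le> l"
  shows "idx m (x l (idx l y)) = idx m y"
proof (rule idx_eq)
  obtain i where i: "x m (idx m y) = x l i" using knot_finer_level[OF assms] by (metis imageE)
  have "x l i \<le> y" using idx_lower[of m y] i by simp
  then show "x m (idx m y) \<le> x l (idx l y)" unfolding i by (simp add: le_idx_iff)
  show "x l (idx l y) < x m (idx m y + 1)" using idx_lower[of l y] idx_upper[of y m] by linarith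
qed

lemma next_knot_le:
  assumes "m \<le> l" "x l i < x m j"
  shows "x l (i + 1) \<le> x m j"
proof -
  obtain r where r: "x m j = x l r" using knot_finer_level[OF assms(1)] by (metis imageE)
  then show ?thesis using assms by simp
qed

lemma idx_Suc_le:
  assumes "m \<le> l"
  shows "idx m (x l (i + 1)) \<le> idx m (x l i) + 1"
proof -
  have "x l (i + 1) \<le> x m (idx m (x l i) + 1)" by (rule next_knot_le[OF assms]) simp
  from idx_mono[OF this, of m] show ?thesis by simp
qed

lemma idx_shift_le:
  assumes "m \<le> l"
  shows "idx m (x l (i + int n)) \<le> idx m (x l i) + int n"
proof (induction n)
  case (Suc n)
  have "idx m (x l (i + int n + 1)) \<le> idx m (x l (i + int n)) + 1" by (rule idx_Suc_le[OF assms])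
  then show ?case using Suc by (simp add: ac_simps)
qed simp

lemma kids_iff: "i \<in> kids m j \<longleftrightarrow> cell x (m + 1) i \<subseteq> cell x m j"
proof
  assume "i \<in> kids m j"
  then have "idx m (x (m + 1) i) = j" by (simp add: kids_def)
  then have "x m j \<le> x (m + 1) i" "x (m + 1) i < x m (j + 1)" by auto
  then show "cell x (m + 1) i \<subseteq> cell x m j" using next_knot_le[of m "m + 1" i "j + 1"]
    by (auto simp: cell_def)
next
  assume "cell x (m + 1) i \<subseteq> cell x m j"
  moreover have "x (m + 1) i < x (m + 1) (i + 1)" by simp
  moreover from calculation have "x m j \<le> x (m + 1) i" "x (m + 1) (i + 1) \<le> x m (j + 1)"
    unfolding cell_def atLeastatMost_subset_iff by auto
  ultimately have "x m j \<le> x (m + 1) i" "x (m + 1) i < x m (j + 1)" by linarith+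
  then show "i \<in> kids m j" unfolding kids_def using idx_eq by simp
qed

lemma kids_card: "finite (kids m j)" "2 \<le> card (kids m j)" "card (kids m j) \<le> M0"
proof -
  have inj: "inj (cell x (m + 1))"
  proof (rule injI)
    fix i i' assume "cell x (m + 1) i = cell x (m + 1) i'"
    moreover have "x (m + 1) i < x (m + 1) (i + 1)" by simp
    ultimately have "x (m + 1) i = x (m + 1) i'" unfolding cell_def by (subst (asm) Icc_eq_Icc) auto
    then show "i = i'" by simp
  qed
  have im: "children x m (cell x m j) = cell x (m + 1) ` kids m j"
    by (auto simp: children_def level_def kids_iff)
  have "2 \<le> card (children x m (cell x m j)) \<and> card (children x m (cell x m j)) \<le> M0"
    using regular by (simp add: regular_multilevel_partition_def level_def)
  then have c: "2 \<le> card (kids m j)" "card (kids m j) \<le> M0"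
    unfolding im using card_image[OF inj_on_subset[OF inj]] by auto
  then show "finite (kids m j)" "2 \<le> card (kids m j)" "card (kids m j) \<le> M0"
    by (auto intro: card_ge_0_finite)
qed

lemma kids_nonempty: "kids m j \<noteq> {}"
  using kids_card(2)[of m j] by auto

lemma sum_len:
  assumes "i \<le> i'"
  shows "(\<Sum>r\<in>{i..<i'}. len m r) = x m i' - x m i"
  using assms
proof (induction i' rule: int_ge_induct)
  case (step i')
  have "{i..<i' + 1} = insert i' {i..<i'}" using step.hyps by auto
  then show ?case using step.IH by (simp add: cell_length_def)
qed simp

lemma sum_kids_len: "(\<Sum>i\<in>kids m j. len (m + 1) i) = len m j"
proof -
  obtain i1 where i1: "x m j = x (m + 1) i1" using knot_next_level by (metis imageE)
  obtain i2 where i2: "x m (j + 1) = x (m + 1) i2" using knot_next_level by (metis imageE)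
  have "x m j < x m (j + 1)" by simp
  then have le: "i1 \<le> i2" unfolding i1 i2 by simp
  have "kids m j = {i1..<i2}"
  proof (rule set_eqI)
    fix i
    have "i \<in> kids m j \<longleftrightarrow> x m j \<le> x (m + 1) i \<and> x (m + 1) i < x m (j + 1)"
      unfolding kids_def using idx_eq[of m j "x (m + 1) i"] idx_lower[of m "x (m + 1) i"] idx_upper[of "x (m + 1) i" m] by auto
    then show "i \<in> kids m j \<longleftrightarrow> i \<in> {i1..<i2}" unfolding i1 i2 by simp
  qed
  then show ?thesis using sum_len[OF le] by (simp add: cell_length_def i1 i2)
qed

lemma rho_bounds: "0 < rho" "rho < 1"
  using lam by (auto simp: rho_def)

text \<open>There is a sibling, at least \<open>1 / lam\<close> times as long as the child, so the
  child covers at most the fraction \<open>lam / (1 + lam)\<close> of the parent.\<close>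

lemma kid_len_le:
  assumes i: "i \<in> kids m j"
  shows "len (m + 1) i \<le> rho * len m j"
proof -
  have "\<exists>i'\<in>kids m j. i' \<noteq> i"
  proof (rule ccontr)
    assume "\<not> ?thesis"
    then have "kids m j \<subseteq> {i}" by auto
    then have "card (kids m j) \<le> card {i}" by (intro card_mono) auto
    then show False using kids_card(2)[of m j] by simp
  qed
  then obtain i' where i': "i' \<in> kids m j" "i' \<noteq> i" by blast
  have "(\<Sum>r\<in>{i, i'}. len (m + 1) r) \<le> (\<Sum>r\<in>kids m j. len (m + 1) r)"
    using i i' by (intro sum_mono2 kids_card) auto
  then have "len (m + 1) i + len (m + 1) i' \<le> len m j" using i' by (simp add: sum_kids_len)
  moreover have "len (m + 1) i \<le> lam * len (m + 1) i'" by (rule len_le)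
  ultimately have "lam * len (m + 1) i + len (m + 1) i \<le> lam * len m j"
    using lam mult_left_mono[of "len (m + 1) i + len (m + 1) i'" "len m j" lam] by (simp add: algebra_simps)
  then have "len (m + 1) i \<le> lam * len m j / (1 + lam)"
    using lam by (subst pos_le_divide_eq) (simp_all add: algebra_simps)
  then show ?thesis by (simp add: rho_def)
qed

lemma kid_len_ge:
  assumes i: "i \<in> kids m j"
  shows "len m j \<le> real M0 * lam * len (m + 1) i"
proof -
  have "len m j = (\<Sum>r\<in>kids m j. len (m + 1) r)" by (rule sum_kids_len[symmetric])
  also have "\<dots> \<le> (\<Sum>r\<in>kids m j. lam * len (m + 1) i)" by (intro sum_mono len_le)
  also have "\<dots> = real (card (kids m j)) * (lam * len (m + 1) i)" by simp
  also have "\<dots> \<le> real M0 * (lam * len (m + 1) i)"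
    using kids_card(3)[of m j] lam by (intro mult_right_mono) auto
  finally show ?thesis by simp
qed

lemma idx_kid: "idx (m + 1) y \<in> kids m (idx m y)"
  unfolding kids_def using idx_idx[of m "m + 1" y] by simp

lemma desc_len_le: "len (m + int n) i \<le> rho ^ n * len m (idx m (x (m + int n) i))"
proof (induction n arbitrary: i)
  case (Suc n)
  let ?y = "x (m + int n + 1) i"
  have "idx (m + int n + 1) ?y = i" by (rule idx_knot)
  then have "i \<in> kids (m + int n) (idx (m + int n) ?y)" using idx_kid[of "m + int n" ?y] by (simp only:)
  then have "len (m + int n + 1) i \<le> rho * len (m + int n) (idx (m + int n) ?y)" by (rule kid_len_le)
  also have "\<dots> \<le> rho * (rho ^ n * len m (idx m (x (m + int n) (idx (m + int n) ?y))))"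
    by (rule mult_left_mono[OF Suc.IH less_imp_le[OF rho_bounds(1)]])
  also have "idx m (x (m + int n) (idx (m + int n) ?y)) = idx m ?y" by (rule idx_idx) simp
  finally have "len (m + int n + 1) i \<le> rho * (rho ^ n * len m (idx m ?y))" .
  moreover have "m + int (Suc n) = m + int n + 1" by simp
  ultimately show ?case by (simp only: power_Suc mult.assoc)
qed simp

lemma len_decay: "len (m + int n) i \<le> lam * rho ^ n * len m j"
proof -
  have "len (m + int n) i \<le> rho ^ n * len m (idx m (x (m + int n) i))" by (rule desc_len_le)
  also have "\<dots> \<le> rho ^ n * (lam * len m j)" using rho_bounds by (intro mult_left_mono[OF len_le]) simp
  finally show ?thesis by (simp only: mult.assoc mult.left_commute)
qed

lemma desc_0 [simp]: "desc 0 m j = {}"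
  by (auto simp: desc_def)

lemma desc_Suc: "desc (Suc n) m j = insert (m, j) (\<Union>i\<in>kids m j. desc n (m + 1) i)"
proof (rule set_eqI, clarify)
  fix l i
  show "(l, i) \<in> desc (Suc n) m j \<longleftrightarrow> (l, i) \<in> insert (m, j) (\<Union>i\<in>kids m j. desc n (m + 1) i)"
  proof (cases "l = m")
    case False
    have "idx m (x l i) = j \<longleftrightarrow> idx (m + 1) (x l i) \<in> kids m j"
      using idx_idx[of m "m + 1" "x l i"] by (simp add: kids_def)
    then show ?thesis using False by (auto simp: desc_def)
  qed (auto simp: desc_def)
qed

lemma desc_finite [simp]: "finite (desc n m j)"
  by (induction n arbitrary: m j) (auto simp: desc_Suc intro: kids_card)

lemma desc_disjoint: "i \<noteq> j \<Longrightarrow> desc n m i \<inter> desc n m j = {}"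
  by (auto simp: desc_def)

lemma sum_desc_Suc:
  fixes w :: "int \<times> int \<Rightarrow> real"
  shows "sum w (desc (Suc n) m j) = w (m, j) + (\<Sum>i\<in>kids m j. sum w (desc n (m + 1) i))"
proof -
  have "(m, j) \<notin> (\<Union>i\<in>kids m j. desc n (m + 1) i)" by (auto simp: desc_def)
  moreover have "sum w (\<Union>i\<in>kids m j. desc n (m + 1) i) = (\<Sum>i\<in>kids m j. sum w (desc n (m + 1) i))"
    by (rule sum.UNION_disjoint) (auto intro: kids_card dest: desc_disjoint)
  ultimately show ?thesis unfolding desc_Suc by (subst sum.insert) (auto intro: kids_card)
qed

end

section \<open>Masses and the selection of cells\<close>

locale weighted_partition = multilevel_partition +
  fixes w :: "int \<times> int \<Rightarrow> real" and \<alpha> \<theta> :: real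
  assumes w_nonneg: "\<And>p. 0 \<le> w p" and w_summable: "w summable_on UNIV"
    and alpha: "0 < \<alpha>" and theta: "0 < \<theta>"
begin

definition below :: "int \<Rightarrow> int \<Rightarrow> (int \<times> int) set" where
  "below m j = {(l, i). m \<le> l \<and> idx m (x l i) = j}"

definition mass :: "int \<Rightarrow> int \<Rightarrow> real" where
  "mass m j = infsum w (below m j)"

definition selected :: "(int \<times> int) set" where
  "selected = {(m, j). \<forall>i\<in>kids m j. \<theta> \<le> mass m j - mass (m + 1) i}"

lemma summable_sub: "w summable_on A"
  using w_summable by (rule summable_on_subset_banach) simp

lemma infsum_UN:
  assumes "finite C" "\<And>i j. i \<in> C \<Longrightarrow> j \<in> C \<Longrightarrow> i \<noteq> j \<Longrightarrow> B i \<inter> B j = {}"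
  shows "(\<Sum>i\<in>C. infsum w (B i)) = infsum w (\<Union>i\<in>C. B i)"
  using assms
proof (induction C rule: finite_induct)
  case (insert c C)
  have "B c \<inter> B i = {}" if "i \<in> C" for i
    using insert.prems[of c i] insert.hyps(2) that by auto
  then have "B c \<inter> (\<Union>i\<in>C. B i) = {}" by blast
  then have "infsum w (B c \<union> (\<Union>i\<in>C. B i)) = infsum w (B c) + infsum w (\<Union>i\<in>C. B i)"
    by (intro infsum_Un_disjoint summable_sub)
  moreover have "(\<Sum>i\<in>C. infsum w (B i)) = infsum w (\<Union>i\<in>C. B i)"
    by (rule insert.IH) (rule insert.prems; simp)
  ultimately show ?case using insert.hyps by simp
qed simp

lemma mass_nonneg: "0 \<le> mass m j"
  unfolding mass_def by (rule infsum_nonneg) (rule w_nonneg)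

lemma mass_superadditive: "w (m, j) + (\<Sum>i\<in>kids m j. mass (m + 1) i) \<le> mass m j"
proof -
  define U where "U = (\<Union>i\<in>kids m j. below (m + 1) i)"
  have disj: "below (m + 1) i \<inter> below (m + 1) i' = {}" if "i \<noteq> i'" for i i'
    using that by (auto simp: below_def)
  have 1: "(\<Sum>i\<in>kids m j. mass (m + 1) i) = infsum w U"
    unfolding mass_def U_def using kids_card(1) disj by (rule infsum_UN)
  have "(m, j) \<notin> U" by (auto simp: below_def U_def)
  then have 2: "infsum w ({(m, j)} \<union> U) = infsum w {(m, j)} + infsum w U"
    by (intro infsum_Un_disjoint summable_sub) auto
  have "{(m, j)} \<union> U \<subseteq> below m j"
  proof -
    have "(l, i) \<in> below m j" if "(l, i) \<in> below (m + 1) i'" "i' \<in> kids m j" for l i i'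
    proof -
      have "m + 1 \<le> l" "idx m (x (m + 1) (idx (m + 1) (x l i))) = j" using that by (simp_all add: below_def kids_def)
      then show ?thesis unfolding idx_idx[of m "m + 1" "x l i", simplified] by (simp add: below_def)
    qed
    moreover have "(m, j) \<in> below m j" by (simp add: below_def)
    ultimately show ?thesis by (auto simp: U_def)
  qed
  then have "infsum w ({(m, j)} \<union> U) \<le> mass m j"
    unfolding mass_def by (intro infsum_mono2 summable_sub w_nonneg)
  then show ?thesis using 1 2 by (simp only: infsum_finite finite.intros sum.insert sum.empty) simp
qed

lemma w_le_mass: "w (m, j) \<le> mass m j"
proof -
  have "0 \<le> (\<Sum>i\<in>kids m j. mass (m + 1) i)" by (intro sum_nonneg mass_nonneg)
  then show ?thesis using mass_superadditive[of m j] by linarith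
qed

lemma sum_mass_le:
  assumes "C \<subseteq> kids m j"
  shows "w (m, j) + (\<Sum>i\<in>C. mass (m + 1) i) \<le> mass m j"
proof -
  have "(\<Sum>i\<in>C. mass (m + 1) i) \<le> (\<Sum>i\<in>kids m j. mass (m + 1) i)"
    using assms by (intro sum_mono2 kids_card) (auto intro: mass_nonneg)
  then show ?thesis using mass_superadditive[of m j] by linarith
qed

text \<open>The \<open>- 1\<close> pays for a selected cell two of whose children have selected cells below them.\<close>

lemma card_selected_desc: "real (card (desc n m j \<inter> selected)) \<le> max 0 (2 * mass m j / \<theta> - 1)"
proof (induction n arbitrary: m j)
  case (Suc n)
  define r where "r = (\<lambda>i. real (card (desc n (m + 1) i \<inter> selected)))"
  define s where "s = (if (m, j) \<in> selected then 1 else 0 :: real)"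
  have card_eq: "real (card (desc n m j \<inter> selected)) = sum (indicator selected) (desc n m j)" for n m j
    by (simp add: sum.inter_restrict[symmetric] indicator_def of_bool_def sum.If_cases Int_def)
  have tot: "real (card (desc (Suc n) m j \<inter> selected)) = s + (\<Sum>i\<in>kids m j. r i)"
    unfolding card_eq sum_desc_Suc r_def s_def by (simp add: indicator_def)
  define P where "P = {i \<in> kids m j. 0 < r i}"
  have fP: "finite P" using kids_card(1)[of m j] by (simp add: P_def)
  have rP: "r i \<le> 2 * mass (m + 1) i / \<theta> - 1" if "i \<in> P" for i
    using Suc.IH[of "m + 1" i] that by (auto simp: P_def r_def)
  have sumP: "(\<Sum>i\<in>kids m j. r i) = (\<Sum>i\<in>P. r i)"
    unfolding P_def by (rule sum.mono_neutral_right) (auto simp: kids_card r_def)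
  have "(\<Sum>i\<in>P. r i) \<le> (\<Sum>i\<in>P. 2 * mass (m + 1) i / \<theta> - 1)" by (rule sum_mono) (rule rP)
  also have "\<dots> = 2 * (\<Sum>i\<in>P. mass (m + 1) i) / \<theta> - real (card P)"
    by (simp add: sum_subtractf sum_distrib_left sum_divide_distrib)
  also have "\<dots> \<le> 2 * mass m j / \<theta> - real (card P)"
    using sum_mass_le[of P m j] w_nonneg[of "(m, j)"] theta by (auto simp: P_def divide_right_mono)
  finally have le: "(\<Sum>i\<in>kids m j. r i) \<le> 2 * mass m j / \<theta> - real (card P)" by (simp add: sumP)
  have s1: "s \<le> 1" by (simp add: s_def)
  \<comment> \<open>\<open>P\<close> consists of the children with selected cells below them. If it
    is empty, a selected cell has mass at least \<theta>, and \<open>2 - 1\<close> pays for it. With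
    one child, selection means that its mass is smaller by \<theta>, which lowers its bound by
    \<open>2\<close>. With two or more, the terms \<open>- 1\<close> of the children leave at least
    one to spare.\<close>
  consider "card P = 0" | "card P = 1" | "2 \<le> card P" by linarith
  then have "s + (\<Sum>i\<in>kids m j. r i) \<le> max 0 (2 * mass m j / \<theta> - 1)"
  proof cases
    case 1
    then have "(\<Sum>i\<in>kids m j. r i) = 0" using fP by (simp add: sumP)
    moreover have "s \<le> max 0 (2 * mass m j / \<theta> - 1)"
    proof (cases "(m, j) \<in> selected")
      case True
      obtain i where "i \<in> kids m j" using kids_nonempty by blast
      then have "\<theta> \<le> mass m j - mass (m + 1) i" using True by (simp add: selected_def)
      then have "\<theta> \<le> mass m j" using mass_nonneg[of "m + 1" i] by linarith
      then have "1 \<le> mass m j / \<theta>" using theta by simp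
      then show ?thesis using s1 by simp
    qed (simp add: s_def)
    ultimately show ?thesis by simp
  next
    case 2
    then obtain i where P: "P = {i}" by (metis card_1_singletonE)
    then have i: "i \<in> kids m j" by (auto simp: P_def)
    show ?thesis
    proof (cases "(m, j) \<in> selected")
      case True
      then have "\<theta> \<le> mass m j - mass (m + 1) i" using i by (simp add: selected_def)
      then have "mass (m + 1) i / \<theta> \<le> (mass m j - \<theta>) / \<theta>" using theta by (intro divide_right_mono) auto
      then have "mass (m + 1) i / \<theta> \<le> mass m j / \<theta> - 1" using theta by (simp add: diff_divide_distrib)
      then show ?thesis using rP[of i] P s1 by (simp add: sumP)
    next
      case False
      then show ?thesis using le 2 by (simp add: s_def)
    qed
  next
    case 3
    then have "2 \<le> real (card P)" by simp
    then show ?thesis using le s1 by linarith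
  qed
  then show ?case using tot by simp
qed simp

text \<open>A finite set of selected cells lies below finitely many cells of its coarsest level. The
  families below these are disjoint, so their masses add up to at most the total.\<close>

lemma selected_card: "finite selected \<and> real (card selected) \<le> 2 * infsum w UNIV / \<theta>"
proof -
  have fin: "real (card F) \<le> 2 * infsum w UNIV / \<theta>" if F: "F \<subseteq> selected" "finite F" for F
  proof (cases "F = {}")
    case True
    then show ?thesis using theta infsum_nonneg[of UNIV w] w_nonneg by simp
  next
    case False
    define m0 m1 where "m0 = Min (fst ` F)" and "m1 = Max (fst ` F)"
    define n where "n = nat (m1 - m0 + 1)"
    define J where "J = (\<lambda>(l, i). idx m0 (x l i)) ` F"
    have fJ: "finite J" using F by (simp add: J_def)
    have b: "m0 \<le> l" "l \<le> m1" if "(l, i) \<in> F" for l i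
    proof -
      have "l \<in> fst ` F" using that by force
      then show "m0 \<le> l" "l \<le> m1" using F(2) unfolding m0_def m1_def by (auto intro: Min_le Max_ge)
    qed
    have "F \<subseteq> (\<Union>j\<in>J. desc n m0 j \<inter> selected)"
    proof
      fix p assume p: "p \<in> F"
      obtain l i where li: "p = (l, i)" by (cases p)
      have "p \<in> desc n m0 (idx m0 (x l i))" using b[of l i] p li by (auto simp: desc_def n_def)
      moreover have "idx m0 (x l i) \<in> J" using p li by (force simp: J_def)
      ultimately show "p \<in> (\<Union>j\<in>J. desc n m0 j \<inter> selected)" using F p by auto
    qed
    then have "card F \<le> card (\<Union>j\<in>J. desc n m0 j \<inter> selected)" using fJ by (intro card_mono) auto
    also have "\<dots> \<le> (\<Sum>j\<in>J. card (desc n m0 j \<inter> selected))" by (rule card_UN_le[OF fJ])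
    finally have "real (card F) \<le> (\<Sum>j\<in>J. real (card (desc n m0 j \<inter> selected)))"
      by (metis of_nat_le_iff of_nat_sum)
    also have "\<dots> \<le> (\<Sum>j\<in>J. 2 * mass m0 j / \<theta>)"
    proof (rule sum_mono)
      fix j
      have "0 \<le> 2 * mass m0 j / \<theta>" using mass_nonneg[of m0 j] theta by simp
      then show "real (card (desc n m0 j \<inter> selected)) \<le> 2 * mass m0 j / \<theta>"
        using card_selected_desc[of n m0 j] by linarith
    qed
    also have "\<dots> = 2 * (\<Sum>j\<in>J. mass m0 j) / \<theta>"
      by (simp add: sum_distrib_left sum_divide_distrib)
    also have "(\<Sum>j\<in>J. mass m0 j) = infsum w (\<Union>j\<in>J. below m0 j)"
      unfolding mass_def by (rule infsum_UN[OF fJ]) (auto simp: below_def)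
    also have "infsum w (\<Union>j\<in>J. below m0 j) \<le> infsum w UNIV"
      by (rule infsum_mono2) (auto intro: summable_sub w_nonneg)
    finally show ?thesis using theta by (simp add: divide_right_mono)
  qed
  have "finite selected \<and> card selected \<le> nat \<lfloor>2 * infsum w UNIV / \<theta>\<rfloor>"
  proof (rule finite_if_finite_subsets_card_bdd)
    fix G assume "G \<subseteq> selected" "finite G"
    then show "card G \<le> nat \<lfloor>2 * infsum w UNIV / \<theta>\<rfloor>" using fin[of G] by (simp add: le_nat_floor)
  qed
  then show ?thesis using fin[of selected] by simp
qed

section \<open>Carleson bounds from masses\<close>

definition CL :: real where "CL = 1 / ((1 - 2 powr - \<alpha>) * (1 - rho))"

lemma two_powr: "2 powr - \<alpha> < (1::real)"
  using alpha by (simp add: powr_less_one)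

lemma CL_pos: "0 < CL"
  using two_powr rho_bounds by (simp add: CL_def)

text \<open>All children but the heaviest, \<open>i1\<close>, have at most half the mass of the
  parent, hence the factor \<open>2 powr - \<alpha>\<close>; and \<open>i1\<close> is shorter than
  the parent by the factor \<open>rho\<close>. So the sum of \<open>mass powr \<alpha> * len\<close>
  shrinks by the factor \<open>1 - 1 / CL\<close> from one generation to the next, and
  \<open>CL\<close> is the sum of the geometric series.\<close>

lemma light_bound: "(\<Sum>p\<in>desc n m j. w p powr \<alpha> * len (fst p) (snd p)) \<le> CL * mass m j powr \<alpha> * len m j"
proof (induction n arbitrary: m j)
  case 0
  then show ?case using CL_pos by simp
next
  case (Suc n)
  let ?N = "mass m j powr \<alpha>"
  define Q where "Q = (2::real) powr - \<alpha>"
  have Q: "0 < Q" "Q < 1" using two_powr by (auto simp: Q_def)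
  obtain i1 where i1: "i1 \<in> kids m j" "\<And>i. i \<in> kids m j \<Longrightarrow> mass (m + 1) i \<le> mass (m + 1) i1"
  proof -
    have "Max (mass (m + 1) ` kids m j) \<in> mass (m + 1) ` kids m j"
      using kids_card(1) kids_nonempty by (intro Max_in) auto
    then obtain i1 where "i1 \<in> kids m j" "Max (mass (m + 1) ` kids m j) = mass (m + 1) i1" by blast
    moreover have "mass (m + 1) i \<le> Max (mass (m + 1) ` kids m j)" if "i \<in> kids m j" for i
      using kids_card(1) that by simp
    ultimately show ?thesis by (auto intro: that)
  qed
  have fk: "finite (kids m j)" by (rule kids_card)
  have big: "mass (m + 1) i1 powr \<alpha> \<le> ?N"
  proof (rule powr_mono2)
    show "mass (m + 1) i1 \<le> mass m j" using sum_mass_le[of "{i1}" m j] i1(1) w_nonneg[of "(m, j)"] by simp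
  qed (use alpha mass_nonneg in auto)
  have small: "mass (m + 1) i powr \<alpha> \<le> Q * ?N" if i: "i \<in> kids m j - {i1}" for i
  proof -
    have "mass (m + 1) i + mass (m + 1) i1 \<le> mass m j"
      using sum_mass_le[of "{i, i1}" m j] i i1 w_nonneg[of "(m, j)"] by simp
    then have "mass (m + 1) i \<le> mass m j / 2" using i1(2)[of i] i by simp
    then have "mass (m + 1) i powr \<alpha> \<le> (mass m j / 2) powr \<alpha>" using alpha mass_nonneg by (intro powr_mono2) auto
    also have "\<dots> = Q * ?N" using mass_nonneg[of m j] by (simp add: Q_def powr_divide powr_minus_divide)
    finally show ?thesis .
  qed
  have split: "(\<Sum>i\<in>kids m j. g i) = g i1 + (\<Sum>i\<in>kids m j - {i1}. g i)" for g :: "int \<Rightarrow> real"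
    using i1 fk by (simp add: sum.remove)
  have lsplit: "(\<Sum>i\<in>kids m j - {i1}. len (m + 1) i) = len m j - len (m + 1) i1"
    using split[of "len (m + 1)"] sum_kids_len[of m j] by linarith
  have "(\<Sum>i\<in>kids m j. mass (m + 1) i powr \<alpha> * len (m + 1) i)
      \<le> ?N * len (m + 1) i1 + (\<Sum>i\<in>kids m j - {i1}. Q * ?N * len (m + 1) i)"
    unfolding split[of "\<lambda>i. mass (m + 1) i powr \<alpha> * len (m + 1) i"]
    using big small by (intro add_mono sum_mono mult_right_mono) auto
  also have "\<dots> = ?N * (len m j - (1 - Q) * (len m j - len (m + 1) i1))"
    unfolding sum_distrib_left[symmetric] lsplit by algebra
  also have "\<dots> \<le> ?N * (len m j - (1 - Q) * ((1 - rho) * len m j))"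
  proof (rule mult_left_mono)
    have "(1 - rho) * len m j \<le> len m j - len (m + 1) i1"
      using kid_len_le[OF i1(1)] by (simp add: left_diff_distrib)
    then show "len m j - (1 - Q) * (len m j - len (m + 1) i1) \<le> len m j - (1 - Q) * ((1 - rho) * len m j)"
      using Q by (intro diff_left_mono mult_left_mono) auto
  qed simp
  also have "\<dots> = ?N * len m j * (1 - (1 - Q) * (1 - rho))" by algebra
  also have "(1 - Q) * (1 - rho) = 1 / CL" by (simp add: CL_def Q_def)
  finally have 1: "(\<Sum>i\<in>kids m j. mass (m + 1) i powr \<alpha> * len (m + 1) i) \<le> ?N * len m j * (1 - 1 / CL)" .
  have "(\<Sum>p\<in>desc (Suc n) m j. w p powr \<alpha> * len (fst p) (snd p))
      \<le> ?N * len m j + (\<Sum>i\<in>kids m j. CL * mass (m + 1) i powr \<alpha> * len (m + 1) i)"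
    unfolding sum_desc_Suc fst_conv snd_conv
  proof (rule add_mono)
    show "w (m, j) powr \<alpha> * len m j \<le> ?N * len m j"
      using w_nonneg w_le_mass alpha by (intro mult_right_mono powr_mono2) auto
  qed (rule sum_mono, rule Suc.IH)
  also have "\<dots> = ?N * len m j + CL * (\<Sum>i\<in>kids m j. mass (m + 1) i powr \<alpha> * len (m + 1) i)"
    by (simp add: sum_distrib_left mult.assoc)
  also have "\<dots> \<le> ?N * len m j + CL * (?N * len m j * (1 - 1 / CL))"
    using 1 CL_pos by (intro add_left_mono mult_left_mono) auto
  also have "\<dots> = CL * ?N * len m j"
  proof -
    have "CL * (1 - 1 / CL) = CL - 1" using CL_pos by (simp add: right_diff_distrib)
    then show ?thesis by algebra
  qed
  finally show ?case .
qed

definition CS :: real where "CS = CL + 1 / (1 - rho)"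

lemma CS_pos: "0 < CS"
  using CL_pos rho_bounds by (simp add: CS_def add_pos_pos)

text \<open>At a selected cell the term is absent and the bounds of the children add up. At a
  discarded cell one child \<open>i0\<close> is handled by induction with \<open>CS\<close>, while
  the others have total mass below \<theta> and fall under \<open>light_bound\<close> with the
  smaller \<open>CL\<close>. They cover at least the fraction \<open>1 - rho\<close> of the cell, so
  the difference \<open>CS - CL = 1 / (1 - rho)\<close> pays for the term of the cell
  itself.\<close>

lemma unselected_carleson:
  "(\<Sum>p\<in>desc n m j - selected. w p powr \<alpha> * len (fst p) (snd p)) \<le> CS * \<theta> powr \<alpha> * len m j"
proof -
  let ?g = "\<lambda>p. w p powr \<alpha> * len (fst p) (snd p)"
  let ?h = "\<lambda>p. if p \<in> selected then 0 else ?g p"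
  let ?T = "\<theta> powr \<alpha>"
  have "sum ?h (desc n m j) \<le> CS * ?T * len m j"
  proof (induction n arbitrary: m j)
    case 0
    then show ?case using CS_pos by simp
  next
    case (Suc n)
    have fk: "finite (kids m j)" by (rule kids_card)
    show ?case
    proof (cases "(m, j) \<in> selected")
      case True
      then have "sum ?h (desc (Suc n) m j) \<le> (\<Sum>i\<in>kids m j. CS * ?T * len (m + 1) i)"
        unfolding sum_desc_Suc using Suc.IH by (simp add: sum_mono)
      also have "\<dots> = CS * ?T * len m j" by (simp add: sum_distrib_left[symmetric] sum_kids_len)
      finally show ?thesis .
    next
      case False
      then obtain i0 where i0: "i0 \<in> kids m j" "mass m j - mass (m + 1) i0 < \<theta>"
        by (force simp: selected_def)
      have split: "(\<Sum>i\<in>kids m j. g i) = g i0 + (\<Sum>i\<in>kids m j - {i0}. g i)" for g :: "int \<Rightarrow> real"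
        using i0 fk by (simp add: sum.remove)
      have lsplit: "(\<Sum>i\<in>kids m j - {i0}. len (m + 1) i) = len m j - len (m + 1) i0"
        using split[of "len (m + 1)"] sum_kids_len[of m j] by linarith
      have tot: "w (m, j) + (\<Sum>i\<in>kids m j - {i0}. mass (m + 1) i) < \<theta>"
        using mass_superadditive[of m j] split[of "mass (m + 1)"] i0 by linarith
      have pos: "0 \<le> (\<Sum>i\<in>kids m j - {i0}. mass (m + 1) i)" by (intro sum_nonneg mass_nonneg)
      have w: "w (m, j) powr \<alpha> \<le> ?T"
        using tot pos w_nonneg alpha by (intro powr_mono2) auto
      have other: "sum ?h (desc n (m + 1) i) \<le> CL * ?T * len (m + 1) i" if i: "i \<in> kids m j - {i0}" for i
      proof -
        have "mass (m + 1) i \<le> (\<Sum>i\<in>kids m j - {i0}. mass (m + 1) i)"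
          using i fk by (intro member_le_sum) (auto intro: mass_nonneg)
        then have "mass (m + 1) i \<le> \<theta>" using tot w_nonneg[of "(m, j)"] by linarith
        then have N: "mass (m + 1) i powr \<alpha> \<le> ?T" using alpha mass_nonneg by (intro powr_mono2) auto
        have "sum ?h (desc n (m + 1) i) \<le> sum ?g (desc n (m + 1) i)" by (intro sum_mono) auto
        also have "\<dots> \<le> CL * mass (m + 1) i powr \<alpha> * len (m + 1) i" by (rule light_bound)
        also have "\<dots> \<le> CL * ?T * len (m + 1) i"
          using N CL_pos by (intro mult_right_mono mult_left_mono) auto
        finally show ?thesis .
      qed
      have "sum ?h (desc (Suc n) m j) \<le> ?T * len m j + (CS * ?T * len (m + 1) i0 + (\<Sum>i\<in>kids m j - {i0}. CL * ?T * len (m + 1) i))"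
        unfolding sum_desc_Suc split[of "\<lambda>i. sum ?h (desc n (m + 1) i)"]
        using w False Suc.IH[of "m + 1" i0] other by (intro add_mono sum_mono) (auto intro: mult_right_mono)
      also have "(\<Sum>i\<in>kids m j - {i0}. CL * ?T * len (m + 1) i) = CL * ?T * (len m j - len (m + 1) i0)"
        by (simp add: sum_distrib_left[symmetric] lsplit)
      also have "?T * len m j + (CS * ?T * len (m + 1) i0 + CL * ?T * (len m j - len (m + 1) i0))
          = CS * ?T * len m j + ?T * (len m j - (len m j - len (m + 1) i0) / (1 - rho))"
          by (simp add: CS_def divide_inverse algebra_simps)
      also have "\<dots> \<le> CS * ?T * len m j"
      proof -
        have "(1 - rho) * len m j \<le> len m j - len (m + 1) i0" using kid_len_le[OF i0(1)] by (simp add: algebra_simps)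
        then have "len m j \<le> (len m j - len (m + 1) i0) / (1 - rho)" using rho_bounds by (simp add: field_simps)
        then have "?T * (len m j - (len m j - len (m + 1) i0) / (1 - rho)) \<le> 0" by (intro mult_nonneg_nonpos) auto
        then show ?thesis by linarith
      qed
      finally show ?thesis .
    qed
  qed
  moreover have "sum ?h (desc n m j) = sum ?g (desc n m j - selected)"
    by (rule sum.mono_neutral_cong_right) auto
  ultimately show ?thesis by simp
qed

end

section \<open>Carleson conditions and mean oscillation\<close>

lemma locally_integrable_dist_measurable:
  assumes f: "locally_integrable f" and h: "h \<in> borel_measurable borel"
  shows "(\<lambda>y. ennreal (cmod (f y - h y)) * indicator {u..v} y) \<in> borel_measurable lebesgue"
proof -
  have 1: "(\<lambda>y. indicator {u..v} y *\<^sub>R f y) \<in> borel_measurable lebesgue"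
    using f by (intro borel_measurable_integrable) (simp add: locally_integrable_def set_integrable_def)
  have 2: "(\<lambda>y. indicator {u..v} y *\<^sub>R h y) \<in> borel_measurable lebesgue"
    using h by (intro measurable_completion) simp
  have "(\<lambda>y. ennreal (norm (indicator {u..v} y *\<^sub>R f y - indicator {u..v} y *\<^sub>R h y))) \<in> borel_measurable lebesgue"
    using 1 2 by measurable
  moreover have "(\<lambda>y. ennreal (norm (indicator {u..v} y *\<^sub>R f y - indicator {u..v} y *\<^sub>R h y)))
      = (\<lambda>y. ennreal (cmod (f y - h y)) * indicator {u..v} y)"
    by (auto simp: indicator_def)
  ultimately show ?thesis by (simp only:)
qed

text \<open>The average is an optimal constant up to the factor \<open>2\<close>, its distance from
  any \<kappa> being at most the mean of \<open>cmod (F y - \<kappa>)\<close>. So \<kappa> may be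
  chosen freely on each interval.\<close>

lemma bmo_norm_le:
  assumes F: "locally_integrable F" and C: "0 \<le> C"
    and hyp: "\<And>a b. a < b \<Longrightarrow> \<exists>\<kappa>. (\<integral>\<^sup>+y\<in>{a..b}. ennreal (cmod (F y - \<kappa>)) \<partial>lebesgue) \<le> ennreal (C * (b - a))"
  shows "bmo_norm F \<le> ennreal (2 * C)"
  unfolding bmo_norm_def
proof (rule SUP_least, clarify)
  fix a b :: real assume ab: "a < b"
  obtain \<kappa> where \<kappa>: "(\<integral>\<^sup>+y\<in>{a..b}. ennreal (cmod (F y - \<kappa>)) \<partial>lebesgue) \<le> ennreal (C * (b - a))"
    using hyp[OF ab] by blast
  let ?A = "avg F a b"
  have Fi: "set_integrable lebesgue {a..b} F" using F by (simp add: locally_integrable_def)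
  have ci: "set_integrable lebesgue {a..b} (\<lambda>y. c)" for c :: complex
    by (intro absolutely_integrable_continuous_real continuous_intros)
  have cint: "(LINT y:{a..b}|lebesgue. c) = (b - a) *\<^sub>R c" for c :: complex
    using ab by (simp add: set_lebesgue_integral_def)
  have di: "set_integrable lebesgue {a..b} (\<lambda>y. F y - \<kappa>)" by (rule set_integral_diff(1)[OF Fi ci])
  have m1: "(\<lambda>y. ennreal (cmod (F y - c)) * indicator {a..b} y) \<in> borel_measurable lebesgue" for c
    by (rule locally_integrable_dist_measurable[OF F]) simp
  have "(b - a) *\<^sub>R (?A - \<kappa>) = (LINT y:{a..b}|lebesgue. F y - \<kappa>)"
    using ab by (simp add: set_integral_diff(2)[OF Fi ci] cint avg_def scaleR_diff_right)
  then have "ennreal (cmod ((b - a) *\<^sub>R (?A - \<kappa>))) \<le> (\<integral>\<^sup>+y. ennreal (norm (indicator {a..b} y *\<^sub>R (F y - \<kappa>))) \<partial>lebesgue)"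
    using integral_norm_bound_ennreal[OF di[unfolded set_integrable_def]] by (simp add: set_lebesgue_integral_def)
  also have "\<dots> = (\<integral>\<^sup>+y\<in>{a..b}. ennreal (cmod (F y - \<kappa>)) \<partial>lebesgue)"
    by (intro nn_integral_cong) (auto simp: indicator_def)
  finally have "ennreal (cmod ((b - a) *\<^sub>R (?A - \<kappa>))) \<le> ennreal (C * (b - a))" using \<kappa> by (rule order_trans)
  then have Ak: "cmod (?A - \<kappa>) * (b - a) \<le> C * (b - a)" using ab C by (simp add: mult.commute)
  have "(\<integral>\<^sup>+y\<in>{a..b}. ennreal (cmod (F y - ?A)) \<partial>lebesgue)
      \<le> (\<integral>\<^sup>+y. (ennreal (cmod (F y - \<kappa>)) * indicator {a..b} y + ennreal (cmod (?A - \<kappa>)) * indicator {a..b} y) \<partial>lebesgue)"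
  proof (rule nn_integral_mono)
    fix y
    have "cmod (F y - ?A) \<le> cmod (F y - \<kappa>) + cmod (?A - \<kappa>)"
      by (metis norm_minus_commute norm_triangle_sub dist_norm dist_triangle2)
    then show "ennreal (cmod (F y - ?A)) * indicator {a..b} y \<le> ennreal (cmod (F y - \<kappa>)) * indicator {a..b} y + ennreal (cmod (?A - \<kappa>)) * indicator {a..b} y"
      by (auto simp: indicator_def ennreal_plus[symmetric] ennreal_leI simp del: ennreal_plus)
  qed
  also have "\<dots> = (\<integral>\<^sup>+y\<in>{a..b}. ennreal (cmod (F y - \<kappa>)) \<partial>lebesgue) + ennreal (cmod (?A - \<kappa>)) * ennreal (b - a)"
  proof (subst nn_integral_add[OF m1])
    show "(\<lambda>y. ennreal (cmod (?A - \<kappa>)) * indicator {a..b} y) \<in> borel_measurable lebesgue"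
      by (rule measurable_completion) measurable
  qed (use ab in \<open>simp add: nn_integral_cmult_indicator\<close>)
  also have "\<dots> \<le> ennreal (C * (b - a)) + ennreal (C * (b - a))"
    using \<kappa> Ak ab by (intro add_mono) (auto simp: ennreal_mult''[symmetric] intro: ennreal_leI)
  also have "\<dots> = ennreal (2 * C * (b - a))"
    using C ab by (simp add: ennreal_plus[symmetric] del: ennreal_plus)
  finally have "(\<integral>\<^sup>+y\<in>{a..b}. ennreal (cmod (F y - ?A)) \<partial>lebesgue) / ennreal (b - a) \<le> ennreal (2 * C * (b - a)) / ennreal (b - a)"
    by (rule divide_right_mono_ennreal)
  also have "\<dots> = ennreal (2 * C)" using ab C by (simp add: divide_ennreal)
  finally show "(\<integral>\<^sup>+y\<in>{a..b}. ennreal (cmod (F y - ?A)) \<partial>lebesgue) / ennreal (b - a) \<le> ennreal (2 * C)" .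
qed

lemma poly_nn_integral:
  assumes "a \<le> b"
  shows "(\<integral>\<^sup>+y\<in>{a..b}. ennreal (cmod (poly P (of_real y))) \<partial>lebesgue) = ennreal (integral {a..b} (\<lambda>y. cmod (poly P (of_real y))))"
proof -
  have "set_integrable lebesgue {a..b} (\<lambda>y. cmod (poly P (of_real y)))"
    by (intro absolutely_integrable_continuous_real continuous_intros)
  then have i: "integrable lebesgue (\<lambda>y. indicator {a..b} y *\<^sub>R cmod (poly P (of_real y)))"
    and e: "(LINT y:{a..b}|lebesgue. cmod (poly P (of_real y))) = integral {a..b} (\<lambda>y. cmod (poly P (of_real y)))"
    by (simp_all add: set_integrable_def set_lebesgue_integral_eq_integral(2))
  have "(\<integral>\<^sup>+y\<in>{a..b}. ennreal (cmod (poly P (of_real y))) \<partial>lebesgue) = (\<integral>\<^sup>+y. ennreal (indicator {a..b} y *\<^sub>R cmod (poly P (of_real y))) \<partial>lebesgue)"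
    by (intro nn_integral_cong) (auto simp: indicator_def)
  also have "\<dots> = ennreal (LINT y:{a..b}|lebesgue. cmod (poly P (of_real y)))"
    unfolding set_lebesgue_integral_def by (rule nn_integral_eq_integral[OF i]) auto
  finally show ?thesis by (simp add: e)
qed

text \<open>On \<open>[0, N]\<close> the polynomial minus its average has mean modulus at most the
  norm, whereas in the variable \<open>y / N\<close> its leading coefficient carries the factor
  \<open>N ^ d\<close>. For large \<open>N\<close> this forces \<open>d = 0\<close>.\<close>

lemma poly_BMO_const:
  assumes "bmo_norm (\<lambda>y. poly P (of_real y)) < \<infinity>"
  shows "degree P = 0"
proof (rule ccontr)
  assume nz: "degree P \<noteq> 0"
  define d where "d = degree P"
  obtain B where B: "bmo_norm (\<lambda>y. poly P (of_real y)) = ennreal B" "0 \<le> B"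
    using assms by (metis ennreal_cases infinity_ennreal_def less_irrefl)
  obtain C where C: "C > 0" "\<And>P u l. degree P \<le> d \<Longrightarrow> l > 0 \<Longrightarrow>
     local_norm d u l P \<le> C / l * integral {u..u + l} (\<lambda>x. norm (poly P (of_real x)))"
    using local_norm_integral_bound[of d] by blast
  have bound: "cmod (coeff P d) * N \<le> C * B" if N: "1 \<le> N" for N
  proof -
    define Q where "Q = P - [:avg (\<lambda>y. poly P (of_real y)) 0 N:]"
    have dQ: "degree Q \<le> d" unfolding Q_def d_def by (rule degree_diff_le) auto
    have "(\<integral>\<^sup>+y\<in>{0..N}. ennreal (cmod (poly Q (of_real y))) \<partial>lebesgue) / ennreal (N - 0) \<le> ennreal B"
      unfolding B(1)[symmetric] bmo_norm_def Q_def using N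
      by (intro SUP_upper2[of "(0, N)"]) auto
    then have "ennreal (integral {0..N} (\<lambda>y. cmod (poly Q (of_real y)))) / ennreal N \<le> ennreal B"
      using N by (simp add: poly_nn_integral)
    moreover have i0: "0 \<le> integral {0..N} (\<lambda>y. cmod (poly Q (of_real y)))"
      by (intro Henstock_Kurzweil_Integration.integral_nonneg poly_integrable) auto
    ultimately have 1: "integral {0..N} (\<lambda>y. cmod (poly Q (of_real y))) / N \<le> B"
      using N B by (simp add: divide_ennreal)
    have "cmod (coeff (pcompose Q [:of_real 0, of_real N:]) d) \<le> local_norm d 0 N Q"
      unfolding local_norm_def by (rule member_le_sum[where f="\<lambda>i. cmod (coeff (pcompose Q [:of_real 0, of_real N:]) i)"]) auto
    also have "\<dots> \<le> C / N * integral {0..0 + N} (\<lambda>y. cmod (poly Q (of_real y)))"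
      using C(2)[OF dQ, of N 0] N by simp
    also have "\<dots> \<le> C * B" using mult_left_mono[OF 1, of C] C(1) by simp
    finally have "cmod (coeff Q d) * N ^ d \<le> C * B"
      using N by (simp add: coeff_pcompose_linear norm_mult norm_power mult.commute)
    moreover have "coeff Q d = coeff P d" using nz by (simp add: Q_def d_def coeff_pCons split: nat.split)
    moreover have "N \<le> N ^ d" using N nz by (intro self_le_power) (auto simp: d_def)
    ultimately show ?thesis using mult_left_mono[of N "N ^ d" "cmod (coeff P d)"] by simp
  qed
  have c: "0 < cmod (coeff P d)" using nz by (auto simp: d_def)
  have "cmod (coeff P d) * (C * B / cmod (coeff P d) + 1) \<le> C * B"
    using C B c by (intro bound) (simp add: field_simps)
  then show False using c by (simp add: field_simps)
qed

section \<open>Oscillation of multilevel splines\<close>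

context multilevel_partition
begin

text \<open>Only the \<open>d + 1\<close> B-splines that can be nonzero at \<open>y\<close> are
  summed, so coefficients may be prescribed on a whole level without any question of
  convergence.\<close>

definition spl :: "nat \<Rightarrow> int \<Rightarrow> (int \<times> int \<Rightarrow> complex) \<Rightarrow> real \<Rightarrow> complex" where
  "spl d l \<beta> y = spline d (x l) (idx l y) (\<lambda>i. \<beta> (l, i)) y"

lemma bspline_support:
  assumes "\<not> (idx l y - int d \<le> j \<and> j \<le> idx l y)"
  shows "bspline d (x l) j y = 0"
proof (rule bspline_eq_0[OF knots_mono])
  show "y < x l j \<or> x l (j + int d + 1) \<le> y"
  proof (cases "j \<le> idx l y")
    case True
    then have "j + int d + 1 \<le> idx l y" using assms by linarith
    then show ?thesis by (simp add: le_idx_iff)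
  qed (simp add: le_idx_iff)
qed

lemma spl_sum:
  assumes "finite I" "{idx l y - int d..idx l y} \<subseteq> I"
  shows "spl d l \<beta> y = (\<Sum>j\<in>I. \<beta> (l, j) * of_real (bspline d (x l) j y))"
  unfolding spl_def spline_def using assms
  by (intro sum.mono_neutral_left) (auto simp: bspline_support)

lemma bspline_measurable [measurable]: "bspline d (x l) j \<in> borel_measurable borel"
proof (induction d arbitrary: j)
  case 0
  have "bspline 0 (x l) j = indicator {x l j..<x l (j + 1)}" by (auto simp: indicator_def)
  then show ?case by simp
next
  case (Suc d)
  have [measurable]: "bspline d (x l) i \<in> borel_measurable borel" for i by (rule Suc)
  have "bspline (Suc d) (x l) j = (\<lambda>y. (y - x l j) / (x l (j + int d + 1) - x l j) * bspline d (x l) j y +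
     (x l (j + int d + 2) - y) / (x l (j + int d + 2) - x l (j + 1)) * bspline d (x l) (j + 1) y)" by (rule ext) simp
  also have "\<dots> \<in> borel_measurable borel" by measurable
  finally show ?case .
qed

lemma idx_measurable: "idx l \<in> borel \<rightarrow>\<^sub>M count_space UNIV"
proof (subst measurable_count_space_eq2_countable)
  have "idx l -` {j} = {x l j..<x l (j + 1)}" for j
  proof (rule set_eqI)
    fix y
    show "y \<in> idx l -` {j} \<longleftrightarrow> y \<in> {x l j..<x l (j + 1)}"
      using idx_eq[of l j y] idx_lower[of l y] idx_upper[of y l] by (metis atLeastLessThan_iff singletonD singletonI vimage_eq)
  qed
  then show "idx l \<in> space borel \<rightarrow> UNIV \<and> (\<forall>a\<in>UNIV. idx l -` {a} \<inter> space borel \<in> sets borel)" by simp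
qed

lemma spl_measurable: "spl d l \<beta> \<in> borel_measurable borel"
proof -
  have "(\<lambda>y. spline d (x l) c (\<lambda>i. \<beta> (l, i)) y) \<in> borel_measurable borel" for c
    unfolding spline_def by measurable
  from measurable_compose_countable[OF this idx_measurable] show ?thesis
    by (simp add: spl_def[abs_def])
qed

lemma norm_spl_le:
  assumes "\<And>j. idx l y - int d \<le> j \<Longrightarrow> j \<le> idx l y \<Longrightarrow> cmod (\<beta> (l, j)) \<le> D"
  shows "cmod (spl d l \<beta> y) \<le> D"
proof -
  have "cmod (spl d l \<beta> y) \<le> (\<Sum>j = idx l y - int d..idx l y. D * bspline d (x l) j y)"
    unfolding spl_def spline_def using assms
    by (intro order_trans[OF norm_sum] sum_mono) (auto simp: norm_mult bspline_nonneg[OF knots_mono] intro: mult_right_mono)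
  also have "\<dots> = D" by (simp add: sum_distrib_left[symmetric] sum_bspline_eq_1[OF knots_mono])
  finally show ?thesis .
qed

text \<open>The cells strictly between those around \<open>a\<close> and \<open>b\<close> lie in
  \<open>[a, b]\<close> and have length at least \<open>len l j / lam\<close> each.\<close>

lemma idx_diff_le:
  assumes "a \<le> b"
  shows "real_of_int (idx l b - idx l a) \<le> 1 + lam * (b - a) / len l j"
proof (cases "idx l b \<le> idx l a")
  case True
  moreover have "0 \<le> lam * (b - a) / len l j" using assms lam by (intro divide_nonneg_nonneg) auto
  moreover have "real_of_int (idx l b - idx l a) \<le> 0" using True by simp
  ultimately show ?thesis by linarith
next
  case False
  have "real_of_int (idx l b - (idx l a + 1)) * (len l j / lam) = (\<Sum>r\<in>{idx l a + 1..<idx l b}. len l j / lam)"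
    using False by simp
  also have "\<dots> \<le> (\<Sum>r\<in>{idx l a + 1..<idx l b}. len l r)"
  proof (rule sum_mono)
    fix r show "len l j / lam \<le> len l r" using len_le[of l j r] lam by (simp add: field_simps)
  qed
  also have "\<dots> = x l (idx l b) - x l (idx l a + 1)" using False by (intro sum_len) auto
  also have "\<dots> \<le> b - a" using idx_lower[of l b] idx_upper[of a l] by linarith
  finally have "real_of_int (idx l b - (idx l a + 1)) \<le> (b - a) / (len l j / lam)"
    using lam by (subst pos_le_divide_eq) auto
  then show ?thesis by (simp add: mult.commute)
qed

lemma len_at_decay: "len (m + int n) (idx (m + int n) a) \<le> rho ^ n * len m (idx m a)"
  using desc_len_le[of m n "idx (m + int n) a"] idx_idx[of m "m + int n" a] by simp

text \<open>The length of the cell around \<open>a\<close> decays at least like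
  \<open>rho ^ n\<close> towards fine levels and grows accordingly towards coarse ones, so it passes
  \<open>h\<close> somewhere.\<close>

lemma scale_exists:
  assumes "0 < h"
  obtains m where "len (m + 1) (idx (m + 1) a) < h" "h \<le> len m (idx m a)"
proof -
  define s where "s m = len m (idx m a)" for m
  have "(\<lambda>n. rho ^ n) \<longlonglongrightarrow> 0" using rho_bounds by (intro LIMSEQ_realpow_zero) auto
  then have lim: "\<exists>n. rho ^ n < e" if "0 < e" for e
    using that by (metis LIMSEQ_iff diff_zero abs_less_iff real_norm_def order_refl)
  obtain n where n: "rho ^ n < h / s 0" using lim[of "h / s 0"] assms by (auto simp: s_def)
  obtain n' where n': "rho ^ n' < s 0 / h" using lim[of "s 0 / h"] assms by (auto simp: s_def)
  have "s (int n) \<le> rho ^ n * s 0" using len_at_decay[of 0 n a] by (simp add: s_def)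
  also have "\<dots> < h" using n by (simp add: s_def field_simps)
  finally have 1: "s (int n) < h" .
  have "s 0 \<le> rho ^ n' * s (- int n')" using len_at_decay[of "- int n'" n' a] by (simp add: s_def)
  moreover have "rho ^ n' * h < s 0" using n' assms by (simp add: field_simps)
  ultimately have "rho ^ n' * h \<le> rho ^ n' * s (- int n')" by linarith
  then have 2: "h \<le> s (- int n')" using rho_bounds by simp
  have "\<exists>i. - s i \<le> - h \<and> - h < - s (i + 1)"
    by (rule strict_mono_index_exists[of "\<lambda>i. - s i" "- int n'" _ "n + n'"]) (use 1 2 in auto)
  then show ?thesis using that by (auto simp: s_def)
qed

text \<open>The factor \<open>2 + real d + lam\<close> counts the cells of one level near an
  interval that is not much longer than they are; the two summands come from
  \<open>carleson_fine\<close> and \<open>carleson_coarse\<close>.\<close>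

definition CB :: "nat \<Rightarrow> real" where
  "CB d = (2 + real d + lam) * (real (d + 1) * lam\<^sup>2 + 4 ^ d * lam / (1 - rho))"

text \<open>Cells shorter than the interval: absolute values are integrated, a B-spline having
  integral at most the length of its support. All cells involved lie below a few cells of level
  \<open>m\<close>, to each of which the Carleson bound applies once.\<close>

lemma carleson_fine:
  assumes car: "\<And>n m j. (\<Sum>p\<in>desc n m j. cmod (\<beta> p) * len (fst p) (snd p)) \<le> A * len m j"
    and A: "0 \<le> A" and ab: "a < b" and s: "len m (idx m a) < b - a"
  shows "(\<integral>\<^sup>+y\<in>{a..b}. ennreal (cmod (\<Sum>l\<in>{m..hi}. spl d l \<beta> y)) \<partial>lborel)
     \<le> ennreal (real (d + 1) * lam\<^sup>2 * (2 + real d + lam) * A * (b - a))"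
proof -
  define I where "I l = {idx l a - int d..idx l b}" for l
  define F where "F = (SIGMA l:{m..hi}. I l)"
  define n where "n = nat (hi - m + 1)"
  have fF: "finite F" by (auto simp: F_def I_def)
  have pt: "cmod (\<Sum>l\<in>{m..hi}. spl d l \<beta> y) \<le> (\<Sum>p\<in>F. cmod (\<beta> p) * indicator {x (fst p) (snd p)..x (fst p) (snd p + int (d + 1))} y)"
    if y: "y \<in> {a..b}" for y
  proof -
    have "cmod (spl d l \<beta> y) \<le> (\<Sum>j\<in>I l. cmod (\<beta> (l, j)) * indicator {x l j..x l (j + int (d + 1))} y)" for l
    proof -
      have "{idx l y - int d..idx l y} \<subseteq> I l"
        using y idx_mono[of a y l] idx_mono[of y b l] by (auto simp: I_def)
      then have "spl d l \<beta> y = (\<Sum>j\<in>I l. \<beta> (l, j) * of_real (bspline d (x l) j y))"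
        by (intro spl_sum) (auto simp: I_def)
      also have "cmod \<dots> \<le> (\<Sum>j\<in>I l. cmod (\<beta> (l, j)) * indicator {x l j..x l (j + int (d + 1))} y)"
      proof (intro order_trans[OF norm_sum] sum_mono)
        fix j
        have "bspline d (x l) j y \<le> indicator {x l j..x l (j + int (d + 1))} y"
          using bspline_le_1[OF knots_mono, of d l j y] bspline_eq_0[OF knots_mono, of y l j d]
          by (auto simp: indicator_def ac_simps)
        then show "cmod (\<beta> (l, j) * of_real (bspline d (x l) j y)) \<le> cmod (\<beta> (l, j)) * indicator {x l j..x l (j + int (d + 1))} y"
          by (simp add: norm_mult bspline_nonneg[OF knots_mono] mult_left_mono)
      qed
      finally show ?thesis .
    qed
    then have "cmod (\<Sum>l\<in>{m..hi}. spl d l \<beta> y) \<le> (\<Sum>l\<in>{m..hi}. \<Sum>j\<in>I l. cmod (\<beta> (l, j)) * indicator {x l j..x l (j + int (d + 1))} y)"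
      by (intro order_trans[OF norm_sum] sum_mono)
    also have "\<dots> = (\<Sum>p\<in>F. cmod (\<beta> p) * indicator {x (fst p) (snd p)..x (fst p) (snd p + int (d + 1))} y)"
      unfolding F_def by (subst sum.Sigma) (auto simp: I_def split_beta)
    finally show ?thesis .
  qed
  have supp: "x l (j + int (d + 1)) - x l j \<le> real (d + 1) * lam * len l j" for l j
  proof -
    have "x l (j + int (d + 1)) - x l j = (\<Sum>r\<in>{j..<j + int (d + 1)}. len l r)" by (rule sum_len[symmetric]) simp
    also have "\<dots> \<le> (\<Sum>r\<in>{j..<j + int (d + 1)}. lam * len l j)" by (intro sum_mono len_le)
    also have "\<dots> = real (d + 1) * lam * len l j" by simp
    finally show ?thesis .
  qed
  have "(\<integral>\<^sup>+y\<in>{a..b}. ennreal (cmod (\<Sum>l\<in>{m..hi}. spl d l \<beta> y)) \<partial>lborel)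
     \<le> (\<integral>\<^sup>+y. (\<Sum>p\<in>F. ennreal (cmod (\<beta> p)) * indicator {x (fst p) (snd p)..x (fst p) (snd p + int (d + 1))} y) \<partial>lborel)"
  proof (rule nn_integral_mono)
    fix y
    have e: "(\<Sum>p\<in>F. ennreal (cmod (\<beta> p)) * indicator {x (fst p) (snd p)..x (fst p) (snd p + int (d + 1))} y)
        = ennreal (\<Sum>p\<in>F. cmod (\<beta> p) * indicator {x (fst p) (snd p)..x (fst p) (snd p + int (d + 1))} y)"
    proof -
      have "(\<Sum>p\<in>F. ennreal (cmod (\<beta> p)) * indicator {x (fst p) (snd p)..x (fst p) (snd p + int (d + 1))} y)
        = (\<Sum>p\<in>F. ennreal (cmod (\<beta> p) * indicator {x (fst p) (snd p)..x (fst p) (snd p + int (d + 1))} y))"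
        by (intro sum.cong refl) (simp add: indicator_def)
      then show ?thesis by (simp only: sum_ennreal mult_nonneg_nonneg norm_ge_zero indicator_pos_le)
    qed
    show "ennreal (cmod (\<Sum>l\<in>{m..hi}. spl d l \<beta> y)) * indicator {a..b} y
       \<le> (\<Sum>p\<in>F. ennreal (cmod (\<beta> p)) * indicator {x (fst p) (snd p)..x (fst p) (snd p + int (d + 1))} y)"
      unfolding e using pt[of y] by (cases "y \<in> {a..b}") (auto intro: ennreal_leI)
  qed
  also have "\<dots> = (\<Sum>p\<in>F. ennreal (cmod (\<beta> p)) * ennreal (x (fst p) (snd p + int (d + 1)) - x (fst p) (snd p)))"
    by (subst nn_integral_sum) (auto intro!: sum.cong simp: nn_integral_cmult_indicator)
  also have "\<dots> = ennreal (\<Sum>p\<in>F. cmod (\<beta> p) * (x (fst p) (snd p + int (d + 1)) - x (fst p) (snd p)))"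
    by (subst sum_ennreal[symmetric]) (auto simp: ennreal_mult intro!: sum.cong)
  also have "\<dots> \<le> ennreal (real (d + 1) * lam * ((2 + real d + lam) * lam * A * (b - a)))"
  proof (rule ennreal_leI)
    have "(\<Sum>p\<in>F. cmod (\<beta> p) * (x (fst p) (snd p + int (d + 1)) - x (fst p) (snd p)))
       \<le> (\<Sum>p\<in>F. cmod (\<beta> p) * (real (d + 1) * lam * len (fst p) (snd p)))"
      by (intro sum_mono mult_left_mono supp) auto
    also have "\<dots> = real (d + 1) * lam * (\<Sum>p\<in>F. cmod (\<beta> p) * len (fst p) (snd p))"
      by (simp add: sum_distrib_left ac_simps)
    also have "(\<Sum>p\<in>F. cmod (\<beta> p) * len (fst p) (snd p)) \<le> (2 + real d + lam) * lam * A * (b - a)"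
    proof -
      let ?R = "{idx m a - int d..idx m b}"
      \<comment> \<open>A B-spline that meets the interval may start up to \<open>d\<close> cells to
        the left of \<open>a\<close>. Since \<open>d\<close> steps on a fine level cross at most
        \<open>d\<close> coarse knots, its ancestor starts at most \<open>d\<close> cells to the
        left of that of \<open>a\<close>.\<close>
      have "F \<subseteq> (\<Union>r\<in>?R. desc n m r)"
      proof (clarsimp simp: F_def I_def)
        fix l j assume l: "m \<le> l" "l \<le> hi" and j: "idx l a - int d \<le> j" "j \<le> idx l b"
        have "idx m (x l j) \<le> idx m b" using j by (intro idx_mono) (simp add: le_idx_iff)
        moreover have "idx m a - int d \<le> idx m (x l j)"
        proof -
          have "idx m a = idx m (x l (idx l a))" by (rule idx_idx[OF l(1), symmetric])
          also have "\<dots> \<le> idx m (x l (j + int d))" using j by (intro idx_mono) simp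
          also have "\<dots> \<le> idx m (x l j) + int d" by (rule idx_shift_le[OF l(1)])
          finally show ?thesis by simp
        qed
        moreover have "(l, j) \<in> desc n m (idx m (x l j))" using l by (simp add: desc_def n_def)
        ultimately show "\<exists>r\<in>?R. (l, j) \<in> desc n m r" by (intro bexI[of _ "idx m (x l j)"]) auto
      qed
      then have "(\<Sum>p\<in>F. cmod (\<beta> p) * len (fst p) (snd p)) \<le> (\<Sum>p\<in>(\<Union>r\<in>?R. desc n m r). cmod (\<beta> p) * len (fst p) (snd p))"
        by (intro sum_mono2) auto
      also have "\<dots> = (\<Sum>r\<in>?R. \<Sum>p\<in>desc n m r. cmod (\<beta> p) * len (fst p) (snd p))"
        by (rule sum.UNION_disjoint) (auto dest: desc_disjoint)
      also have "\<dots> \<le> (\<Sum>r\<in>?R. A * (lam * len m (idx m a)))"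
        using A by (intro sum_mono order_trans[OF car] mult_left_mono len_le) auto
      also have "\<dots> = real (card ?R) * (A * (lam * len m (idx m a)))" by simp
      also have "\<dots> \<le> (2 + real d + lam * (b - a) / len m (idx m a)) * (A * (lam * len m (idx m a)))"
      proof (rule mult_right_mono)
        have "idx m a \<le> idx m b" using ab by (intro idx_mono) simp
        then have "real (card ?R) = real_of_int (idx m b - idx m a) + 1 + real d" by simp
        then show "real (card ?R) \<le> 2 + real d + lam * (b - a) / len m (idx m a)"
          using idx_diff_le[of a b m "idx m a"] ab by linarith
      qed (use A lam in simp)
      also have "\<dots> = A * lam * ((2 + real d) * len m (idx m a) + lam * (b - a))"
      proof -
        have "len m (idx m a) \<noteq> 0" using len_pos[of m "idx m a"] by linarith
        then show ?thesis by (simp add: field_simps)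
      qed
      also have "\<dots> \<le> A * lam * ((2 + real d) * (b - a) + lam * (b - a))"
        using A lam s by (intro mult_left_mono add_right_mono) auto
      finally show ?thesis by (simp add: algebra_simps)
    qed
    finally show "(\<Sum>p\<in>F. cmod (\<beta> p) * (x (fst p) (snd p + int (d + 1)) - x (fst p) (snd p)))
        \<le> real (d + 1) * lam * ((2 + real d + lam) * lam * A * (b - a))"
      using lam by (simp add: mult_left_mono)
  qed
  finally show ?thesis by (simp add: power2_eq_square mult.assoc mult.left_commute mult.commute)
qed

text \<open>Cells at least as long as the interval: on \<open>[a, b]\<close> a B-spline varies by at
  most \<open>4 ^ d * lam * (b - a) / len\<close>, and this ratio decays like
  \<open>rho ^ (m - l)\<close> towards coarse levels \<open>l\<close>. The geometric series makes
  the bound independent of \<open>lo\<close>.\<close>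

lemma carleson_coarse:
  assumes car: "\<And>p. cmod (\<beta> p) \<le> A" and d: "1 \<le> d"
    and A: "0 \<le> A" and ab: "a < b" and s: "b - a \<le> len m (idx m a)" and y: "y \<in> {a..b}"
  shows "cmod ((\<Sum>l\<in>{lo..m}. spl d l \<beta> y) - (\<Sum>l\<in>{lo..m}. spl d l \<beta> a))
     \<le> (2 + real d + lam) * (4 ^ d * lam / (1 - rho)) * A"
proof -
  define K where "K = (2 + real d + lam) * (A * (4 ^ d * lam))"
  have K0: "0 \<le> K" using A lam by (simp add: K_def)
  have lev: "cmod (spl d l \<beta> y - spl d l \<beta> a) \<le> K * rho ^ nat (m - l)" if l: "l \<le> m" for l
  proof -
    let ?s = "len l (idx l a)"
    define I where "I = {idx l a - int d..idx l b}"
    have e: "l + int (nat (m - l)) = m" using l by simp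
    have ms: "len m (idx m a) \<le> rho ^ nat (m - l) * ?s" using len_at_decay[of l "nat (m - l)" a] unfolding e .
    have ratio: "(b - a) / ?s \<le> rho ^ nat (m - l)" using ms s by (simp add: pos_divide_le_eq)
    have r1: "rho ^ nat (m - l) \<le> 1" using rho_bounds by (intro power_le_one) auto
    have min: "?s / lam \<le> x l (i + 1) - x l i" for i
      using len_le[of l "idx l a" i] lam by (simp add: cell_length_def field_simps)
    have "{idx l z - int d..idx l z} \<subseteq> I" if "z \<in> {a..b}" for z
      using that idx_mono[of a z l] idx_mono[of z b l] by (auto simp: I_def)
    then have "spl d l \<beta> z = (\<Sum>j\<in>I. \<beta> (l, j) * of_real (bspline d (x l) j z))" if "z \<in> {a..b}" for z
      using that by (intro spl_sum) (auto simp: I_def)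
    then have "spl d l \<beta> y - spl d l \<beta> a = (\<Sum>j\<in>I. \<beta> (l, j) * of_real (bspline d (x l) j y - bspline d (x l) j a))"
      using y ab by (simp add: sum_subtractf right_diff_distrib)
    also have "cmod \<dots> \<le> (\<Sum>j\<in>I. A * (4 ^ d * lam * ((b - a) / ?s)))"
    proof (intro order_trans[OF norm_sum] sum_mono)
      fix j
      obtain d' where d': "d = Suc d'" using d by (cases d) auto
      have "\<bar>bspline d (x l) j y - bspline d (x l) j a\<bar> \<le> 4 ^ d / (?s / lam) * \<bar>y - a\<bar>"
        unfolding d' by (rule bspline_lipschitz[OF knots_mono _ min]) (use lam in simp)
      also have "\<dots> \<le> 4 ^ d / (?s / lam) * (b - a)"
        using y lam by (intro mult_left_mono) auto
      finally have "\<bar>bspline d (x l) j y - bspline d (x l) j a\<bar> \<le> 4 ^ d * lam * ((b - a) / ?s)" by simp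
      then show "cmod (\<beta> (l, j) * of_real (bspline d (x l) j y - bspline d (x l) j a)) \<le> A * (4 ^ d * lam * ((b - a) / ?s))"
        unfolding norm_mult norm_of_real using A by (intro mult_mono car) auto
    qed
    also have "\<dots> = real (card I) * (A * (4 ^ d * lam * ((b - a) / ?s)))" by simp
    also have "\<dots> \<le> (2 + real d + lam) * (A * (4 ^ d * lam * rho ^ nat (m - l)))"
    proof (intro mult_mono mult_left_mono)
      have "idx l a \<le> idx l b" using ab by (intro idx_mono) simp
      then have "real (card I) = real_of_int (idx l b - idx l a) + 1 + real d" by (simp add: I_def)
      moreover have "lam * (b - a) / ?s \<le> lam * 1"
        unfolding times_divide_eq_right[symmetric]
        using mult_left_mono[OF order_trans[OF ratio r1], of lam] lam by simp
      ultimately show "real (card I) \<le> 2 + real d + lam"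
        using idx_diff_le[of a b l "idx l a"] ab by linarith
    qed (use ratio A lam rho_bounds ab in auto)
    finally show ?thesis by (simp add: K_def mult.assoc)
  qed
  have "cmod ((\<Sum>l\<in>{lo..m}. spl d l \<beta> y) - (\<Sum>l\<in>{lo..m}. spl d l \<beta> a)) \<le> (\<Sum>l\<in>{lo..m}. K * rho ^ nat (m - l))"
    unfolding sum_subtractf[symmetric] using lev by (intro order_trans[OF norm_sum] sum_mono) auto
  also have "\<dots> = K * (\<Sum>l\<in>{lo..m}. rho ^ nat (m - l))" by (simp add: sum_distrib_left)
  also have "(\<Sum>l\<in>{lo..m}. rho ^ nat (m - l)) = (\<Sum>n\<in>(\<lambda>l. nat (m - l)) ` {lo..m}. rho ^ n)"
    by (subst sum.reindex) (auto simp: inj_on_def)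
  also have "\<dots> \<le> (\<Sum>n. rho ^ n)"
    using rho_bounds by (intro sum_le_suminf summable_geometric) auto
  also have "(\<Sum>n. rho ^ n) = 1 / (1 - rho)" using rho_bounds by (intro suminf_geometric) auto
  finally have "cmod ((\<Sum>l\<in>{lo..m}. spl d l \<beta> y) - (\<Sum>l\<in>{lo..m}. spl d l \<beta> a)) \<le> K * (1 / (1 - rho))"
    using K0 by (simp add: mult_left_mono)
  then show ?thesis by (simp add: K_def mult.assoc mult.commute mult.left_commute)
qed

text \<open>The levels are split at the scale of the interval. The coarse part is nearly constant
  there, and its value at \<open>a\<close> serves as \<kappa>; the fine part is small in the
  mean.\<close>

lemma carleson_oscillation:
  assumes car: "\<And>n m j. (\<Sum>p\<in>desc n m j. cmod (\<beta> p) * len (fst p) (snd p)) \<le> A * len m j"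
    and A: "0 \<le> A" and ab: "a < b" and d: "1 \<le> d"
  shows "\<exists>\<kappa>. (\<integral>\<^sup>+y\<in>{a..b}. ennreal (cmod ((\<Sum>l\<in>{lo..hi}. spl d l \<beta> y) - \<kappa>)) \<partial>lebesgue) \<le> ennreal (CB d * A * (b - a))"
proof -
  obtain m where m: "len (m + 1) (idx (m + 1) a) < b - a" "b - a \<le> len m (idx m a)"
    using scale_exists[of "b - a" a] ab by auto
  \<comment> \<open>Truncated to the levels from \<open>lo\<close> to \<open>hi\<close>, because the
    splitting level \<open>m\<close> need not lie between them.\<close>
  define \<beta>' where "\<beta>' p = (if lo \<le> fst p \<and> fst p \<le> hi then \<beta> p else 0)" for p
  have b': "cmod (\<beta>' p) \<le> cmod (\<beta> p)" for p by (simp add: \<beta>'_def)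
  have car': "(\<Sum>p\<in>desc n m j. cmod (\<beta>' p) * len (fst p) (snd p)) \<le> A * len m j" for n m j
    by (rule order_trans[OF sum_mono car]) (auto intro: mult_right_mono b')
  have pt: "cmod (\<beta>' p) \<le> A" for p
  proof -
    have "desc (Suc 0) (fst p) (snd p) = {p}" by (simp add: desc_Suc)
    then have "cmod (\<beta>' p) * len (fst p) (snd p) \<le> A * len (fst p) (snd p)"
      using car'[where n = "Suc 0" and m = "fst p" and j = "snd p"] by simp
    then show ?thesis by (rule mult_right_le_imp_le) simp
  qed
  let ?f = "\<lambda>y. \<Sum>l\<in>{m + 1..hi}. spl d l \<beta>' y" and ?g = "\<lambda>y. \<Sum>l\<in>{lo..m}. spl d l \<beta>' y"
  have split: "(\<Sum>l\<in>{lo..hi}. spl d l \<beta> y) = ?g y + ?f y" for y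
  proof -
    have z: "spl d l \<beta>' y = (if lo \<le> l \<and> l \<le> hi then spl d l \<beta> y else 0)" for l
      by (auto simp: spl_def spline_def \<beta>'_def intro!: sum.neutral)
    have "?g y + ?f y = (\<Sum>l\<in>{lo..m} \<union> {m + 1..hi}. spl d l \<beta>' y)" by (rule sum.union_disjoint[symmetric]) auto
    also have "\<dots> = (\<Sum>l\<in>({lo..m} \<union> {m + 1..hi}) \<inter> {lo..hi}. spl d l \<beta> y)"
      unfolding z by (rule sum.mono_neutral_cong_right) auto
    also have "({lo..m} \<union> {m + 1..hi}) \<inter> {lo..hi} = {lo..hi}" by auto
    finally show ?thesis by simp
  qed
  let ?E = "(2 + real d + lam) * (4 ^ d * lam / (1 - rho)) * A"
  have E0: "0 \<le> ?E" using A lam rho_bounds by simp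
  have mf: "(\<lambda>y. ennreal E * indicator {a..b} y) \<in> borel_measurable lborel" for E by simp
  have "(\<integral>\<^sup>+y\<in>{a..b}. ennreal (cmod ((\<Sum>l\<in>{lo..hi}. spl d l \<beta> y) - ?g a)) \<partial>lborel)
     \<le> (\<integral>\<^sup>+y. (ennreal ?E * indicator {a..b} y + ennreal (cmod (?f y)) * indicator {a..b} y) \<partial>lborel)"
  proof (rule nn_integral_mono)
    fix y
    show "ennreal (cmod ((\<Sum>l\<in>{lo..hi}. spl d l \<beta> y) - ?g a)) * indicator {a..b} y
       \<le> ennreal ?E * indicator {a..b} y + ennreal (cmod (?f y)) * indicator {a..b} y"
    proof (cases "y \<in> {a..b}")
      case True
      have "(\<Sum>l\<in>{lo..hi}. spl d l \<beta> y) - ?g a = (?g y - ?g a) + ?f y" by (simp add: split)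
      then have "cmod ((\<Sum>l\<in>{lo..hi}. spl d l \<beta> y) - ?g a) \<le> ?E + cmod (?f y)"
        using carleson_coarse[where \<beta> = \<beta>' and lo = lo, OF pt d A ab m(2) True]
        by (simp only: order_trans[OF norm_triangle_ineq add_right_mono])
      then show ?thesis using True E0 by (simp add: ennreal_plus[symmetric] ennreal_leI del: ennreal_plus)
    qed simp
  qed
  also have "\<dots> = ennreal ?E * ennreal (b - a) + (\<integral>\<^sup>+y\<in>{a..b}. ennreal (cmod (?f y)) \<partial>lborel)"
  proof -
    have [measurable]: "spl d l \<beta>' \<in> borel_measurable borel" for l by (rule spl_measurable)
    show ?thesis using ab by (subst nn_integral_add) (auto simp: nn_integral_cmult_indicator)
  qed
  also have "\<dots> \<le> ennreal ?E * ennreal (b - a) + ennreal (real (d + 1) * lam\<^sup>2 * (2 + real d + lam) * A * (b - a))"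
    by (intro add_left_mono carleson_fine car' A ab m)
  also have "\<dots> = ennreal (?E * (b - a) + real (d + 1) * lam\<^sup>2 * (2 + real d + lam) * A * (b - a))"
  proof -
    have ba: "0 \<le> b - a" using ab by simp
    have "0 \<le> real (d + 1) * lam\<^sup>2 * (2 + real d + lam) * A * (b - a)" using A lam ba by simp
    then show ?thesis by (simp only: ennreal_mult[OF E0 ba] ennreal_plus[OF mult_nonneg_nonneg[OF E0 ba]])
  qed
  also have "?E * (b - a) + real (d + 1) * lam\<^sup>2 * (2 + real d + lam) * A * (b - a) = CB d * A * (b - a)"
    unfolding CB_def by algebra
  finally show ?thesis unfolding nn_integral_completion by blast
qed

end

section \<open>The multilevel spline decomposition\<close>

lemma spline_diff: "spline d t c (\<lambda>j. a j - b j) y = spline d t c a y - spline d t c b y"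
  by (simp add: spline_def left_diff_distrib sum_subtractf)

lemma sum_fibres_le:
  fixes g :: "'b \<Rightarrow> real"
  assumes g: "\<And>y. 0 \<le> g y" "g summable_on UNIV" and F: "finite F"
    and fib: "\<And>y. card {p \<in> F. \<phi> p = y} \<le> M"
  shows "(\<Sum>p\<in>F. g (\<phi> p)) \<le> real M * infsum g UNIV"
proof -
  have "(\<Sum>p\<in>F. g (\<phi> p)) = (\<Sum>y\<in>\<phi> ` F. \<Sum>p\<in>{p \<in> F. \<phi> p = y}. g (\<phi> p))"
    by (rule sum.image_gen[OF F])
  also have "\<dots> = (\<Sum>y\<in>\<phi> ` F. real (card {p \<in> F. \<phi> p = y}) * g y)"
    by (intro sum.cong) auto
  also have "\<dots> \<le> (\<Sum>y\<in>\<phi> ` F. real M * g y)"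
    using fib g(1) by (intro sum_mono mult_right_mono) auto
  also have "\<dots> = real M * sum g (\<phi> ` F)" by (simp add: sum_distrib_left)
  also have "\<dots> \<le> real M * infsum g UNIV"
    using g F by (intro mult_left_mono finite_sum_le_infsum) auto
  finally show ?thesis .
qed

context multilevel_partition
begin

lemma knot_dist:
  assumes "\<bar>i - i'\<bar> \<le> int n"
  shows "\<bar>x m i - x m i'\<bar> \<le> real n * lam * len m r"
proof -
  have main: "x m j' - x m j \<le> real n * lam * len m r" if "j \<le> j'" "j' - j \<le> int n" for j j'
  proof -
    have "x m j' - x m j = (\<Sum>s\<in>{j..<j'}. len m s)" by (rule sum_len[OF that(1), symmetric])
    also have "\<dots> \<le> (\<Sum>s\<in>{j..<j'}. lam * len m r)" by (intro sum_mono len_le)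
    also have "\<dots> = real_of_int (j' - j) * (lam * len m r)" using that by simp
    also have "\<dots> \<le> real n * (lam * len m r)"
      using that lam by (intro mult_right_mono) auto
    finally show ?thesis by simp
  qed
  show ?thesis
  proof (cases "i \<le> i'")
    case True
    then have "x m i \<le> x m i'" by simp
    moreover have "x m i' - x m i \<le> real n * lam * len m r" using True assms by (intro main) linarith+
    ultimately show ?thesis by linarith
  next
    case False
    then have "x m i' \<le> x m i" by simp
    moreover have "x m i - x m i' \<le> real n * lam * len m r" using False assms by (intro main) linarith+
    ultimately show ?thesis by linarith
  qed
qed

lemma refinement: "knot_refinement (x m) (x (m + 1)) (\<lambda>i. idx m (x (m + 1) i))"
  by unfold_locales (auto simp: knots_mono knot_next_level)

lemma M0_pos: "1 \<le> M0"
  using kids_card(2,3)[of 0 0] by linarith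

end

text \<open>\<open>e (m, j)\<close> is the error of \<open>P m j\<close> in units of the cell
  length. \<open>CN\<close> is a parameter rather than chosen inside, so that the constants derived
  from it depend neither on \<open>f\<close> nor on the knots.\<close>

locale spline_decomposition = multilevel_partition +
  fixes d :: nat and f :: "real \<Rightarrow> complex" and P :: "int \<Rightarrow> int \<Rightarrow> complex poly"
    and e :: "int \<times> int \<Rightarrow> real" and \<tau> CN :: real
  assumes d: "1 \<le> d" and f: "locally_integrable f" and degP: "\<And>m j. degree (P m j) \<le> d"
    and approx: "\<And>m j. (\<integral>\<^sup>+y\<in>{x m (j - int d)..x m (j + int d)}. ennreal (cmod (f y - poly (P m j) (of_real y))) \<partial>lebesgue)
        \<le> ennreal (e (m, j) * len m j)"
    and e_nonneg: "\<And>p. 0 \<le> e p" and tau: "0 < \<tau>" and e_summable: "(\<lambda>p. e p powr \<tau>) summable_on UNIV"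
    and CN: "0 < CN" "\<And>P u l. degree P \<le> d \<Longrightarrow> l > 0 \<Longrightarrow>
        local_norm d u l P \<le> CN / l * integral {u..u + l} (\<lambda>x. norm (poly P (of_real x)))"
begin

lemma dev_measurable:
  "(\<lambda>y. ennreal (cmod (f y - poly Q (of_real y))) * indicator {a..b} y) \<in> borel_measurable lebesgue"
  by (intro locally_integrable_dist_measurable[OF f] borel_measurable_continuous_onI continuous_intros)

text \<open>Two polynomials near \<open>f\<close> on a common interval are near each other there in
  L1, and \<open>CN\<close> turns this into a bound on coefficients.\<close>

lemma compare:
  assumes s: "0 < s" and 1: "{u..u + s} \<subseteq> {x m (j - int d)..x m (j + int d)}"
    and 2: "{u..u + s} \<subseteq> {x m' (j' - int d)..x m' (j' + int d)}"
  shows "local_norm d u s (P m j - P m' j') \<le> CN / s * (e (m, j) * len m j + e (m', j') * len m' j')"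
proof -
  let ?Q = "P m j - P m' j'"
  have dQ: "degree ?Q \<le> d" by (intro degree_diff_le degP)
  have "ennreal (integral {u..u + s} (\<lambda>y. cmod (poly ?Q (of_real y)))) = (\<integral>\<^sup>+y\<in>{u..u + s}. ennreal (cmod (poly ?Q (of_real y))) \<partial>lebesgue)"
    using s by (intro poly_nn_integral[symmetric]) simp
  also have "\<dots> \<le> (\<integral>\<^sup>+y. (ennreal (cmod (f y - poly (P m j) (of_real y))) * indicator {x m (j - int d)..x m (j + int d)} y
      + ennreal (cmod (f y - poly (P m' j') (of_real y))) * indicator {x m' (j' - int d)..x m' (j' + int d)} y) \<partial>lebesgue)"
  proof (rule nn_integral_mono)
    fix y
    have "cmod (poly ?Q (of_real y)) \<le> cmod (f y - poly (P m j) (of_real y)) + cmod (f y - poly (P m' j') (of_real y))"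
      using norm_triangle_ineq4[of "f y - poly (P m' j') (of_real y)" "f y - poly (P m j) (of_real y)"] by simp
    then show "ennreal (cmod (poly ?Q (of_real y))) * indicator {u..u + s} y
      \<le> ennreal (cmod (f y - poly (P m j) (of_real y))) * indicator {x m (j - int d)..x m (j + int d)} y
      + ennreal (cmod (f y - poly (P m' j') (of_real y))) * indicator {x m' (j' - int d)..x m' (j' + int d)} y"
      using 1 2 by (cases "y \<in> {u..u + s}") (auto simp: indicator_def ennreal_plus[symmetric] ennreal_leI simp del: ennreal_plus)
  qed
  also have "\<dots> \<le> ennreal (e (m, j) * len m j) + ennreal (e (m', j') * len m' j')"
    by (subst nn_integral_add) (auto intro: dev_measurable add_mono approx)
  also have "\<dots> = ennreal (e (m, j) * len m j + e (m', j') * len m' j')"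
    by (simp add: e_nonneg)
  finally have "integral {u..u + s} (\<lambda>y. cmod (poly ?Q (of_real y))) \<le> e (m, j) * len m j + e (m', j') * len m' j'"
    by (subst (asm) ennreal_le_iff) (intro add_nonneg_nonneg mult_nonneg_nonneg e_nonneg len_nonneg)
  then have "CN / s * integral {u..u + s} (\<lambda>y. cmod (poly ?Q (of_real y))) \<le> CN / s * (e (m, j) * len m j + e (m', j') * len m' j')"
    using CN(1) s by (intro mult_left_mono) auto
  then show ?thesis using CN(2)[OF dQ s, of u] by linarith
qed

lemma compare_same_level:
  assumes r: "j - int d \<le> r" "r < j + int d" "j' - int d \<le> r" "r < j' + int d"
  shows "local_norm d (x m r) (len m r) (P m j - P m j') \<le> CN * lam * (e (m, j) + e (m, j'))"
proof -
  have "{x m r..x m r + len m r} = {x m r..x m (r + 1)}" by (simp add: cell_length_def)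
  then have "local_norm d (x m r) (len m r) (P m j - P m j') \<le> CN / len m r * (e (m, j) * len m j + e (m, j') * len m j')"
    using r by (intro compare) (auto intro: order_trans)
  also have "\<dots> \<le> CN / len m r * (e (m, j) * (lam * len m r) + e (m, j') * (lam * len m r))"
    using CN(1) e_nonneg by (intro mult_left_mono add_mono len_le) auto
  also have "\<dots> = CN * lam * (e (m, j) + e (m, j'))"
  proof -
    have "len m r \<noteq> 0" using len_pos[of m r] by linarith
    then show ?thesis by (simp add: field_simps)
  qed
  finally show ?thesis .
qed

lemma compare_parent:
  assumes c: "idx m (x (m + 1) i) = c"
  shows "local_norm d (x (m + 1) i) (len (m + 1) i) (P (m + 1) i - P m c) \<le> CN * (e (m + 1, i) + real M0 * lam * e (m, c))"
proof -
  have sub: "{x (m + 1) i..x (m + 1) i + len (m + 1) i} = cell x (m + 1) i" by (simp add: cell_length_def cell_def)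
  have k: "i \<in> kids m c" using c by (simp add: kids_def)
  then have "cell x (m + 1) i \<subseteq> cell x m c" by (simp add: kids_iff)
  moreover have "cell x m c \<subseteq> {x m (c - int d)..x m (c + int d)}" using d by (auto simp: cell_def intro: order_trans)
  moreover have "cell x (m + 1) i \<subseteq> {x (m + 1) (i - int d)..x (m + 1) (i + int d)}" using d by (auto simp: cell_def intro: order_trans)
  ultimately have "local_norm d (x (m + 1) i) (len (m + 1) i) (P (m + 1) i - P m c)
      \<le> CN / len (m + 1) i * (e (m + 1, i) * len (m + 1) i + e (m, c) * len m c)"
    by (intro compare) (auto simp: sub)
  also have "\<dots> \<le> CN / len (m + 1) i * (e (m + 1, i) * len (m + 1) i + e (m, c) * (real M0 * lam * len (m + 1) i))"
    using CN(1) e_nonneg by (intro mult_left_mono add_left_mono kid_len_ge k) auto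
  also have "\<dots> = CN * (e (m + 1, i) + real M0 * lam * e (m, c))"
  proof -
    have "len (m + 1) i \<noteq> 0" using len_pos[of "m + 1" i] by linarith
    then show ?thesis by (simp add: field_simps)
  qed
  finally show ?thesis .
qed

text \<open>\<open>K1\<close> bounds, in cell lengths, the distance of knots at most
  \<open>d + 1\<close> steps apart. \<open>G\<close> combines \<open>polar_coeff_bound\<close> with
  \<open>compare_same_level\<close>. In \<open>CD\<close> the first term comes from the comparison
  of a cell with its parent, the second from refining the coefficient deviations on the parent
  level.\<close>

definition K1 :: real where "K1 = real (d + 1) * lam"
definition G :: real where "G = (K1 + 2) ^ d * CN * lam"
definition CD :: real where
  "CD = (K1 + 2) ^ d * CN * (real M0 * lam) + (2 * ((2 * real d * lam + 1) * lam)) ^ d * (2 * G)"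

lemma K1_nonneg: "0 \<le> K1"
  using lam by (simp add: K1_def)

lemma G_nonneg: "0 \<le> G"
  using K1_nonneg CN(1) lam by (simp add: G_def)

text \<open>A quasi-interpolant: every coefficient is taken from its own local polynomial.\<close>

definition a :: "int \<Rightarrow> int \<Rightarrow> complex" where "a m j = polar_coeff d (x m) (P m j) j"

definition b :: "int \<times> int \<Rightarrow> complex" where
  "b p = (case p of (m, i) \<Rightarrow> a m i - refine_coeff d (x (m - 1)) (x m) (\<lambda>i. idx (m - 1) (x m i)) (a (m - 1)) i)"

definition T :: "int \<Rightarrow> real \<Rightarrow> complex" where "T m y = spl d m (\<lambda>(l, i). a l i) y"

text \<open>The comparison is made on the cell \<open>c - 1\<close>, which lies in the windows of
  \<open>P m c\<close> and of every \<open>P m j\<close> in question. The cell \<open>c\<close>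
  would not do: for \<open>j = c - d\<close> the window ends at \<open>x m c\<close>.\<close>

lemma coeff_deviation:
  assumes "c - int d \<le> j" "j \<le> c"
  shows "cmod (a m j - polar_coeff d (x m) (P m c) j) \<le> G * (e (m, j) + e (m, c))"
proof -
  have "cmod (polar_coeff d (x m) (P m j - P m c) j) \<le> (K1 + 2) ^ d * local_norm d (x m (c - 1)) (len m (c - 1)) (P m j - P m c)"
  proof (rule polar_coeff_bound[OF _ len_pos K1_nonneg])
    show "degree (P m j - P m c) \<le> d" by (intro degree_diff_le degP)
    fix r assume "1 \<le> r" "r \<le> d"
    then show "\<bar>x m (j + int r) - x m (c - 1)\<bar> \<le> K1 * len m (c - 1)"
      unfolding K1_def using assms by (intro knot_dist) auto
  qed
  also have "\<dots> \<le> (K1 + 2) ^ d * (CN * lam * (e (m, j) + e (m, c)))"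
    using assms d K1_nonneg by (intro mult_left_mono compare_same_level) auto
  finally show ?thesis by (simp add: a_def polar_coeff_diff G_def mult.assoc)
qed

text \<open>Splines reproduce the polynomial of the cell around \<open>y\<close>, so the difference
  is a spline whose active coefficients are the deviations bounded in
  \<open>coeff_deviation\<close>.\<close>

lemma T_eq_poly_dev:
  "cmod (T m y - poly (P m (idx m y)) (of_real y)) \<le> 2 * G * (\<Sum>s\<le>d. e (m, idx m y - int s))"
proof -
  let ?c = "idx m y" and ?S = "\<Sum>s\<le>d. e (m, idx m y - int s)"
  have mem: "e (m, j) \<le> ?S" if "?c - int d \<le> j" "j \<le> ?c" for j
  proof -
    have "j = ?c - int (nat (?c - j))" "nat (?c - j) \<in> {..d}" using that by auto
    then show ?thesis using member_le_sum[of "nat (?c - j)" "{..d}" "\<lambda>s. e (m, ?c - int s)"] e_nonneg by auto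
  qed
  define \<beta> where "\<beta> p = (case p of (l, i) \<Rightarrow> a l i - polar_coeff d (x m) (P m ?c) i)" for p
  have "poly (P m ?c) (of_real y) = spline d (x m) ?c (polar_coeff d (x m) (P m ?c)) y"
    by (rule spline_polar_coeff[symmetric]) (auto simp: knots_mono degP)
  then have "T m y - poly (P m ?c) (of_real y) = spl d m \<beta> y"
    by (simp add: T_def spl_def \<beta>_def spline_diff)
  moreover have "cmod (spl d m \<beta> y) \<le> 2 * G * ?S"
  proof (rule norm_spl_le)
    fix j assume j: "?c - int d \<le> j" "j \<le> ?c"
    have "cmod (\<beta> (m, j)) \<le> G * (e (m, j) + e (m, ?c))" unfolding \<beta>_def using coeff_deviation[OF j] by simp
    also have "\<dots> \<le> G * (?S + ?S)" using mem[OF j] mem[of ?c] G_nonneg by (intro mult_left_mono add_mono) auto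
    finally show "cmod (\<beta> (m, j)) \<le> 2 * G * ?S" by simp
  qed
  ultimately show ?thesis by simp
qed

lemma T_step: "T (m + 1) y - T m y = spl d (m + 1) b y"
proof -
  interpret knot_refinement "x m" "x (m + 1)" "\<lambda>i. idx m (x (m + 1) i)" by (rule refinement)
  have "T m y = spline d (x m) (idx m (x (m + 1) (idx (m + 1) y))) (a m) y"
    using idx_idx[of m "m + 1" y] by (simp add: T_def spl_def)
  also have "\<dots> = spline d (x (m + 1)) (idx (m + 1) y) (refine_coeff d (x m) (x (m + 1)) (\<lambda>i. idx m (x (m + 1) i)) (a m)) y"
    by (rule spline_refine[symmetric]) auto
  finally show ?thesis by (simp add: T_def spl_def b_def spline_diff)
qed

lemma T_telescope:
  assumes "lo \<le> hi"
  shows "T hi y - T lo y = (\<Sum>l\<in>{lo + 1..hi}. spl d l b y)"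
  using assms
proof (induction hi rule: int_ge_induct)
  case (step hi)
  have "{lo + 1..hi + 1} = insert (hi + 1) {lo + 1..hi}" using step.hyps by auto
  then show ?case using step.IH T_step[of hi y] by (simp add: algebra_simps)
qed simp

definition E :: "int \<Rightarrow> int \<Rightarrow> real" where
  "E m i = e (m, i) + (\<Sum>s\<le>d. e (m - 1, idx (m - 1) (x m i) - int s))"

text \<open>The polynomial of the parent \<open>c\<close> is subtracted on both levels, which is
  allowed because refinement maps its coarse coefficients to its fine ones. What remains is the
  blossom of a difference of two local polynomials and a refinement of coefficient
  deviations.\<close>

lemma b_bound: "cmod (b (m, i)) \<le> CD * E m i"
proof -
  define m' where "m' = m - 1"
  have m: "m = m' + 1" by (simp add: m'_def)
  interpret knot_refinement "x m'" "x m" "\<lambda>i. idx m' (x m i)" unfolding m by (rule refinement)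
  define c where "c = idx m' (x m i)"
  let ?S = "\<Sum>s\<le>d. e (m', c - int s)"
  have mem: "e (m', j) \<le> ?S" if "c - int d \<le> j" "j \<le> c" for j
  proof -
    have "j = c - int (nat (c - j))" "nat (c - j) \<in> {..d}" using that by auto
    then show ?thesis using member_le_sum[of "nat (c - j)" "{..d}" "\<lambda>s. e (m', c - int s)"] e_nonneg by auto
  qed
  let ?R = "refine_coeff d (x m') (x m) (\<lambda>i. idx m' (x m i))"
  have b: "b (m, i) = polar_coeff d (x m) (P m i - P m' c) i - ?R (\<lambda>j. a m' j - polar_coeff d (x m') (P m' c) j) i"
    by (simp add: b_def a_def[of m] m'_def[symmetric] refine_coeff_diff refine_coeff_polar_coeff polar_coeff_diff)
  have 1: "cmod (polar_coeff d (x m) (P m i - P m' c) i) \<le> (K1 + 2) ^ d * CN * (real M0 * lam) * (e (m, i) + ?S)"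
  proof -
    have "cmod (polar_coeff d (x m) (P m i - P m' c) i) \<le> (K1 + 2) ^ d * local_norm d (x m i) (len m i) (P m i - P m' c)"
    proof (rule polar_coeff_bound[OF _ len_pos K1_nonneg])
      show "degree (P m i - P m' c) \<le> d" by (intro degree_diff_le degP)
      fix r assume "1 \<le> r" "r \<le> d"
      then show "\<bar>x m (i + int r) - x m i\<bar> \<le> K1 * len m i"
        unfolding K1_def by (intro knot_dist) auto
    qed
    also have "\<dots> \<le> (K1 + 2) ^ d * (CN * (e (m, i) + real M0 * lam * e (m', c)))"
      using K1_nonneg compare_parent[of m' i c] by (intro mult_left_mono) (auto simp: m c_def)
    also have "\<dots> \<le> (K1 + 2) ^ d * (CN * (real M0 * lam * e (m, i) + real M0 * lam * ?S))"
    proof -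
      have "1 \<le> real M0 * lam" using M0_pos lam mult_mono[of 1 "real M0" 1 lam] by simp
      then have "e (m, i) \<le> real M0 * lam * e (m, i)" using e_nonneg[of "(m, i)"] mult_right_mono[of 1 "real M0 * lam" "e (m, i)"] by simp
      moreover have "e (m', c) \<le> ?S" by (rule mem) auto
      then have "real M0 * lam * e (m', c) \<le> real M0 * lam * ?S" using lam by (intro mult_left_mono) simp_all
      ultimately show ?thesis using K1_nonneg CN(1) by (intro mult_left_mono[OF mult_left_mono[OF add_mono]]) auto
    qed
    finally show ?thesis by (simp only: distrib_left mult.assoc)
  qed
  have 2: "cmod (?R (\<lambda>j. a m' j - polar_coeff d (x m') (P m' c) j) i) \<le> (2 * ((2 * real d * lam + 1) * lam)) ^ d * (2 * G * ?S)"
  proof (rule refine_coeff_bound[where l = "len m' c / lam"])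
    show "strict_mono (x m')" by (rule knots_mono)
    show "0 < len m' c / lam" using lam by simp
    show "len m' c / lam \<le> x m' (j + 1) - x m' j" for j
      using len_le[of m' c j] lam by (simp add: cell_length_def field_simps)
    show "0 \<le> (2 * real d * lam + 1) * lam" using lam by simp
    show "\<bar>x m (i + int r) - x m' j\<bar> \<le> (2 * real d * lam + 1) * lam * (len m' c / lam)"
      if "1 \<le> r" "r \<le> d" "idx m' (x m i) - int d \<le> j" "j \<le> idx m' (x m i) + int d" for r j
    proof -
      have k: "i \<in> kids m' c" by (simp add: kids_def c_def m)
      have "\<bar>x m (i + int r) - x m i\<bar> \<le> real d * lam * len m i" using that by (intro knot_dist) auto
      also have "\<dots> \<le> real d * lam * len m' c"
      proof (rule mult_left_mono)
        have "len m i \<le> rho * len m' c" using kid_len_le[OF k] by (simp add: m)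
        also have "\<dots> \<le> 1 * len m' c" using rho_bounds by (intro mult_right_mono) auto
        finally show "len m i \<le> len m' c" by simp
      qed (use lam in simp)
      moreover have "\<bar>x m i - x m' c\<bar> \<le> len m' c"
        unfolding c_def cell_length_def using idx_lower[of m' "x m i"] idx_upper[of "x m i" m'] by linarith
      moreover have "\<bar>x m' c - x m' j\<bar> \<le> real d * lam * len m' c" using that by (intro knot_dist) (auto simp: c_def)
      ultimately have "\<bar>x m (i + int r) - x m' j\<bar> \<le> real d * lam * len m' c + len m' c + real d * lam * len m' c" by linarith
      then show ?thesis using lam by (simp add: algebra_simps)
    qed
    show "cmod (a m' j - polar_coeff d (x m') (P m' c) j) \<le> 2 * G * ?S"
      if "idx m' (x m i) - int d \<le> j" "j \<le> idx m' (x m i)" for j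
    proof -
      have j: "c - int d \<le> j" "j \<le> c" using that by (auto simp: c_def)
      have "cmod (a m' j - polar_coeff d (x m') (P m' c) j) \<le> G * (e (m', j) + e (m', c))"
        by (rule coeff_deviation[OF j])
      also have "\<dots> \<le> G * (?S + ?S)" using mem[OF j] mem[of c] G_nonneg by (intro mult_left_mono add_mono) auto
      finally show ?thesis by simp
    qed
  qed
  let ?D = "(2 * ((2 * real d * lam + 1) * lam)) ^ d * (2 * G)"
  have D0: "0 \<le> ?D" using lam G_nonneg by simp
  have "cmod (b (m, i)) \<le> (K1 + 2) ^ d * CN * (real M0 * lam) * (e (m, i) + ?S) + ?D * ?S"
    unfolding b using norm_triangle_ineq4 1 2 by (smt (verit) mult.assoc)
  also have "\<dots> \<le> (K1 + 2) ^ d * CN * (real M0 * lam) * (e (m, i) + ?S) + ?D * (e (m, i) + ?S)"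
    using D0 e_nonneg by (intro add_left_mono mult_left_mono) auto
  also have "\<dots> = CD * E m i" by (simp add: CD_def E_def m'_def c_def algebra_simps)
  finally show ?thesis .
qed

definition CE :: real where
  "CE = CD powr \<tau> * real (d + 2) powr \<tau> * (1 + real (d + 1) * real M0)"

text \<open>A coarse error enters the bounds of at most \<open>(d + 1) * M0\<close> coefficients:
  there are \<open>d + 1\<close> shifts \<open>s\<close>, and each leads to at most
  \<open>M0\<close> children.\<close>

lemma b_sum_bound:
  assumes F: "finite F"
  shows "(\<Sum>p\<in>F. cmod (b p) powr \<tau>) \<le> CE * (\<Sum>\<^sub>\<infinity>p. e p powr \<tau>)"
proof -
  let ?I = "\<Sum>\<^sub>\<infinity>p. e p powr \<tau>"
  define \<phi> where "\<phi> s p = (case p of (m, i) \<Rightarrow> (m - 1, idx (m - 1) (x m i) - int s))" for s and p :: "int \<times> int"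
  have pt: "cmod (b p) powr \<tau> \<le> CD powr \<tau> * real (d + 2) powr \<tau> * (e p powr \<tau> + (\<Sum>s\<le>d. e (\<phi> s p) powr \<tau>))" for p
  proof -
    obtain m i where p: "p = (m, i)" by (cases p)
    define v where "v s = (case s of 0 \<Rightarrow> e p | Suc s \<Rightarrow> e (\<phi> s p))" for s
    have v: "(\<Sum>s\<le>Suc d. g (v s)) = g (e p) + (\<Sum>s\<le>d. g (e (\<phi> s p)))" for g :: "real \<Rightarrow> real"
      by (subst sum.atMost_Suc_shift) (simp add: v_def)
    have E: "E m i = (\<Sum>s\<le>Suc d. v s)" using v[of "\<lambda>x. x"] by (simp add: E_def \<phi>_def p)
    have v0: "0 \<le> v s" for s by (simp add: v_def e_nonneg split: nat.split)
    have "cmod (b p) powr \<tau> \<le> (CD * E m i) powr \<tau>"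
      using b_bound[of m i] tau by (intro powr_mono2) (auto simp: p)
    also have "\<dots> = CD powr \<tau> * (\<Sum>s\<le>Suc d. v s) powr \<tau>"
      unfolding E by (rule powr_mult)
    also have "\<dots> \<le> CD powr \<tau> * (real (card {..Suc d}) powr \<tau> * (\<Sum>s\<le>Suc d. v s powr \<tau>))"
      using v0 tau by (intro mult_left_mono sum_powr_le) auto
    also have "(\<Sum>s\<le>Suc d. v s powr \<tau>) = e p powr \<tau> + (\<Sum>s\<le>d. e (\<phi> s p) powr \<tau>)" by (rule v)
    finally show ?thesis by (simp add: mult.assoc)
  qed
  have fib: "(\<Sum>p\<in>F. e (\<phi> s p) powr \<tau>) \<le> real M0 * ?I" for s
  proof (rule sum_fibres_le[OF _ e_summable F])
    fix y :: "int \<times> int"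
    obtain m' j' where y: "y = (m', j')" by (cases y)
    have "{p \<in> F. \<phi> s p = y} \<subseteq> Pair (m' + 1) ` kids m' (j' + int s)"
      by (auto simp: \<phi>_def y kids_def)
    then have "card {p \<in> F. \<phi> s p = y} \<le> card (Pair (m' + 1) ` kids m' (j' + int s))"
      by (intro card_mono finite_imageI kids_card)
    also have "\<dots> \<le> card (kids m' (j' + int s))" by (intro card_image_le kids_card)
    also have "\<dots> \<le> M0" by (rule kids_card)
    finally show "card {p \<in> F. \<phi> s p = y} \<le> M0" .
  qed simp
  have "(\<Sum>p\<in>F. cmod (b p) powr \<tau>) \<le> (\<Sum>p\<in>F. CD powr \<tau> * real (d + 2) powr \<tau> * (e p powr \<tau> + (\<Sum>s\<le>d. e (\<phi> s p) powr \<tau>)))"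
    by (rule sum_mono) (rule pt)
  also have "\<dots> = CD powr \<tau> * real (d + 2) powr \<tau> * ((\<Sum>p\<in>F. e p powr \<tau>) + (\<Sum>s\<le>d. \<Sum>p\<in>F. e (\<phi> s p) powr \<tau>))"
  proof -
    have sw: "(\<Sum>s\<le>d. \<Sum>p\<in>F. e (\<phi> s p) powr \<tau>) = (\<Sum>p\<in>F. \<Sum>s\<le>d. e (\<phi> s p) powr \<tau>)"
      by (rule sum.swap)
    show ?thesis unfolding sw by (simp only: sum_distrib_left[symmetric] sum.distrib)
  qed
  also have "\<dots> \<le> CD powr \<tau> * real (d + 2) powr \<tau> * (?I + (\<Sum>s\<le>d. real M0 * ?I))"
    using F by (intro mult_left_mono add_mono sum_mono fib finite_sum_le_infsum e_summable) auto
  also have "\<dots> = CE * ?I" by (simp add: CE_def algebra_simps)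
  finally show ?thesis .
qed

lemma b_summable: "(\<lambda>p. cmod (b p) powr \<tau>) summable_on UNIV"
  and b_infsum: "(\<Sum>\<^sub>\<infinity>p. cmod (b p) powr \<tau>) \<le> CE * (\<Sum>\<^sub>\<infinity>p. e p powr \<tau>)"
proof -
  show s: "(\<lambda>p. cmod (b p) powr \<tau>) summable_on UNIV"
    by (rule nonneg_bdd_above_summable_on) (auto intro!: bdd_aboveI2 b_sum_bound)
  show "(\<Sum>\<^sub>\<infinity>p. cmod (b p) powr \<tau>) \<le> CE * (\<Sum>\<^sub>\<infinity>p. e p powr \<tau>)"
    by (rule infsum_le_finite_sums[OF s]) (rule b_sum_bound)
qed

end

section \<open>Limits of the decomposition\<close>

context spline_decomposition
begin

text \<open>Summability leaves finitely many values above \<epsilon>, hence none on levels far out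
  in either direction.\<close>

lemma e_small:
  assumes \<epsilon>: "0 < \<epsilon>"
  shows "\<exists>M. \<forall>m j. M \<le> \<bar>m\<bar> \<longrightarrow> e (m, j) \<le> \<epsilon>"
proof -
  define S where "S = {p. \<epsilon> < e p}"
  have "finite S \<and> card S \<le> nat \<lfloor>(\<Sum>\<^sub>\<infinity>p. e p powr \<tau>) / \<epsilon> powr \<tau>\<rfloor>"
  proof (rule finite_if_finite_subsets_card_bdd)
    fix F assume F: "F \<subseteq> S" "finite F"
    have "real (card F) * \<epsilon> powr \<tau> = (\<Sum>p\<in>F. \<epsilon> powr \<tau>)" by simp
    also have "\<dots> \<le> (\<Sum>p\<in>F. e p powr \<tau>)"
      using F \<epsilon> tau by (intro sum_mono powr_mono2) (auto simp: S_def)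
    also have "\<dots> \<le> (\<Sum>\<^sub>\<infinity>p. e p powr \<tau>)" using F by (intro finite_sum_le_infsum e_summable) auto
    finally have "real (card F) \<le> (\<Sum>\<^sub>\<infinity>p. e p powr \<tau>) / \<epsilon> powr \<tau>"
      using \<epsilon> by (subst pos_le_divide_eq) auto
    then show "card F \<le> nat \<lfloor>(\<Sum>\<^sub>\<infinity>p. e p powr \<tau>) / \<epsilon> powr \<tau>\<rfloor>" by (simp add: le_nat_floor)
  qed
  then have fin: "finite S" by simp
  define M where "M = Max (insert 0 ((\<lambda>p. \<bar>fst p\<bar>) ` S)) + 1"
  have "e (m, j) \<le> \<epsilon>" if "M \<le> \<bar>m\<bar>" for m j
  proof (rule ccontr)
    assume "\<not> e (m, j) \<le> \<epsilon>"
    then have "(m, j) \<in> S" by (simp add: S_def)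
    then have "\<bar>m\<bar> \<in> insert 0 ((\<lambda>p. \<bar>fst p\<bar>) ` S)" by force
    then have "\<bar>m\<bar> \<le> Max (insert 0 ((\<lambda>p. \<bar>fst p\<bar>) ` S))" using fin by (intro Max_ge) auto
    then show False using that by (simp add: M_def)
  qed
  then show ?thesis by blast
qed

definition emax :: real where "emax = (\<Sum>\<^sub>\<infinity>p. e p powr \<tau>) powr (1 / \<tau>)"

lemma e_le_emax: "e p \<le> emax"
proof -
  have "(\<Sum>p\<in>{p}. e p powr \<tau>) \<le> (\<Sum>\<^sub>\<infinity>p. e p powr \<tau>)"
    by (intro finite_sum_le_infsum e_summable) auto
  then have "(e p powr \<tau>) powr (1 / \<tau>) \<le> emax"
    unfolding emax_def using tau by (intro powr_mono2) auto
  then show ?thesis using tau e_nonneg[of p] by (simp add: powr_powr)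
qed

lemma T_measurable [measurable]: "T m \<in> borel_measurable borel"
proof -
  have "T m = spl d m (\<lambda>(l, i). a l i)" by (rule ext) (simp add: T_def)
  then show ?thesis by (simp add: spl_measurable)
qed

section \<open>Convergence at fine levels\<close>

lemma T_poly_dev_le:
  assumes "\<And>j. e (m, j) \<le> \<epsilon>"
  shows "cmod (T m y - poly (P m (idx m y)) (of_real y)) \<le> 2 * G * real (d + 1) * \<epsilon>"
proof -
  have "(\<Sum>s\<le>d. e (m, idx m y - int s)) \<le> real (card {..d}) * \<epsilon>"
    using assms by (intro sum_bounded_above) auto
  then have "2 * G * (\<Sum>s\<le>d. e (m, idx m y - int s)) \<le> 2 * G * (real (d + 1) * \<epsilon>)"
    using G_nonneg by (intro mult_left_mono) auto
  then show ?thesis using T_eq_poly_dev[of m y] by (simp add: mult.assoc)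
qed

text \<open>On each cell \<open>T m\<close> is uniformly close to the local polynomial, which is
  close to \<open>f\<close> in the mean; together this costs \<open>D * \<epsilon>'\<close> per unit
  length. \<open>L\<close> bounds the total length of the cells that meet \<open>[u, v]\<close>,
  with one cell sticking out at either end.\<close>

lemma T_to_f:
  assumes uv: "u < v" and \<epsilon>: "0 < \<epsilon>"
  shows "\<exists>M. \<forall>m\<ge>M. (\<integral>\<^sup>+y\<in>{u..v}. ennreal (cmod (f y - T m y)) \<partial>lebesgue) \<le> ennreal \<epsilon>"
proof -
  define D where "D = 1 + 2 * G * real (d + 1)"
  define L where "L = v - u + 2 * (lam * len 0 0)"
  have D: "0 < D" using G_nonneg by (simp add: D_def add_pos_nonneg)
  have L: "0 < L" using uv lam by (simp add: L_def add_pos_nonneg)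
  define \<epsilon>' where "\<epsilon>' = \<epsilon> / (D * L)"
  have \<epsilon>': "0 < \<epsilon>'" using D L \<epsilon> by (simp add: \<epsilon>'_def)
  obtain M where M: "\<And>m j. M \<le> \<bar>m\<bar> \<Longrightarrow> e (m, j) \<le> \<epsilon>'" using e_small[OF \<epsilon>'] by blast
  have "(\<integral>\<^sup>+y\<in>{u..v}. ennreal (cmod (f y - T m y)) \<partial>lebesgue) \<le> ennreal \<epsilon>" if m: "max M 0 \<le> m" for m
  proof -
    have em: "e (m, j) \<le> \<epsilon>'" for j using M[of m j] m by simp
    define C where "C = {idx m u..idx m v}"
    let ?K = "2 * G * real (d + 1) * \<epsilon>'"
    have K0: "0 \<le> ?K" using G_nonneg \<epsilon>' by simp
    have mc: "(\<lambda>y. ennreal ?K * indicator (cell x m c) y) \<in> borel_measurable lebesgue" for c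
      by (rule measurable_completion) (simp add: cell_def)
    have "(\<integral>\<^sup>+y\<in>{u..v}. ennreal (cmod (f y - T m y)) \<partial>lebesgue)
      \<le> (\<integral>\<^sup>+y. (\<Sum>c\<in>C. ennreal (cmod (f y - poly (P m c) (of_real y))) * indicator {x m (c - int d)..x m (c + int d)} y
            + ennreal ?K * indicator (cell x m c) y) \<partial>lebesgue)"
    proof (rule nn_integral_mono)
      fix y
      show "ennreal (cmod (f y - T m y)) * indicator {u..v} y
        \<le> (\<Sum>c\<in>C. ennreal (cmod (f y - poly (P m c) (of_real y))) * indicator {x m (c - int d)..x m (c + int d)} y
            + ennreal ?K * indicator (cell x m c) y)"
      proof (cases "y \<in> {u..v}")
        case True
        let ?c = "idx m y"
        let ?h = "\<lambda>c. ennreal (cmod (f y - poly (P m c) (of_real y))) * indicator {x m (c - int d)..x m (c + int d)} y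
            + ennreal ?K * indicator (cell x m c) y"
        have c: "?c \<in> C" using True by (simp add: C_def idx_mono)
        have "x m (?c - int d) \<le> x m ?c" "x m (?c + 1) \<le> x m (?c + int d)" using d by simp_all
        then have i1: "y \<in> {x m (?c - int d)..x m (?c + int d)}"
          using idx_lower[of m y] idx_upper[of y m] by (simp only: atLeastAtMost_iff) linarith
        have i2: "y \<in> cell x m ?c" using idx_upper[of y m] by (simp add: cell_def less_imp_le)
        have "cmod (f y - T m y) \<le> cmod (f y - poly (P m ?c) (of_real y)) + cmod (T m y - poly (P m ?c) (of_real y))"
          using norm_triangle_ineq4[of "f y - poly (P m ?c) (of_real y)" "T m y - poly (P m ?c) (of_real y)"] by simp
        also have "\<dots> \<le> cmod (f y - poly (P m ?c) (of_real y)) + ?K"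
          by (intro add_left_mono T_poly_dev_le em)
        finally have "ennreal (cmod (f y - T m y)) * indicator {u..v} y \<le> ?h ?c"
          using True i1 i2 K0 by (simp add: ennreal_plus[symmetric] ennreal_leI del: ennreal_plus)
        also have "\<dots> \<le> (\<Sum>c\<in>C. ?h c)" using c by (intro member_le_sum) (auto simp: C_def)
        finally show ?thesis .
      qed simp
    qed
    also have "\<dots> = (\<Sum>c\<in>C. (\<integral>\<^sup>+y\<in>{x m (c - int d)..x m (c + int d)}. ennreal (cmod (f y - poly (P m c) (of_real y))) \<partial>lebesgue)
        + ennreal ?K * ennreal (len m c))"
    proof (subst nn_integral_sum)
      show "(\<lambda>y. ennreal (cmod (f y - poly (P m c) (of_real y))) * indicator {x m (c - int d)..x m (c + int d)} y
            + ennreal ?K * indicator (cell x m c) y) \<in> borel_measurable lebesgue" for c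
        by (intro borel_measurable_add dev_measurable mc)
    next
      have "(\<integral>\<^sup>+y. ennreal (cmod (f y - poly (P m c) (of_real y))) * indicator {x m (c - int d)..x m (c + int d)} y
            + ennreal ?K * indicator (cell x m c) y \<partial>lebesgue) = (\<integral>\<^sup>+y\<in>{x m (c - int d)..x m (c + int d)}. ennreal (cmod (f y - poly (P m c) (of_real y))) \<partial>lebesgue)
        + ennreal ?K * ennreal (len m c)" for c
        by (subst nn_integral_add[OF dev_measurable mc])
          (simp add: nn_integral_cmult_indicator cell_def cell_length_def)
      then show "(\<Sum>c\<in>C. \<integral>\<^sup>+y. ennreal (cmod (f y - poly (P m c) (of_real y))) * indicator {x m (c - int d)..x m (c + int d)} y
            + ennreal ?K * indicator (cell x m c) y \<partial>lebesgue) = (\<Sum>c\<in>C. (\<integral>\<^sup>+y\<in>{x m (c - int d)..x m (c + int d)}. ennreal (cmod (f y - poly (P m c) (of_real y))) \<partial>lebesgue)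
        + ennreal ?K * ennreal (len m c))" by (simp only:)
    qed
    also have "\<dots> \<le> (\<Sum>c\<in>C. ennreal (\<epsilon>' * D * len m c))"
    proof (rule sum_mono)
      fix c
      have "(\<integral>\<^sup>+y\<in>{x m (c - int d)..x m (c + int d)}. ennreal (cmod (f y - poly (P m c) (of_real y))) \<partial>lebesgue)
        \<le> ennreal (\<epsilon>' * len m c)"
        using em[of c] by (intro order_trans[OF approx] ennreal_leI mult_right_mono) auto
      then have "(\<integral>\<^sup>+y\<in>{x m (c - int d)..x m (c + int d)}. ennreal (cmod (f y - poly (P m c) (of_real y))) \<partial>lebesgue)
        + ennreal ?K * ennreal (len m c) \<le> ennreal (\<epsilon>' * len m c) + ennreal (?K * len m c)"
        using K0 by (intro add_mono) (auto simp: ennreal_mult)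
      also have "\<dots> = ennreal (\<epsilon>' * len m c + ?K * len m c)"
        using K0 \<epsilon>' G_nonneg by (intro ennreal_plus[symmetric] mult_nonneg_nonneg) auto
      also have "\<epsilon>' * len m c + ?K * len m c = \<epsilon>' * D * len m c" by (simp add: D_def algebra_simps)
      finally show "(\<integral>\<^sup>+y\<in>{x m (c - int d)..x m (c + int d)}. ennreal (cmod (f y - poly (P m c) (of_real y))) \<partial>lebesgue)
        + ennreal ?K * ennreal (len m c) \<le> ennreal (\<epsilon>' * D * len m c)" .
    qed
    also have "\<dots> = ennreal (\<Sum>c\<in>C. \<epsilon>' * D * len m c)"
      using \<epsilon>' D by (intro sum_ennreal) simp
    also have "\<dots> \<le> ennreal \<epsilon>"
    proof (rule ennreal_leI)
      have small: "len m j \<le> lam * len 0 0" for j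
      proof -
        have "len (0 + int (nat m)) j \<le> lam * rho ^ nat m * len 0 0" by (rule len_decay)
        also have "\<dots> \<le> lam * 1 * len 0 0"
          using lam rho_bounds by (intro mult_right_mono mult_left_mono power_le_one) auto
        finally show ?thesis using m by simp
      qed
      have iuv: "idx m u \<le> idx m v" using uv by (intro idx_mono) simp
      have "C = {idx m u..<idx m v + 1}" by (auto simp: C_def)
      then have "(\<Sum>c\<in>C. len m c) = x m (idx m v + 1) - x m (idx m u)"
        using iuv sum_len[of "idx m u" "idx m v + 1" m] by simp
      also have "\<dots> = (x m (idx m v) - x m (idx m u + 1)) + len m (idx m v) + len m (idx m u)" by (simp add: cell_length_def)
      also have "\<dots> \<le> L"
        using idx_lower[of m v] idx_upper[of u m] small[of "idx m v"] small[of "idx m u"] unfolding L_def by linarith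
      finally have "\<epsilon>' * D * (\<Sum>c\<in>C. len m c) \<le> \<epsilon>' * D * L" using \<epsilon>' D by (intro mult_left_mono) auto
      also have "\<dots> = \<epsilon>" using D L by (simp add: \<epsilon>'_def)
      finally show "(\<Sum>c\<in>C. \<epsilon>' * D * len m c) \<le> \<epsilon>" by (simp add: sum_distrib_left)
    qed
    finally show ?thesis .
  qed
  then show ?thesis by blast
qed

section \<open>Convergence at coarse levels modulo constants\<close>

definition CT :: real where "CT = 2 * G * real (d + 1) + (2 * lam) ^ d * (CN * lam * 2)"

text \<open>A point such as 0 may be a knot of every coarse level. An interval around it then never
  fits into one cell, but on coarse enough levels it meets only the cell around 0 and neighbours of
  it.\<close>

lemma poly_neighbour:
  assumes em: "\<And>j. e (m, j) \<le> \<epsilon>" and c: "\<bar>idx m y - c\<bar> \<le> 1"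
  shows "cmod (poly (P m (idx m y)) (of_real y) - poly (P m c) (of_real y)) \<le> (2 * lam) ^ d * (CN * lam * 2) * \<epsilon>"
proof -
  let ?c = "idx m y"
  have \<epsilon>0: "0 \<le> \<epsilon>" using em[of 0] e_nonneg[of "(m, 0)"] by linarith
  show ?thesis
  proof (cases "?c = c")
    case True
    then show ?thesis using lam CN(1) \<epsilon>0 by simp
  next
    case False
    define r where "r = min ?c c"
    have "local_norm d (x m r) (len m r) (P m ?c - P m c) \<le> CN * lam * (e (m, ?c) + e (m, c))"
      using c d False by (intro compare_same_level) (auto simp: r_def)
    also have "\<dots> \<le> CN * lam * (\<epsilon> + \<epsilon>)" using CN(1) lam em by (intro mult_left_mono add_mono) auto
    finally have ln: "local_norm d (x m r) (len m r) (P m ?c - P m c) \<le> CN * lam * 2 * \<epsilon>" by simp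
    have "\<bar>y - x m r\<bar> \<le> 2 * lam * len m r"
    proof -
      have "x m r \<le> x m ?c" by (simp add: r_def)
      moreover have "\<bar>x m (?c + 1) - x m r\<bar> \<le> real 2 * lam * len m r" using c by (intro knot_dist) (auto simp: r_def)
      ultimately show ?thesis using idx_lower[of m y] idx_upper[of y m] unfolding of_nat_numeral by linarith
    qed
    then have "cmod (poly (P m ?c - P m c) (of_real y)) \<le> (2 * lam) ^ d * local_norm d (x m r) (len m r) (P m ?c - P m c)"
      using lam by (intro local_norm_sup_bound degree_diff_le degP) auto
    also have "\<dots> \<le> (2 * lam) ^ d * (CN * lam * 2 * \<epsilon>)" using ln lam by (intro mult_left_mono) auto
    finally show ?thesis by (simp add: mult.assoc)
  qed
qed

lemma T_near_poly:
  assumes em: "\<And>j. e (m, j) \<le> \<epsilon>" and c: "\<bar>idx m y - c\<bar> \<le> 1"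
  shows "cmod (T m y - poly (P m c) (of_real y)) \<le> CT * \<epsilon>"
  using norm_triangle_ineq[of "T m y - poly (P m (idx m y)) (of_real y)" "poly (P m (idx m y)) (of_real y) - poly (P m c) (of_real y)"]
    T_poly_dev_le[OF em, of y] poly_neighbour[OF em c]
  by (simp add: CT_def algebra_simps)

definition Q :: "nat \<Rightarrow> complex poly" where "Q n = P (- int n) (idx (- int n) 0)"

lemma degQ: "degree (Q n) \<le> d"
  by (simp add: Q_def degP)

text \<open>The polynomials of a cell around 0 and of its parent differ by a bounded amount in the
  variable scaled by the cell length, and this length is at least the one on level 0 divided by
  \<open>rho ^ n\<close>. Undoing the scaling divides the coefficient of order \<open>r\<close> by
  the \<open>r\<close>-th power of the length; for \<open>r = 0\<close> nothing is gained.\<close>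

lemma coeff_Q_step:
  assumes r: "1 \<le> r" "r \<le> d"
  shows "cmod (coeff (Q n) r - coeff (Q (Suc n)) r)
     \<le> CN * 2 ^ d * (CN * (emax + real M0 * lam * emax)) / len 0 (idx 0 0) ^ r * rho ^ n"
proof -
  define m where "m = - int n - 1"
  have m: "- int n = m + 1" "- int (Suc n) = m" by (simp_all add: m_def)
  define i where "i = idx (m + 1) 0"
  let ?s = "len (m + 1) i" and ?u = "x (m + 1) i" and ?z = "len 0 (idx 0 0)"
  define B0 where "B0 = CN * (emax + real M0 * lam * emax)"
  let ?D = "Q n - Q (Suc n)"
  have dD: "degree ?D \<le> d" by (intro degree_diff_le degQ)
  have emax0: "0 \<le> emax" by (simp add: emax_def)
  have B0: "0 \<le> B0" using CN(1) emax0 lam by (simp add: B0_def)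
  have "idx m (x (m + 1) i) = idx m 0" unfolding i_def by (rule idx_idx) simp
  then have "local_norm d ?u ?s (P (m + 1) i - P m (idx m 0)) \<le> CN * (e (m + 1, i) + real M0 * lam * e (m, idx m 0))"
    by (rule compare_parent)
  also have "\<dots> \<le> B0" unfolding B0_def using CN(1) lam by (intro mult_left_mono add_mono e_le_emax) auto
  finally have ln: "local_norm d ?u ?s ?D \<le> B0" by (simp add: Q_def m i_def)
  \<comment> \<open>The cell contains 0, so the points of \<open>[0, ?s]\<close> are within twice
    its length of its left end. Passing to an interval that starts at 0 makes the coefficients of
    \<open>?D\<close> itself appear.\<close>
  have sup: "cmod (poly ?D (of_real y)) \<le> 2 ^ d * B0" if "y \<in> {0..?s}" for y
  proof -
    have "?u \<le> 0" "0 < ?u + ?s" using idx_upper[of 0 "m + 1"] by (simp_all add: i_def cell_length_def)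
    then have "\<bar>y - ?u\<bar> \<le> 2 * ?s" using that by auto
    then have "cmod (poly ?D (of_real y)) \<le> 2 ^ d * local_norm d ?u ?s ?D"
      by (intro local_norm_sup_bound dD) auto
    also have "\<dots> \<le> 2 ^ d * B0" using ln by (intro mult_left_mono) auto
    finally show ?thesis .
  qed
  have "integral {0..0 + ?s} (\<lambda>y. cmod (poly ?D (of_real y))) \<le> integral {0..0 + ?s} (\<lambda>y. 2 ^ d * B0)"
    using sup by (intro integral_le poly_integrable) auto
  also have "\<dots> = ?s * (2 ^ d * B0)" using len_pos[of "m + 1" i] by (simp add: content_real)
  finally have I: "integral {0..0 + ?s} (\<lambda>y. cmod (poly ?D (of_real y))) \<le> ?s * (2 ^ d * B0)" .
  have "cmod (coeff (pcompose ?D [:of_real 0, of_real ?s:]) r) \<le> local_norm d 0 ?s ?D"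
    unfolding local_norm_def using r
    by (intro member_le_sum[where f="\<lambda>i. cmod (coeff (pcompose ?D [:of_real 0, of_real ?s:]) i)"]) auto
  also have "\<dots> \<le> CN / ?s * integral {0..0 + ?s} (\<lambda>y. cmod (poly ?D (of_real y)))" by (rule CN(2)[OF dD]) simp
  also have "\<dots> \<le> CN / ?s * (?s * (2 ^ d * B0))" using I CN(1) by (intro mult_left_mono) auto
  also have "\<dots> = CN * 2 ^ d * B0"
  proof -
    have "?s \<noteq> 0" using len_pos[of "m + 1" i] by linarith
    then show ?thesis by simp
  qed
  finally have c: "?s ^ r * cmod (coeff (Q n) r - coeff (Q (Suc n)) r) \<le> CN * 2 ^ d * B0"
    by (simp add: coeff_pcompose_linear norm_mult norm_power)
  have "len (- int n + int n) (idx (- int n + int n) 0) \<le> rho ^ n * len (- int n) (idx (- int n) 0)"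
    by (rule len_at_decay)
  then have "?z \<le> rho ^ n * len (- int n) (idx (- int n) 0)" by simp
  then have s: "?z \<le> rho ^ n * ?s" by (simp only: m(1) i_def)
  then have "?z ^ r \<le> (rho ^ n * ?s) ^ r" by (intro power_mono) auto
  also have "\<dots> = (rho ^ n) ^ r * ?s ^ r" by (rule power_mult_distrib)
  also have "\<dots> \<le> rho ^ n * ?s ^ r"
  proof (rule mult_right_mono)
    have "rho ^ n \<le> 1" using rho_bounds by (intro power_le_one) auto
    then show "(rho ^ n) ^ r \<le> rho ^ n" using rho_bounds r power_decreasing[of 1 r "rho ^ n"] by simp
  qed simp
  finally have "?z ^ r * cmod (coeff (Q n) r - coeff (Q (Suc n)) r) \<le> rho ^ n * ?s ^ r * cmod (coeff (Q n) r - coeff (Q (Suc n)) r)"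
    by (intro mult_right_mono) auto
  also have "\<dots> \<le> rho ^ n * (CN * 2 ^ d * B0)" using c rho_bounds by (simp add: mult.assoc mult_left_mono)
  finally have "cmod (coeff (Q n) r - coeff (Q (Suc n)) r) \<le> rho ^ n * (CN * 2 ^ d * B0) / ?z ^ r"
    by (subst pos_le_divide_eq) (auto simp: mult.commute)
  then show ?thesis by (simp add: B0_def mult.commute)
qed

lemma coeff_Q_convergent:
  assumes r: "1 \<le> r" "r \<le> d"
  shows "convergent (\<lambda>n. coeff (Q n) r)"
proof -
  define C where "C = CN * 2 ^ d * (CN * (emax + real M0 * lam * emax)) / len 0 (idx 0 0) ^ r"
  have "summable (\<lambda>n. coeff (Q (Suc n)) r - coeff (Q n) r)"
  proof (rule summable_comparison_test)
    show "summable (\<lambda>n. C * rho ^ n)" using rho_bounds by (intro summable_mult summable_geometric) auto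
    show "\<exists>N. \<forall>n\<ge>N. norm (coeff (Q (Suc n)) r - coeff (Q n) r) \<le> C * rho ^ n"
      using coeff_Q_step[OF r] unfolding C_def by (subst norm_minus_commute) blast
  qed
  then have "convergent (\<lambda>N. \<Sum>n<N. coeff (Q (Suc n)) r - coeff (Q n) r)" by (simp add: summable_iff_convergent)
  then have "convergent (\<lambda>N. coeff (Q N) r - coeff (Q 0) r)" unfolding sum_lessThan_telescope[of "\<lambda>n. coeff (Q n) r"] .
  then show ?thesis by (simp add: convergent_diff_const_right_iff)
qed

text \<open>The constant term is left out: it need not converge, and constants do not matter in
  BMO.\<close>

definition PP :: "complex poly" where "PP = (\<Sum>r=1..d. monom (lim (\<lambda>n. coeff (Q n) r)) r)"

lemma degPP: "degree PP \<le> d"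
  unfolding PP_def by (intro degree_sum_le) (auto intro: order_trans[OF degree_monom_le])

lemma Q_to_PP:
  assumes R: "0 \<le> R" and \<epsilon>: "0 < \<epsilon>"
  shows "\<exists>N. \<forall>n\<ge>N. \<forall>y. \<bar>y\<bar> \<le> R \<longrightarrow> cmod (poly (Q n) (of_real y) - coeff (Q n) 0 - poly PP (of_real y)) \<le> \<epsilon>"
proof -
  define L where "L r = lim (\<lambda>n. coeff (Q n) r)" for r
  have lim: "(\<lambda>n. coeff (Q n) r) \<longlonglongrightarrow> L r" if "r \<in> {1..d}" for r
    using coeff_Q_convergent[of r] that by (simp add: L_def convergent_LIMSEQ_iff)
  have "(\<lambda>n. \<Sum>r=1..d. cmod (coeff (Q n) r - L r) * R ^ r) \<longlonglongrightarrow> (\<Sum>r=1..d. cmod (L r - L r) * R ^ r)"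
    by (intro tendsto_sum tendsto_mult tendsto_norm tendsto_diff lim tendsto_const)
  then have "(\<lambda>n. \<Sum>r=1..d. cmod (coeff (Q n) r - L r) * R ^ r) \<longlonglongrightarrow> 0" by simp
  then have "\<forall>\<^sub>F n in sequentially. (\<Sum>r=1..d. cmod (coeff (Q n) r - L r) * R ^ r) < \<epsilon>"
    using \<epsilon> by (rule order_tendstoD(2))
  then obtain N where N: "\<And>n. N \<le> n \<Longrightarrow> (\<Sum>r=1..d. cmod (coeff (Q n) r - L r) * R ^ r) < \<epsilon>"
    by (auto simp: eventually_sequentially)
  have "cmod (poly (Q n) (of_real y) - coeff (Q n) 0 - poly PP (of_real y)) \<le> \<epsilon>" if "N \<le> n" "\<bar>y\<bar> \<le> R" for n y
  proof -
    have "poly (Q n) (of_real y) = (\<Sum>r\<le>degree (Q n). coeff (Q n) r * of_real y ^ r)" by (rule poly_altdef)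
    also have "\<dots> = (\<Sum>r\<le>d. coeff (Q n) r * of_real y ^ r)"
      using degQ[of n] by (intro sum.mono_neutral_left) (auto simp: coeff_eq_0)
    also have "{..d} = insert 0 {1..d}" by auto
    finally have "poly (Q n) (of_real y) = coeff (Q n) 0 + (\<Sum>r=1..d. coeff (Q n) r * of_real y ^ r)" by simp
    moreover have "poly PP (of_real y) = (\<Sum>r=1..d. L r * of_real y ^ r)"
      by (simp add: PP_def poly_sum poly_monom L_def)
    ultimately have "poly (Q n) (of_real y) - coeff (Q n) 0 - poly PP (of_real y) = (\<Sum>r=1..d. (coeff (Q n) r - L r) * of_real y ^ r)"
      by (simp add: left_diff_distrib sum_subtractf)
    also have "cmod \<dots> \<le> (\<Sum>r=1..d. cmod (coeff (Q n) r - L r) * R ^ r)"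
      using that(2) by (intro order_trans[OF norm_sum] sum_mono) (auto simp: norm_mult norm_power intro!: mult_left_mono power_mono)
    also have "\<dots> \<le> \<epsilon>" using N[OF that(1)] by simp
    finally show ?thesis .
  qed
  then show ?thesis by blast
qed

text \<open>The constant \<open>coeff (Q n) 0\<close> varies with \<open>n\<close>. As soon as the
  cell around 0 is longer than \<open>lam * R\<close>, the interval meets only this cell and its
  neighbours, and \<open>T_near_poly\<close> applies.\<close>

lemma T_to_PP:
  assumes \<epsilon>: "0 < \<epsilon>"
  shows "\<exists>N. \<forall>n\<ge>N. \<forall>y\<in>{u..v}. cmod (T (- int n) y - poly PP (of_real y) - coeff (Q n) 0) \<le> \<epsilon>"
proof -
  define R where "R = max \<bar>u\<bar> \<bar>v\<bar>"
  have R: "0 \<le> R" by (simp add: R_def)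
  have CT0: "0 \<le> CT" using G_nonneg CN(1) lam by (simp add: CT_def)
  define \<epsilon>' where "\<epsilon>' = \<epsilon> / (2 * (CT + 1))"
  have \<epsilon>': "0 < \<epsilon>'" using \<epsilon> CT0 by (simp add: \<epsilon>'_def)
  have CTe: "CT * \<epsilon>' \<le> \<epsilon> / 2" using \<epsilon> CT0 by (simp add: \<epsilon>'_def field_simps)
  obtain M where M: "\<And>m j. M \<le> \<bar>m\<bar> \<Longrightarrow> e (m, j) \<le> \<epsilon>'" using e_small[OF \<epsilon>'] by blast
  have "\<exists>N. \<forall>n\<ge>N. \<forall>y. \<bar>y\<bar> \<le> R \<longrightarrow> cmod (poly (Q n) (of_real y) - coeff (Q n) 0 - poly PP (of_real y)) \<le> \<epsilon> / 2"
    using \<epsilon> by (intro Q_to_PP R) simp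
  then obtain N1 where N1: "\<And>n y. N1 \<le> n \<Longrightarrow> \<bar>y\<bar> \<le> R \<Longrightarrow> cmod (poly (Q n) (of_real y) - coeff (Q n) 0 - poly PP (of_real y)) \<le> \<epsilon> / 2"
    by blast
  let ?z = "len 0 (idx 0 0)"
  have lR: "0 < lam * R + 1" using lam R by (simp add: add_nonneg_pos)
  have "(\<lambda>n. rho ^ n) \<longlonglongrightarrow> 0" using rho_bounds by (intro LIMSEQ_realpow_zero) auto
  then have "\<forall>\<^sub>F n in sequentially. rho ^ n < ?z / (lam * R + 1)"
    by (rule order_tendstoD(2)) (use lR in simp)
  then obtain N2 where N2: "\<And>n. N2 \<le> n \<Longrightarrow> rho ^ n < ?z / (lam * R + 1)" by (auto simp: eventually_sequentially)
  have "cmod (T (- int n) y - poly PP (of_real y) - coeff (Q n) 0) \<le> \<epsilon>"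
    if n: "max (nat M) (max N1 N2) \<le> n" and y: "y \<in> {u..v}" for n y
  proof -
    let ?m = "- int n"
    have yR: "\<bar>y\<bar> \<le> R" using y by (auto simp: R_def)
    have em: "e (?m, j) \<le> \<epsilon>'" for j using n by (intro M) auto
    have "len (- int n + int n) (idx (- int n + int n) 0) \<le> rho ^ n * len ?m (idx ?m 0)" by (rule len_at_decay)
    then have "?z \<le> rho ^ n * len ?m (idx ?m 0)" by simp
    also have "\<dots> < ?z / (lam * R + 1) * len ?m (idx ?m 0)" using N2[of n] n by (intro mult_strict_right_mono) auto
    finally have "?z * (lam * R + 1) < ?z * len ?m (idx ?m 0)" using lR by (simp add: field_simps)
    then have "lam * R + 1 < len ?m (idx ?m 0)" by simp
    then have big: "lam * R / len ?m (idx ?m 0) < 1" by (subst pos_divide_less_eq) auto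
    have ratio: "lam * \<bar>y\<bar> / len ?m (idx ?m 0) < 1"
    proof -
      have "lam * \<bar>y\<bar> / len ?m (idx ?m 0) \<le> lam * R / len ?m (idx ?m 0)"
        using yR lam by (intro divide_right_mono mult_left_mono) auto
      then show ?thesis using big by linarith
    qed
    have c: "\<bar>idx ?m y - idx ?m 0\<bar> \<le> 1"
    proof (cases "0 \<le> y")
      case True
      then have ya: "\<bar>y\<bar> = y - 0" by simp
      have "real_of_int (idx ?m y - idx ?m 0) < 2"
        using idx_diff_le[of 0 y ?m "idx ?m 0"] ratio True unfolding ya by linarith
      then have "idx ?m y - idx ?m 0 < 2" by linarith
      moreover have "idx ?m 0 \<le> idx ?m y" using True by (rule idx_mono)
      ultimately show ?thesis by linarith
    next
      case False
      then have ya: "\<bar>y\<bar> = 0 - y" by simp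
      have "real_of_int (idx ?m 0 - idx ?m y) < 2"
        using idx_diff_le[of y 0 ?m "idx ?m 0"] ratio False unfolding ya by linarith
      then have "idx ?m 0 - idx ?m y < 2" by linarith
      moreover have "idx ?m y \<le> idx ?m 0" using False by (intro idx_mono) simp
      ultimately show ?thesis by linarith
    qed
    have "cmod (T ?m y - poly (Q n) (of_real y)) \<le> \<epsilon> / 2"
      using T_near_poly[OF em c] CTe by (simp add: Q_def)
    moreover have "cmod (poly (Q n) (of_real y) - coeff (Q n) 0 - poly PP (of_real y)) \<le> \<epsilon> / 2"
      using n yR by (intro N1) auto
    ultimately show ?thesis
      using norm_triangle_ineq[of "T ?m y - poly (Q n) (of_real y)" "poly (Q n) (of_real y) - coeff (Q n) 0 - poly PP (of_real y)"]
      by (simp add: algebra_simps)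
  qed
  then show ?thesis by blast
qed

lemma spl_restrict_sum:
  assumes F: "finite F" "\<And>l i. (l, i) \<in> F \<Longrightarrow> lo \<le> l \<and> l \<le> hi"
  shows "(\<Sum>l\<in>{lo..hi}. spl d l (\<lambda>p. if p \<in> F then b p else 0) y)
    = (\<Sum>(l, i)\<in>F. b (l, i) * of_real (bspline d (x l) i y))"
proof -
  define J where "J l = {idx l y - int d..idx l y} \<union> {i. (l, i) \<in> F}" for l
  have fJ: "finite (J l)" for l
  proof -
    have "{i. (l, i) \<in> F} \<subseteq> snd ` F" by force
    then show ?thesis using F(1) by (auto simp: J_def intro: finite_subset)
  qed
  have "(\<Sum>l\<in>{lo..hi}. spl d l (\<lambda>p. if p \<in> F then b p else 0) y)
     = (\<Sum>l\<in>{lo..hi}. \<Sum>i\<in>J l. (if (l, i) \<in> F then b (l, i) else 0) * of_real (bspline d (x l) i y))"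
    by (intro sum.cong refl spl_sum fJ) (auto simp: J_def)
  also have "\<dots> = (\<Sum>(l, i)\<in>(SIGMA l:{lo..hi}. J l). (if (l, i) \<in> F then b (l, i) else 0) * of_real (bspline d (x l) i y))"
    by (rule sum.Sigma) (auto intro: fJ)
  also have "\<dots> = (\<Sum>(l, i)\<in>F. b (l, i) * of_real (bspline d (x l) i y))"
  proof (rule sum.mono_neutral_cong_right)
    show "F \<subseteq> (SIGMA l:{lo..hi}. J l)" using F(2) by (auto simp: J_def)
  qed (auto intro: fJ)
  finally show ?thesis .
qed

end

section \<open>The Jackson estimate\<close>

lemma bspline_continuous:
  assumes t: "strict_mono t" and l: "0 < l" "\<And>i. l \<le> t (i + 1) - t i" and d: "1 \<le> d"
  shows "continuous_on UNIV (bspline d t j)"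
proof -
  obtain d' where d': "d = Suc d'" using d by (cases d) auto
  have "(4 ^ Suc d' / l)-lipschitz_on UNIV (bspline (Suc d') t j)"
    using bspline_lipschitz[OF t l, of d' j] l(1) by (intro lipschitz_onI) (auto simp: dist_real_def)
  then show ?thesis unfolding d' by (rule lipschitz_on_continuous_on)
qed

lemma Delta_diff_poly:
  assumes "degree Q < k"
  shows "Delta k h (\<lambda>y. f y - poly Q (of_real y)) J = Delta k h f J"
proof
  fix y
  have "nth_diff k h (\<lambda>y. f y - poly Q (of_real y)) y = nth_diff k h f y - nth_diff k h (\<lambda>y. poly Q (of_real y)) y"
    by (simp add: nth_diff_def right_diff_distrib sum_subtractf)
  also have "nth_diff k h (\<lambda>y. poly Q (of_real y)) y = 0" using assms by (intro nth_diff_poly) simp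
  finally show "Delta k h (\<lambda>y. f y - poly Q (of_real y)) J y = Delta k h f J y"
    by (simp add: Delta_def nth_diff_def)
qed

text \<open>Differences of order \<open>k\<close> annihilate polynomials of degree below
  \<open>k\<close>. Hence a canonical representative of \<open>f\<close> has the same norm as
  \<open>f\<close>.\<close>

lemma besov_norm_diff_poly:
  assumes "degree Q < k"
  shows "besov_norm x k q \<tau> (\<lambda>y. f y - poly Q (of_real y)) = besov_norm x k q \<tau> f"
  by (simp add: besov_norm_def besov_term_def omega_def Delta_diff_poly[OF assms])

lemma locally_integrable_diff:
  assumes "locally_integrable f" "continuous_on UNIV g"
  shows "locally_integrable (\<lambda>y. f y - g y)"
  unfolding locally_integrable_def
proof (intro allI set_integral_diff(1))
  fix a b :: real
  show "set_integrable lebesgue {a..b} f" using assms by (simp add: locally_integrable_def)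
  show "set_integrable lebesgue {a..b} g"
    using assms(2) by (intro absolutely_integrable_continuous_real) (rule continuous_on_subset, auto)
qed

text \<open>The difference of the two averages serves as \<kappa> in \<open>bmo_norm_le\<close>.
  This is how two representatives are compared later.\<close>

lemma bmo_norm_diff_finite:
  assumes "locally_integrable u" "locally_integrable v"
    and u: "bmo_norm u < \<infinity>" and v: "bmo_norm v < \<infinity>"
  shows "bmo_norm (\<lambda>y. u y - v y) < \<infinity>"
proof -
  obtain A where A: "bmo_norm u = ennreal A" "0 \<le> A"
    using u by (metis ennreal_cases infinity_ennreal_def less_irrefl)
  obtain B where B: "bmo_norm v = ennreal B" "0 \<le> B"
    using v by (metis ennreal_cases infinity_ennreal_def less_irrefl)
  have int: "(\<integral>\<^sup>+y\<in>{a..b}. ennreal (cmod (w y - avg w a b)) \<partial>lebesgue) \<le> ennreal (C * (b - a))"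
    if w: "bmo_norm w = ennreal C" "0 \<le> C" and ab: "a < b" for w C a b
  proof -
    let ?I = "\<integral>\<^sup>+y\<in>{a..b}. ennreal (cmod (w y - avg w a b)) \<partial>lebesgue"
    have "?I / ennreal (b - a) \<le> ennreal C"
      unfolding w(1)[symmetric] bmo_norm_def using ab by (intro SUP_upper2[of "(a, b)"]) auto
    then have "?I / ennreal (b - a) * ennreal (b - a) \<le> ennreal C * ennreal (b - a)" by (rule mult_right_mono) simp
    moreover have "?I / ennreal (b - a) * ennreal (b - a) = ?I"
      using ab by (simp add: ennreal_divide_times divide_ennreal)
    ultimately show ?thesis using ab w(2) by (simp add: ennreal_mult)
  qed
  have "locally_integrable (\<lambda>y. u y - v y)"
    using assms(1,2) by (auto simp: locally_integrable_def intro: set_integral_diff(1))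
  then have "bmo_norm (\<lambda>y. u y - v y) \<le> ennreal (2 * (A + B))"
  proof (rule bmo_norm_le)
    fix a b :: real assume ab: "a < b"
    have m: "(\<lambda>y. ennreal (cmod (w y - c)) * indicator {a..b} y) \<in> borel_measurable lebesgue" if "locally_integrable w" for w c
      by (rule locally_integrable_dist_measurable[OF that]) simp
    let ?u = "avg u a b" and ?v = "avg v a b"
    have "(\<integral>\<^sup>+y\<in>{a..b}. ennreal (cmod (u y - v y - (?u - ?v))) \<partial>lebesgue)
      \<le> (\<integral>\<^sup>+y. (ennreal (cmod (u y - ?u)) * indicator {a..b} y + ennreal (cmod (v y - ?v)) * indicator {a..b} y) \<partial>lebesgue)"
    proof (rule nn_integral_mono)
      fix y
      have "cmod (u y - v y - (?u - ?v)) \<le> cmod (u y - ?u) + cmod (v y - ?v)"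
        using norm_triangle_ineq4[of "u y - ?u" "v y - ?v"] by (simp add: algebra_simps)
      then show "ennreal (cmod (u y - v y - (?u - ?v))) * indicator {a..b} y \<le> ennreal (cmod (u y - ?u)) * indicator {a..b} y + ennreal (cmod (v y - ?v)) * indicator {a..b} y"
        by (auto simp: indicator_def ennreal_plus[symmetric] ennreal_leI simp del: ennreal_plus)
    qed
    also have "\<dots> \<le> ennreal (A * (b - a)) + ennreal (B * (b - a))"
      using ab A B by (subst nn_integral_add[OF m[OF assms(1)] m[OF assms(2)]]) (intro add_mono int)
    also have "\<dots> = ennreal ((A + B) * (b - a))"
      using A B ab by (simp add: distrib_right)
    finally show "\<exists>\<kappa>. (\<integral>\<^sup>+y\<in>{a..b}. ennreal (cmod (u y - v y - \<kappa>)) \<partial>lebesgue) \<le> ennreal ((A + B) * (b - a))" by blast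
  qed (use A B in simp)
  then show ?thesis by (rule le_less_trans) simp
qed

section \<open>Approximation by the selected terms\<close>

context spline_decomposition
begin

definition g :: "(int \<times> int) set \<Rightarrow> real \<Rightarrow> complex" where
  "g \<Lambda> y = (\<Sum>(m, j)\<in>\<Lambda>. b (m, j) * complex_of_real (bspline d (x m) j y))"

text \<open>\<open>CB d\<close> accounts for the discarded splines, the summand \<open>2\<close> for
  the remainders at fine and at coarse levels.\<close>

definition CF :: real where "CF = (CB d + 2) * weighted_partition.CS lam (1 / \<tau>)"

lemma knot_gap: "len m 0 / lam \<le> x m (i + 1) - x m i"
  using len_le[of m 0 i] lam by (simp add: cell_length_def field_simps)

lemma bspline_cont: "continuous_on UNIV (bspline d (x m) j)"
  by (rule bspline_continuous[OF knots_mono _ knot_gap d]) (use lam in simp)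

lemma g_continuous: "continuous_on UNIV (g \<Lambda>)"
  unfolding g_def[abs_def] split_beta
  by (intro continuous_intros continuous_on_subset[OF bspline_cont]) auto

lemma g_C0:
  assumes "finite \<Lambda>"
  shows "g \<Lambda> \<in> C0"
proof -
  define K where "K = (\<Union>(m, j)\<in>\<Lambda>. {x m j..x m (j + int d + 1)})"
  have "compact K" unfolding K_def using assms by (intro compact_UN) auto
  have "g \<Lambda> y = 0" if "y \<notin> K" for y
  proof -
    have "bspline d (x m) j y = 0" if "(m, j) \<in> \<Lambda>" for m j
      using \<open>y \<notin> K\<close> that by (intro bspline_eq_0[OF knots_mono]) (force simp: K_def)
    then show ?thesis by (auto simp: g_def intro!: sum.neutral)
  qed
  then have "{y. g \<Lambda> y \<noteq> 0} \<subseteq> K" by blast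
  then have "closure {y. g \<Lambda> y \<noteq> 0} \<subseteq> K" using compact_imp_closed[OF \<open>compact K\<close>] by (rule closure_minimal)
  then have "compact (closure {y. g \<Lambda> y \<noteq> 0})"
    using \<open>compact K\<close> by (metis closed_closure compact_Int_closed inf.absorb2)
  then show ?thesis by (simp add: C0_def g_continuous)
qed

text \<open>Finitely many selected cells fit between a coarse level \<open>- n\<close> and a fine
  level \<open>hi\<close>, between which \<open>T\<close> changes by the selected plus the discarded
  terms. Both remainders are pushed below \<open>A\<close>, the Carleson constant of the discarded
  terms, and so cost no more than these. The levels and \<kappa> depend on the interval, the bound
  does not.\<close>

lemma sparse_approximation:
  assumes \<theta>: "0 < \<theta>"
  shows "\<exists>\<Lambda>. finite \<Lambda> \<and> real (card \<Lambda>) \<le> 2 * (\<Sum>\<^sub>\<infinity>p. cmod (b p) powr \<tau>) / \<theta> \<and>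
    (\<forall>u v. u < v \<longrightarrow> (\<exists>\<kappa>. (\<integral>\<^sup>+y\<in>{u..v}. ennreal (cmod (f y - poly PP (of_real y) - g \<Lambda> y - \<kappa>)) \<partial>lebesgue)
        \<le> ennreal (CF * \<theta> powr (1 / \<tau>) * (v - u))))"
proof -
  interpret W: weighted_partition M0 lam x "\<lambda>p. cmod (b p) powr \<tau>" "1 / \<tau>" \<theta>
    by unfold_locales (use b_summable tau \<theta> in auto)
  define A where "A = W.CS * \<theta> powr (1 / \<tau>)"
  have A: "0 < A" using W.CS_pos \<theta> by (simp add: A_def)
  define \<beta> where "\<beta> p = (if p \<in> W.selected then 0 else b p)" for p
  have fin: "finite W.selected" using W.selected_card by simp
  have car: "(\<Sum>p\<in>desc n m j. cmod (\<beta> p) * len (fst p) (snd p)) \<le> A * len m j" for n m j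
  proof -
    have "(\<Sum>p\<in>desc n m j. cmod (\<beta> p) * len (fst p) (snd p))
      = (\<Sum>p\<in>desc n m j - W.selected. (cmod (b p) powr \<tau>) powr (1 / \<tau>) * len (fst p) (snd p))"
      by (rule sum.mono_neutral_cong_right) (use tau in \<open>auto simp: \<beta>_def powr_powr\<close>)
    then show ?thesis using W.unselected_carleson[of n m j] by (simp add: A_def)
  qed
  have "\<exists>\<kappa>. (\<integral>\<^sup>+y\<in>{u..v}. ennreal (cmod (f y - poly PP (of_real y) - g W.selected y - \<kappa>)) \<partial>lebesgue)
        \<le> ennreal (CF * \<theta> powr (1 / \<tau>) * (v - u))" if uv: "u < v" for u v
  proof -
    obtain N where N: "\<And>n y. N \<le> n \<Longrightarrow> y \<in> {u..v} \<Longrightarrow> cmod (T (- int n) y - poly PP (of_real y) - coeff (Q n) 0) \<le> A"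
      using T_to_PP[OF A] by blast
    have Av: "0 < A * (v - u)" using A uv by simp
    obtain M where M: "\<And>m. M \<le> m \<Longrightarrow> (\<integral>\<^sup>+y\<in>{u..v}. ennreal (cmod (f y - T m y)) \<partial>lebesgue) \<le> ennreal (A * (v - u))"
      using T_to_f[OF uv Av] by blast
    define B where "B = Max (insert 0 ((\<lambda>p. \<bar>fst p\<bar>) ` W.selected))"
    have B: "\<bar>l\<bar> \<le> B" if "(l, i) \<in> W.selected" for l i
      unfolding B_def using fin that by (intro Max_ge) force+
    define n where "n = max N (nat (B + 1))"
    define hi where "hi = max M (max 0 (B + 1))"
    let ?lo = "- int n"
    have n: "N \<le> n" "B + 1 \<le> int n" by (auto simp: n_def)
    have hi: "M \<le> hi" "B + 1 \<le> hi" "?lo \<le> hi" by (auto simp: hi_def)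
    let ?S = "\<lambda>y. \<Sum>l\<in>{?lo + 1..hi}. spl d l \<beta> y"
    obtain \<kappa> where \<kappa>: "(\<integral>\<^sup>+y\<in>{u..v}. ennreal (cmod (?S y - \<kappa>)) \<partial>lebesgue) \<le> ennreal (CB d * A * (v - u))"
      using carleson_oscillation[OF car less_imp_le[OF A] uv d, of "?lo + 1" hi] by blast
    have S: "?S y = T hi y - T ?lo y - g W.selected y" for y
    proof -
      have "spl d l \<beta> y = spl d l b y - spl d l (\<lambda>p. if p \<in> W.selected then b p else 0) y" for l
      proof -
        have "(\<lambda>i. \<beta> (l, i)) = (\<lambda>i. b (l, i) - (if (l, i) \<in> W.selected then b (l, i) else 0))"
          by (auto simp: \<beta>_def)
        then show ?thesis by (simp add: spl_def spline_diff)
      qed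
      moreover have "(\<Sum>l\<in>{?lo + 1..hi}. spl d l (\<lambda>p. if p \<in> W.selected then b p else 0) y) = g W.selected y"
        unfolding g_def
      proof (rule spl_restrict_sum[OF fin])
        fix l i assume "(l, i) \<in> W.selected"
        then have "\<bar>l\<bar> \<le> B" by (rule B)
        then show "?lo + 1 \<le> l \<and> l \<le> hi" using n hi by linarith
      qed
      ultimately show ?thesis using T_telescope[OF hi(3), of y] by (simp add: sum_subtractf)
    qed
    let ?q = "coeff (Q n) 0"
    have [measurable]: "spl d l \<beta> \<in> borel_measurable borel" for l by (rule spl_measurable)
    have m1: "(\<lambda>y. ennreal (cmod (f y - T hi y)) * indicator {u..v} y) \<in> borel_measurable lebesgue"
      by (rule locally_integrable_dist_measurable[OF f T_measurable])
    have m2: "(\<lambda>y. ennreal (cmod (?S y - \<kappa>)) * indicator {u..v} y) \<in> borel_measurable lebesgue"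
      by (rule measurable_completion) measurable
    have m3: "(\<lambda>y. ennreal A * indicator {u..v} y) \<in> borel_measurable lebesgue"
      by (rule measurable_completion) measurable
    have "(\<integral>\<^sup>+y\<in>{u..v}. ennreal (cmod (f y - poly PP (of_real y) - g W.selected y - (\<kappa> + ?q))) \<partial>lebesgue)
      \<le> (\<integral>\<^sup>+y. (ennreal (cmod (f y - T hi y)) * indicator {u..v} y + (ennreal (cmod (?S y - \<kappa>)) * indicator {u..v} y
          + ennreal A * indicator {u..v} y)) \<partial>lebesgue)"
    proof (rule nn_integral_mono)
      fix y
      show "ennreal (cmod (f y - poly PP (of_real y) - g W.selected y - (\<kappa> + ?q))) * indicator {u..v} y
        \<le> ennreal (cmod (f y - T hi y)) * indicator {u..v} y + (ennreal (cmod (?S y - \<kappa>)) * indicator {u..v} y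
          + ennreal A * indicator {u..v} y)"
      proof (cases "y \<in> {u..v}")
        case True
        let ?Z = "T ?lo y - poly PP (of_real y) - ?q"
        have "f y - poly PP (of_real y) - g W.selected y - (\<kappa> + ?q) = (f y - T hi y) + ((?S y - \<kappa>) + ?Z)"
          unfolding S by simp
        also have "cmod \<dots> \<le> cmod (f y - T hi y) + (cmod (?S y - \<kappa>) + cmod ?Z)"
          by (intro order_trans[OF norm_triangle_ineq] add_left_mono norm_triangle_ineq)
        also have "\<dots> \<le> cmod (f y - T hi y) + (cmod (?S y - \<kappa>) + A)"
          by (intro add_left_mono N[OF n(1) True])
        finally show ?thesis using True A
          by (simp add: ennreal_plus[symmetric] ennreal_leI del: ennreal_plus)
      qed simp
    qed
    also have "\<dots> = (\<integral>\<^sup>+y\<in>{u..v}. ennreal (cmod (f y - T hi y)) \<partial>lebesgue)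
        + ((\<integral>\<^sup>+y\<in>{u..v}. ennreal (cmod (?S y - \<kappa>)) \<partial>lebesgue) + ennreal A * ennreal (v - u))"
      using uv by (subst nn_integral_add[OF m1 borel_measurable_add[OF m2 m3]], subst nn_integral_add[OF m2 m3])
        (simp add: nn_integral_cmult_indicator)
    also have "\<dots> \<le> ennreal (A * (v - u)) + (ennreal (CB d * A * (v - u)) + ennreal (A * (v - u)))"
      using A uv by (intro add_mono M[OF hi(1)] \<kappa>) (simp add: ennreal_mult)
    also have "\<dots> = ennreal (CF * \<theta> powr (1 / \<tau>) * (v - u))"
    proof -
      have "0 \<le> CB d" using lam rho_bounds by (simp add: CB_def)
      then have "ennreal (A * (v - u)) + (ennreal (CB d * A * (v - u)) + ennreal (A * (v - u)))
        = ennreal (A * (v - u) + (CB d * A * (v - u) + A * (v - u)))"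
      proof -
        assume "0 \<le> CB d"
        then have 1: "0 \<le> A * (v - u)" "0 \<le> CB d * A * (v - u)" using A uv by simp_all
        then show ?thesis by (simp only: ennreal_plus add_nonneg_nonneg)
      qed
      also have "A * (v - u) + (CB d * A * (v - u) + A * (v - u)) = CF * \<theta> powr (1 / \<tau>) * (v - u)"
        by (simp add: CF_def A_def algebra_simps)
      finally show ?thesis .
    qed
    finally show ?thesis by blast
  qed
  then show ?thesis using W.selected_card by blast
qed

end

lemma approximation_constant_mono:
  fixes X Y V W \<omega> :: real
  assumes "0 \<le> X" "X \<le> Y" "0 \<le> V" "V \<le> W" "0 \<le> \<omega>"
  shows "2 * ((1 + 2 ^ k * X ^ n) * (2 * V * \<omega>)) \<le> 2 * ((1 + 2 ^ k * Y ^ n) * (2 * W * \<omega>))"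
  using assms by (intro mult_left_mono mult_mono add_left_mono power_mono) simp_all

theorem theorem4p1:
  fixes \<alpha> \<tau> q lam :: real and k M0 :: nat
  assumes "\<alpha> > 0" and "\<tau> = 1 / \<alpha>" and "k \<ge> 2" and "q \<ge> 1"
    and "M0 \<ge> 2" and "lam \<ge> 1"
  shows "\<exists>c>0. \<forall>(x :: int \<Rightarrow> int \<Rightarrow> real) (f :: real \<Rightarrow> complex).
           regular_multilevel_partition M0 lam x \<longrightarrow> f \<in> besov_space x k q \<tau> \<longrightarrow>
             canonical_reps k f \<noteq> {} \<and>
             (\<forall>g \<in> canonical_reps k f.
                g \<in> VMO \<and>
                (\<forall>n::nat. n \<ge> 1 \<longrightarrow>
                   sigma_n_BMO x k n g
                     \<le> ennreal (c * real n powr (- \<alpha>) * besov_norm x k q \<tau> g)))"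
proof -
  define d where "d = k - 1"
  have kd: "1 \<le> d" "k = Suc d" using assms(3) by (auto simp: d_def)
  have k1: "k - 1 = d" by (simp add: d_def)
  have tau_inv: "0 < \<tau>" "1 / \<tau> = \<alpha>" using assms(1,2) by auto
  obtain CN where CN: "0 < CN" "\<And>P u l. degree P \<le> d \<Longrightarrow> l > 0 \<Longrightarrow>
        local_norm d u l P \<le> CN / l * integral {u..u + l} (\<lambda>x. norm (poly P (of_real x)))"
    using local_norm_integral_bound[of d] by blast
  \<comment> \<open>\<open>Z\<close> bounds the length of a window of \<open>2 * d\<close> cells
    divided by \<delta>, for the \<delta> chosen below for each cell.\<close>
  define Z where "Z = real (2 * d) * lam * (lam * real k * real (k + 1))"
  define Ce where "Ce = 4 * (1 + 2 ^ k * Z ^ Suc k) * (real (2 * d + 1) * lam) powr (1 - 1 / q)"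
  have Z: "0 \<le> Z" using assms(6) by (simp add: Z_def)
  have Ce: "0 < Ce" using Z assms(6) by (simp add: Ce_def add_pos_nonneg)
  \<comment> \<open>Taken outside their locales, the constants have as arguments only what their
    definitions mention, and neither \<open>x\<close> nor \<open>f\<close> is among them. This gives
    the uniformity of \<open>c\<close>; the maxima ensure positivity.\<close>
  define CEv where "CEv = max 0 (spline_decomposition.CE M0 lam d \<tau> CN) + 1"
  define CFv where "CFv = max 1 (spline_decomposition.CF lam d \<tau>)"
  define H where "H = 2 * CEv * Ce powr \<tau>"
  have H: "0 < H" using Ce by (simp add: H_def CEv_def)
  define c where "c = 2 * CFv * H powr \<alpha>"
  have c: "0 < c" using H by (simp add: c_def CFv_def)
  have main: "canonical_reps k f \<noteq> {} \<and>
             (\<forall>g \<in> canonical_reps k f. g \<in> VMO \<and>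
                (\<forall>n::nat. n \<ge> 1 \<longrightarrow> sigma_n_BMO x k n g \<le> ennreal (c * real n powr (- \<alpha>) * besov_norm x k q \<tau> g)))"
    if reg: "regular_multilevel_partition M0 lam x" and fB: "f \<in> besov_space x k q \<tau>" for x f
  proof -
    interpret multilevel_partition M0 lam x by unfold_locales (use reg assms(6) in auto)
    have fq: "f \<in> Lq_loc q" and fs: "besov_term x k q \<tau> f summable_on UNIV"
      using fB by (auto simp: besov_space_def)
    define S where "S = (\<Sum>\<^sub>\<infinity>p. besov_term x k q \<tau> f p)"
    define e where "e p = (case p of (m, j) \<Rightarrow> Ce * (len m j powr (- 1 / q) * omega k q f (Omega x k m j)))" for p
    have ex: "0 \<le> omega k q f (Omega x k m j)"
      "\<exists>P. degree P \<le> d \<and> (\<integral>\<^sup>+y\<in>{x m (j - int d)..x m (j + int d)}. ennreal (cmod (f y - poly P (of_real y))) \<partial>lebesgue) \<le> ennreal (e (m, j) * len m j)"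
      for m j
    proof -
      let ?a = "x m (j - int d)" and ?b = "x m (j + int d)" and ?B = "x m (j + int k)"
      \<comment> \<open>The margin \<open>k * (k + 1) * \<delta>\<close> becomes
        \<open>len m j / lam\<close>, which is at most the length of the last cell of
        \<open>Omega\<close>.\<close>
      define \<delta> where "\<delta> = len m j / (lam * (real k * real (k + 1)))"
      have kk: "0 < real k * real (k + 1)" using kd by simp
      have \<delta>: "0 < \<delta>" using kk assms(6) by (simp add: \<delta>_def)
      have ab: "?a < ?b" using kd by simp
      have Om: "Omega x k m j = {?a..?B}" using kd by (simp add: Omega_def algebra_simps)
      have "real k * real (k + 1) * \<delta> = len m j / lam" using kd by (simp add: \<delta>_def)
      also have "\<dots> \<le> len m (j + int d)" using len_le[of m j "j + int d"] assms(6) by (simp add: field_simps)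
      also have "\<dots> = ?B - ?b" using kd by (simp add: cell_length_def algebra_simps)
      finally have B: "?b + real k * real (k + 1) * \<delta> \<le> ?B" by simp
      have k_pos: "1 \<le> k" using kd by simp
      note bl = besov_local_polynomial[OF fq assms(4) k_pos \<delta> ab B]
      show \<Omega>: "0 \<le> omega k q f (Omega x k m j)" unfolding Om by (rule bl(1))
      obtain P where P: "degree P \<le> k - 1" "(\<integral>\<^sup>+y\<in>{?a..?b}. ennreal (cmod (f y - poly P (of_real y))) \<partial>lebesgue)
         \<le> ennreal (2 * ((1 + 2 ^ k * ((?b - ?a) / \<delta>) ^ Suc k) * (2 * (?B - ?a) powr (1 - 1 / q) * omega k q f {?a..?B})))"
        using bl(2) by blast
      have "2 * ((1 + 2 ^ k * ((?b - ?a) / \<delta>) ^ Suc k) * (2 * (?B - ?a) powr (1 - 1 / q) * omega k q f {?a..?B})) \<le> e (m, j) * len m j"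
      proof -
        have "\<bar>?b - ?a\<bar> \<le> real (2 * d) * lam * len m j" by (rule knot_dist) simp
        then have "(?b - ?a) / \<delta> \<le> real (2 * d) * lam * len m j / \<delta>" using \<delta> by (intro divide_right_mono) auto
        also have "\<dots> = Z"
        proof -
          have "len m j \<noteq> 0" using len_pos[of m j] by linarith
          then show ?thesis by (simp add: Z_def \<delta>_def)
        qed
        finally have 1: "(?b - ?a) / \<delta> \<le> Z" .
        have 2: "0 \<le> (?b - ?a) / \<delta>" using ab \<delta> by (simp add: less_imp_le)
        have aB: "?a < ?B" using kd by simp
        have "\<bar>?B - ?a\<bar> \<le> real (2 * d + 1) * lam * len m j" using kd by (intro knot_dist) simp
        then have "(?B - ?a) powr (1 - 1 / q) \<le> (real (2 * d + 1) * lam * len m j) powr (1 - 1 / q)"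
          using aB assms(4) by (intro powr_mono2) auto
        also have "\<dots> = (real (2 * d + 1) * lam) powr (1 - 1 / q) * len m j powr (1 - 1 / q)" by (rule powr_mult)
        finally have 3: "(?B - ?a) powr (1 - 1 / q) \<le> (real (2 * d + 1) * lam) powr (1 - 1 / q) * len m j powr (1 - 1 / q)" .
        have 4: "len m j powr (1 - 1 / q) = len m j powr (- 1 / q) * len m j"
        proof -
          have "len m j powr (1 - 1 / q) = len m j powr (- 1 / q + 1)" by (simp add: add.commute)
          then show ?thesis by (simp only: powr_add) simp
        qed
        have "2 * ((1 + 2 ^ k * ((?b - ?a) / \<delta>) ^ Suc k) * (2 * (?B - ?a) powr (1 - 1 / q) * omega k q f {?a..?B}))
          \<le> 2 * ((1 + 2 ^ k * Z ^ Suc k) * (2 * ((real (2 * d + 1) * lam) powr (1 - 1 / q) * len m j powr (1 - 1 / q)) * omega k q f {?a..?B}))"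
          by (rule approximation_constant_mono[OF 2 1 powr_ge_zero 3 bl(1)])
        also have "\<dots> = e (m, j) * len m j" unfolding 4 by (simp add: e_def Ce_def Om)
        finally show ?thesis .
      qed
      then show "\<exists>P. degree P \<le> d \<and> (\<integral>\<^sup>+y\<in>{?a..?b}. ennreal (cmod (f y - poly P (of_real y))) \<partial>lebesgue) \<le> ennreal (e (m, j) * len m j)"
        using P order_trans[OF P(2) ennreal_leI] unfolding d_def by blast
    qed
    define P where "P m j = (SOME P. degree P \<le> d \<and> (\<integral>\<^sup>+y\<in>{x m (j - int d)..x m (j + int d)}.
        ennreal (cmod (f y - poly P (of_real y))) \<partial>lebesgue) \<le> ennreal (e (m, j) * len m j))" for m j
    have P: "degree (P m j) \<le> d"
      "(\<integral>\<^sup>+y\<in>{x m (j - int d)..x m (j + int d)}. ennreal (cmod (f y - poly (P m j) (of_real y))) \<partial>lebesgue) \<le> ennreal (e (m, j) * len m j)" for m j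
      unfolding P_def using someI_ex[OF ex(2)[of m j]] by blast+
    have e0: "0 \<le> e p" for p using ex(1) Ce by (auto simp: e_def split: prod.split)
    have et: "e p powr \<tau> = Ce powr \<tau> * besov_term x k q \<tau> f p" for p
      by (simp add: e_def besov_term_def powr_mult split: prod.split)
    have es: "(\<lambda>p. e p powr \<tau>) summable_on UNIV" unfolding et using fs by (intro summable_on_cmult_right)
    have eS: "(\<Sum>\<^sub>\<infinity>p. e p powr \<tau>) = Ce powr \<tau> * S" unfolding et S_def by (intro infsum_cmult_right fs)
    have S0: "0 \<le> S" unfolding S_def by (intro infsum_nonneg) (auto simp: besov_term_def)
    interpret spline_decomposition M0 lam x d f P e \<tau> CN
      by unfold_locales (fact kd Lq_loc_locally_integrable[OF fq assms(4)] P e0 tau_inv es CN)+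
    define w where "w = (\<Sum>\<^sub>\<infinity>p. cmod (b p) powr \<tau>)"
    have wS: "2 * w \<le> H * S"
    proof -
      have "w \<le> CE * (Ce powr \<tau> * S)" using b_infsum by (simp add: w_def eS)
      also have "\<dots> \<le> CEv * (Ce powr \<tau> * S)" using S0 by (intro mult_right_mono) (auto simp: CEv_def)
      finally show ?thesis by (simp add: H_def mult.assoc)
    qed
    define F where "F y = f y - poly PP (of_real y)" for y
    have Fl: "locally_integrable F" unfolding F_def[abs_def]
      by (rule locally_integrable_diff[OF f]) (intro continuous_intros)
    \<comment> \<open>The shift \<open>s\<close> provides for the canonical representatives other
      than \<open>F\<close>, which differ from it by constants.\<close>
    have approx_shift: "\<exists>\<Lambda>. finite \<Lambda> \<and> real (card \<Lambda>) \<le> H * S / \<theta> \<and>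
        (\<forall>s. bmo_norm (\<lambda>y. F y + s - g \<Lambda> y) \<le> ennreal (2 * (CFv * \<theta> powr \<alpha>)))" if \<theta>: "0 < \<theta>" for \<theta>
    proof -
      obtain \<Lambda> where \<Lambda>: "finite \<Lambda>" "real (card \<Lambda>) \<le> 2 * w / \<theta>"
        "\<And>u v. u < v \<Longrightarrow> \<exists>\<kappa>. (\<integral>\<^sup>+y\<in>{u..v}. ennreal (cmod (F y - g \<Lambda> y - \<kappa>)) \<partial>lebesgue)
        \<le> ennreal (CF * \<theta> powr \<alpha> * (v - u))"
        using sparse_approximation[OF \<theta>] unfolding w_def[symmetric] tau_inv(2) F_def by blast
      have "bmo_norm (\<lambda>y. F y + s - g \<Lambda> y) \<le> ennreal (2 * (CFv * \<theta> powr \<alpha>))" for s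
      proof (rule bmo_norm_le)
        show "locally_integrable (\<lambda>y. F y + s - g \<Lambda> y)"
        proof -
          have "continuous_on UNIV (\<lambda>y. g \<Lambda> y - s)" by (intro continuous_intros g_continuous)
          from locally_integrable_diff[OF Fl this] show ?thesis by (simp add: algebra_simps)
        qed
        show "0 \<le> CFv * \<theta> powr \<alpha>" by (simp add: CFv_def)
        fix u v :: real assume uv: "u < v"
        obtain \<kappa> where "(\<integral>\<^sup>+y\<in>{u..v}. ennreal (cmod (F y - g \<Lambda> y - \<kappa>)) \<partial>lebesgue) \<le> ennreal (CF * \<theta> powr \<alpha> * (v - u))"
          using \<Lambda>(3)[OF uv] by blast
        also have "\<dots> \<le> ennreal (CFv * \<theta> powr \<alpha> * (v - u))"
          using uv by (intro ennreal_leI mult_right_mono) (auto simp: CFv_def)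
        finally have "(\<integral>\<^sup>+y\<in>{u..v}. ennreal (cmod (F y + s - g \<Lambda> y - (\<kappa> + s))) \<partial>lebesgue) \<le> ennreal (CFv * \<theta> powr \<alpha> * (v - u))"
          by (simp add: algebra_simps)
        then show "\<exists>\<kappa>. (\<integral>\<^sup>+y\<in>{u..v}. ennreal (cmod (F y + s - g \<Lambda> y - \<kappa>)) \<partial>lebesgue) \<le> ennreal (CFv * \<theta> powr \<alpha> * (v - u))"
          by blast
      qed
      moreover have "2 * w / \<theta> \<le> H * S / \<theta>" using wS \<theta> by (intro divide_right_mono) auto
      ultimately show ?thesis using \<Lambda>(1,2) by (intro exI[of _ \<Lambda>]) auto
    qed
    have FB: "F \<in> BMO"
    proof -
      \<comment> \<open>For this \<theta> fewer than one term is selected, that is, none, and the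
        bound is one for \<open>F\<close> itself.\<close>
      have \<theta>: "0 < H * S + 1" using H S0 by (simp add: add_nonneg_pos)
      obtain \<Lambda> where \<Lambda>: "finite \<Lambda>" "real (card \<Lambda>) \<le> H * S / (H * S + 1)"
        "\<And>s. bmo_norm (\<lambda>y. F y + s - g \<Lambda> y) \<le> ennreal (2 * (CFv * (H * S + 1) powr \<alpha>))"
        using approx_shift[OF \<theta>] by blast
      have "H * S / (H * S + 1) < 1" using \<theta> by simp
      then have "card \<Lambda> = 0" using \<Lambda>(2) by linarith
      then have "\<Lambda> = {}" using \<Lambda>(1) by simp
      then have "bmo_norm F \<le> ennreal (2 * (CFv * (H * S + 1) powr \<alpha>))"
        using \<Lambda>(3)[of 0] by (simp add: g_def)
      then have "bmo_norm F < \<infinity>" by (rule le_less_trans) simp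
      then show ?thesis using Fl by (simp add: BMO_def)
    qed
    have FV: "F \<in> VMO"
    proof -
      have "\<exists>h\<in>C0. bmo_norm (\<lambda>y. F y - h y) < ennreal \<epsilon>" if \<epsilon>: "0 < \<epsilon>" for \<epsilon>
      proof -
        \<comment> \<open>Chosen so that the bound \<open>2 * (CFv * \<theta> powr \<alpha>)\<close>
          equals \<open>\<epsilon> / 2\<close>.\<close>
        define \<theta> where "\<theta> = (\<epsilon> / (4 * CFv)) powr (1 / \<alpha>)"
        have CFv: "0 < CFv" by (simp add: CFv_def)
        have \<theta>: "0 < \<theta>" "\<theta> powr \<alpha> = \<epsilon> / (4 * CFv)" using \<epsilon> CFv assms(1) by (simp_all add: \<theta>_def powr_powr)
        obtain \<Lambda> where \<Lambda>: "finite \<Lambda>" "\<And>s. bmo_norm (\<lambda>y. F y + s - g \<Lambda> y) \<le> ennreal (2 * (CFv * \<theta> powr \<alpha>))"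
          using approx_shift[OF \<theta>(1)] by blast
        have "bmo_norm (\<lambda>y. F y - g \<Lambda> y) \<le> ennreal (\<epsilon> / 2)"
          using \<Lambda>(2)[of 0] CFv by (simp add: \<theta>(2))
        also have "\<dots> < ennreal \<epsilon>" using \<epsilon> by (simp add: ennreal_lessI)
        finally show ?thesis using g_C0[OF \<Lambda>(1)] by blast
      qed
      then show ?thesis using FB by (simp add: VMO_def)
    qed
    have "F \<in> canonical_reps k f"
      unfolding canonical_reps_def mem_Collect_eq
      unfolding k1 by (intro conjI FV exI[of _ PP] degPP) (simp only: F_def[abs_def])
    moreover have "h \<in> VMO \<and> (\<forall>n::nat. n \<ge> 1 \<longrightarrow> sigma_n_BMO x k n h \<le> ennreal (c * real n powr (- \<alpha>) * besov_norm x k q \<tau> h))"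
      if h: "h \<in> canonical_reps k f" for h
    proof (intro conjI allI impI)
      show hV: "h \<in> VMO" using h by (simp add: canonical_reps_def)
      obtain R where R: "degree R \<le> k - 1" "h = (\<lambda>y. f y - poly R (of_real y))"
        using h by (auto simp: canonical_reps_def)
      have hB: "locally_integrable h" "bmo_norm h < \<infinity>" using hV by (auto simp: VMO_def BMO_def)
      \<comment> \<open>Two representatives differ by a polynomial of finite BMO norm, hence by a
        constant.\<close>
      have "bmo_norm (\<lambda>y. h y - F y) < \<infinity>"
        using FB hB by (intro bmo_norm_diff_finite) (auto simp: BMO_def)
      moreover have "(\<lambda>y. h y - F y) = (\<lambda>y. poly (PP - R) (of_real y))"
        by (rule ext) (simp add: R F_def)
      ultimately have "degree (PP - R) = 0" by (intro poly_BMO_const) simp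
      then obtain s where s: "PP - R = [:s:]" by (rule degree_eq_zeroE)
      have hF: "h y = F y + s" for y
      proof -
        have "poly (PP - R) (of_real y) = s" unfolding s by simp
        then show ?thesis by (simp add: R F_def algebra_simps)
      qed
      have norm: "besov_norm x k q \<tau> h = S powr \<alpha>"
      proof -
        have "besov_norm x k q \<tau> h = besov_norm x k q \<tau> f"
          unfolding R(2) using R(1) kd by (intro besov_norm_diff_poly) auto
        then show ?thesis by (simp add: besov_norm_def S_def tau_inv)
      qed
      fix n :: nat assume n: "1 \<le> n"
      \<comment> \<open>At most \<open>n\<close> terms are selected once
        \<open>\<theta> \<ge> H * S / n\<close>. Equality is the best choice, except that for
        \<open>S = 0\<close> it would make \<theta> zero; there \<theta> tends to zero
        instead.\<close>
      have step: "sigma_n_BMO x k n h \<le> ennreal (2 * (CFv * \<theta> powr \<alpha>))" if \<theta>: "0 < \<theta>" "H * S / real n \<le> \<theta>" for \<theta>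
      proof -
        obtain \<Lambda> where \<Lambda>: "finite \<Lambda>" "real (card \<Lambda>) \<le> H * S / \<theta>"
          "\<And>s. bmo_norm (\<lambda>y. F y + s - g \<Lambda> y) \<le> ennreal (2 * (CFv * \<theta> powr \<alpha>))"
          using approx_shift[OF \<theta>(1)] by blast
        have "H * S / \<theta> \<le> real n" using \<theta> n by (simp add: field_simps)
        then have card: "card \<Lambda> \<le> n" using \<Lambda>(2) by linarith
        have "g \<Lambda> \<in> Sigma_n x k n" unfolding Sigma_n_def mem_Collect_eq
          by (intro exI[of _ \<Lambda>] exI[of _ b] conjI \<Lambda>(1) card) (simp only: g_def[abs_def] k1)
        then have "sigma_n_BMO x k n h \<le> bmo_norm (\<lambda>y. h y - g \<Lambda> y)"
          unfolding sigma_n_BMO_def by (rule INF_lower)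
        also have "\<dots> \<le> ennreal (2 * (CFv * \<theta> powr \<alpha>))" unfolding hF by (rule \<Lambda>(3))
        finally show ?thesis .
      qed
      show "sigma_n_BMO x k n h \<le> ennreal (c * real n powr (- \<alpha>) * besov_norm x k q \<tau> h)"
      proof (cases "S = 0")
        case True
        have "sigma_n_BMO x k n h \<le> 0"
        proof (rule ennreal_le_epsilon)
          fix \<epsilon> :: real assume \<epsilon>: "0 < \<epsilon>"
          define \<theta> where "\<theta> = (\<epsilon> / (2 * CFv)) powr (1 / \<alpha>)"
          have CFv: "0 < CFv" by (simp add: CFv_def)
          have \<theta>: "0 < \<theta>" "\<theta> powr \<alpha> = \<epsilon> / (2 * CFv)" using \<epsilon> CFv assms(1) by (simp_all add: \<theta>_def powr_powr)
          have "2 * (CFv * \<theta> powr \<alpha>) = \<epsilon>" using CFv by (simp add: \<theta>(2))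
          then show "sigma_n_BMO x k n h \<le> 0 + ennreal \<epsilon>" using step[OF \<theta>(1)] True \<theta>(1) by simp
        qed
        then show ?thesis by simp
      next
        case False
        then have S: "0 < S" using S0 by simp
        have "0 < H * S / real n" using H S n by simp
        then have "sigma_n_BMO x k n h \<le> ennreal (2 * (CFv * (H * S / real n) powr \<alpha>))" by (rule step) simp
        also have "2 * (CFv * (H * S / real n) powr \<alpha>) = c * real n powr (- \<alpha>) * besov_norm x k q \<tau> h"
          unfolding norm c_def using H S n by (simp add: powr_divide powr_mult powr_minus_divide)
        finally show ?thesis .
      qed
    qed
    ultimately show ?thesis by (intro conjI ballI) auto
  qed
  show ?thesis using c main by blast
qed

end
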